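(* Let $E$ be a Dedekind complete real Banach lattice such that its centre $\mathcal Z(E)$ is normal. Take $T\in\mathcal Z(E_{\mathbb C})$. There exists a unique spectral Borel measure $\mu_T\colon\mathcal B(\sigma(T))\to\mathcal Z(E)^+$ with $\mu_T(\sigma(T))=I$ such that $$T=\int_{\sigma(T)}^{o}\mathrm{id}\,d\mu_T,$$ where $\mathrm{id}$ is the identity function on $\sigma(T)$. It is a regular Borel measure, and $\mu_T(\Delta)$ is an order projection for every $\Delta\in\mathcal B(\sigma(T))$. Furthermore, $\mu_T(V)>0$ for every non-empty (relatively) open subset $V$ of $\sigma(T)$.
   Context: Operators are linear; $I$ is the identity operator. For a Dedekind complete real Banach lattice $E$, the complexification $E_{\mathbb C}=E+iE$ carries the modulus $|x+iy|=\sup_{\theta}(x\cos\theta+y\sin\theta)$ and the norm $\lVert z\rVert=\lVert\,|z|\,\rVert$. $L_r(E)$ is the Dedekind complete vector lattice of regular operators on $E$, $L_r(E_{\mathbb C})=L_r(E)+iL_r(E)$, and for $T=R+iS$ with $R,S\in L_r(E)$, $|T|=\sup_\theta(R\cos\theta+S\sin\theta)$. The centres are $\mathcal Z(E)=\{T\in L_r(E):|T|\le\lambda I\text{ for some }\lambda\ge0\}$ (a Dedekind complete vector lattice and an algebra under composition) and $\mathcal Z(E_{\mathbb C})=\{T\in L_r(E_{\mathbb C}):|T|\le\lambda I\text{ for some }\lambda\ge0\}=\mathcal Z(E)+i\mathcal Z(E)$. $\sigma(T)$ is the spectrum of $T$ as a bounded operator on $E_{\mathbb C}$, which coincides with its spectrum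 in the algebra $\mathcal Z(E_{\mathbb C})$. A real vector lattice is normal when its order continuous dual (the order continuous order bounded functionals) separates its points. $\mathcal B(\cdot)$ denotes the Borel $\sigma$-algebra. Measures and integrals: let $F$ be a Dedekind complete real vector lattice (here $F=\mathcal Z(E)$). An $F$-valued measure on a $\sigma$-algebra $\Omega$ is a map $\mu\colon\Omega\to F^+$ with $\mu(\emptyset)=0$ and $\mu(\bigcup_n\Delta_n)=\sup_N\sum_{n=1}^N\mu(\Delta_n)$ for pairwise disjoint sequences $(\Delta_n)$ in $\Omega$; it is a Borel measure when $\Omega$ is a Borel $\sigma$-algebra. When $F$ is also an associative algebra, $\mu$ is spectral when $\mu(\Delta_1\cap\Delta_2)=\mu(\Delta_1)\mu(\Delta_2)$ for all $\Delta_1,\Delta_2\in\Omega$. The order integral of $\varphi=\sum_{i=1}^n r_i\chi_{\Delta_i}$ with $r_i\ge0$, $\Delta_i\in\Omega$ is $\int^o\varphi\,d\mu=\sum_i r_i\mu(\Delta_i)$; for bounded measurable $f\ge0$, $\int^o f\,d\mu=\sup_n\int^o\varphi_n\,d\mu$ for any sequence of such functions $\varphi_n\uparrow f$ pointwise (independent of the choice); for bounded measurable real $f$, $\int^o f\,d\mu=\int^o f^+d\mu-\int^o f^-d\mu$; and for bounded measurable complex $f$, $\int^o f\,d\mu=\int^o\operatorname{Re}f\,d\mu+i\int^o\operatorname{Im}f\,d\mu\in F_{\mathbb C}$. For a compact Hausdorff space $X$, a measure $\mu\colon\mathcal B(X)\to F^+$ is a regular Borel measure when $\mu(V)=\sup\{\mu(K):K\subseteq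 V\text{ compact}\}$ for all open $V$ and $\mu(\Delta)=\inf\{\mu(V):V\supseteq\Delta\text{ open}\}$ for all $\Delta\in\mathcal B(X)$. An order projection is a band projection, i.e., an operator $P$ with $P^2=P$ and $0\le P\le I$. *)

theory Defs
  imports "HOL-Analysis.Analysis"
begin

section \<open>Dedekind complete Banach lattices and operators on them\<close>

class dedekind_complete_banach_lattice =
  banach + ordered_real_vector + conditionally_complete_lattice +
  assumes norm_mono_modulus: "sup x (- x) \<le> sup y (- y) \<Longrightarrow> norm x \<le> norm y"

text \<open>
  Operators are plain functions, and the pointwise order that the library puts on the function
  type is not the operator order. The order is therefore the explicit relation \<open>op_le\<close>, and a
  vector lattice of operators is given by its carrier \<open>F\<close>: suprema, infima, moduli and functionals
  are always taken relative to such an \<open>F\<close>.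
\<close>

definition op_le :: "('a::dedekind_complete_banach_lattice \<Rightarrow> 'a) \<Rightarrow> ('a \<Rightarrow> 'a) \<Rightarrow> bool"
  where "op_le S T \<longleftrightarrow> (\<forall>x\<ge>0. S x \<le> T x)"

definition regular_ops :: "('a::dedekind_complete_banach_lattice \<Rightarrow> 'a) set"
  where "regular_ops =
    {T. \<exists>P Q. linear P \<and> linear Q \<and> op_le (\<lambda>_. 0) P \<and> op_le (\<lambda>_. 0) Q \<and> T = (\<lambda>x. P x - Q x)}"

definition is_sup_in ::
    "('a::dedekind_complete_banach_lattice \<Rightarrow> 'a) set \<Rightarrow> ('a \<Rightarrow> 'a) set \<Rightarrow> ('a \<Rightarrow> 'a) \<Rightarrow> bool"
  where "is_sup_in F A U \<longleftrightarrow>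
    U \<in> F \<and> (\<forall>T\<in>A. op_le T U) \<and> (\<forall>V\<in>F. (\<forall>T\<in>A. op_le T V) \<longrightarrow> op_le U V)"

definition is_inf_in ::
    "('a::dedekind_complete_banach_lattice \<Rightarrow> 'a) set \<Rightarrow> ('a \<Rightarrow> 'a) set \<Rightarrow> ('a \<Rightarrow> 'a) \<Rightarrow> bool"
  where "is_inf_in F A U \<longleftrightarrow>
    U \<in> F \<and> (\<forall>T\<in>A. op_le U T) \<and> (\<forall>V\<in>F. (\<forall>T\<in>A. op_le V T) \<longrightarrow> op_le V U)"

definition is_modulus_in ::
    "('a::dedekind_complete_banach_lattice \<Rightarrow> 'a) set \<Rightarrow> ('a \<Rightarrow> 'a) \<Rightarrow> ('a \<Rightarrow> 'a) \<Rightarrow> bool"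
  where "is_modulus_in F T U \<longleftrightarrow> is_sup_in F {T, \<lambda>x. - T x} U"

definition center :: "('a::dedekind_complete_banach_lattice \<Rightarrow> 'a) set"
  where "center =
    {T \<in> regular_ops. \<exists>U c. is_modulus_in regular_ops T U \<and> 0 \<le> c \<and> op_le U (\<lambda>x. c *\<^sub>R x)}"

definition order_projection :: "('a::dedekind_complete_banach_lattice \<Rightarrow> 'a) \<Rightarrow> bool"
  where "order_projection P \<longleftrightarrow> linear P \<and> P \<circ> P = P \<and> op_le (\<lambda>_. 0) P \<and> op_le P id"


section \<open>The complexification\<close>

text \<open>
  The pair \<open>(x, y)\<close> stands for \<open>x + iy\<close>. The norm of the complexification is \<open>complex_norm\<close>,
  not the library's norm on the product type.
\<close>

definition complex_modulus :: "'a::dedekind_complete_banach_lattice \<times> 'a \<Rightarrow> 'a"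
  where "complex_modulus z = (SUP \<theta>::real. cos \<theta> *\<^sub>R fst z + sin \<theta> *\<^sub>R snd z)"

definition complex_norm :: "'a::dedekind_complete_banach_lattice \<times> 'a \<Rightarrow> real"
  where "complex_norm z = norm (complex_modulus z)"

definition complex_scale ::
    "complex \<Rightarrow> 'a::dedekind_complete_banach_lattice \<times> 'a \<Rightarrow> 'a \<times> 'a"
  where "complex_scale c z =
    (Re c *\<^sub>R fst z - Im c *\<^sub>R snd z, Re c *\<^sub>R snd z + Im c *\<^sub>R fst z)"

definition bounded_complex_op ::
    "('a::dedekind_complete_banach_lattice \<times> 'a \<Rightarrow> 'a \<times> 'a) \<Rightarrow> bool"
  where "bounded_complex_op B \<longleftrightarrow>
    (\<forall>z w. B (z + w) = B z + B w) \<and> (\<forall>c z. B (complex_scale c z) = complex_scale c (B z)) \<and>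
    (\<exists>K. \<forall>z. complex_norm (B z) \<le> K * complex_norm z)"

definition spectrum ::
    "('a::dedekind_complete_banach_lattice \<times> 'a \<Rightarrow> 'a \<times> 'a) \<Rightarrow> complex set"
  where "spectrum T = {c. \<not> (\<exists>B. bounded_complex_op B \<and>
    (\<forall>z. B (T z - complex_scale c z) = z) \<and> (\<forall>z. T (B z) - complex_scale c (B z) = z))}"

text \<open>The operator \<open>R + iS\<close> on the complexification.\<close>

definition complex_op ::
    "('a::dedekind_complete_banach_lattice \<Rightarrow> 'a) \<Rightarrow> ('a \<Rightarrow> 'a) \<Rightarrow> 'a \<times> 'a \<Rightarrow> 'a \<times> 'a"
  where "complex_op R S z = (R (fst z) - S (snd z), R (snd z) + S (fst z))"

definition complex_center :: "('a::dedekind_complete_banach_lattice \<times> 'a \<Rightarrow> 'a \<times> 'a) set"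
  where "complex_center =
    {complex_op R S | R S. R \<in> regular_ops \<and> S \<in> regular_ops \<and>
      (\<exists>U c. is_sup_in regular_ops (range (\<lambda>\<theta>::real. \<lambda>x. cos \<theta> *\<^sub>R R x + sin \<theta> *\<^sub>R S x)) U \<and>
        0 \<le> c \<and> op_le U (\<lambda>x. c *\<^sub>R x))}"


section \<open>Normality\<close>

text \<open>
  Nets are rendered as filters: a net in \<open>F\<close> and the filter generated by its tails have the same
  order limits and the same limits under functionals. The set \<open>D\<close> is the range of the dominating
  net that decreases to zero.
\<close>

definition order_null ::
    "('a::dedekind_complete_banach_lattice \<Rightarrow> 'a) set \<Rightarrow> ('a \<Rightarrow> 'a) filter \<Rightarrow> bool"
  where "order_null F \<F> \<longleftrightarrow>
    (\<exists>D\<subseteq>F. D \<noteq> {} \<and> (\<forall>A\<in>D. \<forall>B\<in>D. \<exists>C\<in>D. op_le C A \<and> op_le C B) \<and> is_inf_in F D (\<lambda>_. 0) \<and>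
      (\<forall>A\<in>D. \<forall>\<^sub>F T in \<F>. T \<in> F \<and> (\<exists>U. is_modulus_in F T U \<and> op_le U A)))"

text \<open>Functionals on \<open>F\<close> are total functions of which only the values on \<open>F\<close> matter.\<close>

definition order_continuous_dual ::
    "('a::dedekind_complete_banach_lattice \<Rightarrow> 'a) set \<Rightarrow> (('a \<Rightarrow> 'a) \<Rightarrow> real) set"
  where "order_continuous_dual F = {f.
    (\<forall>S\<in>F. \<forall>T\<in>F. f (\<lambda>x. S x + T x) = f S + f T) \<and>
    (\<forall>r. \<forall>T\<in>F. f (\<lambda>x. r *\<^sub>R T x) = r * f T) \<and>
    (\<forall>A\<in>F. \<forall>B\<in>F. bounded (f ` {T\<in>F. op_le A T \<and> op_le T B})) \<and>
    (\<forall>\<F>. order_null F \<F> \<longrightarrow> (f \<longlongrightarrow> 0) \<F>)}"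

definition normal_lattice :: "('a::dedekind_complete_banach_lattice \<Rightarrow> 'a) set \<Rightarrow> bool"
  where "normal_lattice F \<longleftrightarrow>
    (\<forall>S\<in>F. \<forall>T\<in>F. S \<noteq> T \<longrightarrow> (\<exists>f\<in>order_continuous_dual F. f S \<noteq> f T))"


section \<open>Measures with values in a vector lattice of operators\<close>

text \<open>
  The argument \<open>M\<close> only supplies a measurable space; its own measure plays no role.
\<close>

definition op_measure ::
    "('a::dedekind_complete_banach_lattice \<Rightarrow> 'a) set \<Rightarrow> 'x measure \<Rightarrow> ('x set \<Rightarrow> 'a \<Rightarrow> 'a) \<Rightarrow> bool"
  where "op_measure F M \<mu> \<longleftrightarrow>
    (\<forall>\<Delta>\<in>sets M. \<mu> \<Delta> \<in> F \<and> op_le (\<lambda>_. 0) (\<mu> \<Delta>)) \<and> \<mu> {} = (\<lambda>_. 0) \<and>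
    (\<forall>\<Delta>::nat \<Rightarrow> 'x set. range \<Delta> \<subseteq> sets M \<longrightarrow> disjoint_family \<Delta> \<longrightarrow>
      is_sup_in F (range (\<lambda>N x. \<Sum>n\<le>N. \<mu> (\<Delta> n) x)) (\<mu> (\<Union>n. \<Delta> n)))"

definition spectral ::
    "'x measure \<Rightarrow> ('x set \<Rightarrow> 'a::dedekind_complete_banach_lattice \<Rightarrow> 'a) \<Rightarrow> bool"
  where "spectral M \<mu> \<longleftrightarrow> (\<forall>\<Delta>\<^sub>1\<in>sets M. \<forall>\<Delta>\<^sub>2\<in>sets M. \<mu> (\<Delta>\<^sub>1 \<inter> \<Delta>\<^sub>2) = \<mu> \<Delta>\<^sub>1 \<circ> \<mu> \<Delta>\<^sub>2)"

text \<open>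
  In the style of the library's \<open>has_integral\<close>, the order integral is a relation between a function
  and the value of its integral; the choices of a representation of a simple function
  and of an approximating sequence are existentially quantified.
\<close>

definition has_simple_order_integral ::
    "'x measure \<Rightarrow> ('x set \<Rightarrow> 'a::dedekind_complete_banach_lattice \<Rightarrow> 'a) \<Rightarrow>
      ('x \<Rightarrow> real) \<Rightarrow> ('a \<Rightarrow> 'a) \<Rightarrow> bool"
  where "has_simple_order_integral M \<mu> \<phi> J \<longleftrightarrow>
    (\<exists>(n::nat) r \<Delta>. (\<forall>i<n. 0 \<le> r i \<and> \<Delta> i \<in> sets M) \<and>
      (\<forall>t\<in>space M. \<phi> t = (\<Sum>i<n. r i * indicator (\<Delta> i) t)) \<and>
      J = (\<lambda>x. \<Sum>i<n. r i *\<^sub>R \<mu> (\<Delta> i) x))"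

definition has_nonneg_order_integral ::
    "('a::dedekind_complete_banach_lattice \<Rightarrow> 'a) set \<Rightarrow> 'x measure \<Rightarrow> ('x set \<Rightarrow> 'a \<Rightarrow> 'a) \<Rightarrow>
      ('x \<Rightarrow> real) \<Rightarrow> ('a \<Rightarrow> 'a) \<Rightarrow> bool"
  where "has_nonneg_order_integral F M \<mu> f J \<longleftrightarrow>
    (\<exists>\<phi> L. (\<forall>k::nat. has_simple_order_integral M \<mu> (\<phi> k) (L k)) \<and>
      (\<forall>t\<in>space M. incseq (\<lambda>k. \<phi> k t) \<and> (\<lambda>k. \<phi> k t) \<longlonglongrightarrow> f t) \<and>
      is_sup_in F (range L) J)"

definition has_real_order_integral ::
    "('a::dedekind_complete_banach_lattice \<Rightarrow> 'a) set \<Rightarrow> 'x measure \<Rightarrow> ('x set \<Rightarrow> 'a \<Rightarrow> 'a) \<Rightarrow>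
      ('x \<Rightarrow> real) \<Rightarrow> ('a \<Rightarrow> 'a) \<Rightarrow> bool"
  where "has_real_order_integral F M \<mu> f J \<longleftrightarrow>
    (\<exists>P N. has_nonneg_order_integral F M \<mu> (\<lambda>t. max (f t) 0) P \<and>
      has_nonneg_order_integral F M \<mu> (\<lambda>t. max (- f t) 0) N \<and> J = (\<lambda>x. P x - N x))"

definition has_order_integral ::
    "('a::dedekind_complete_banach_lattice \<Rightarrow> 'a) set \<Rightarrow> 'x measure \<Rightarrow> ('x set \<Rightarrow> 'a \<Rightarrow> 'a) \<Rightarrow>
      ('x \<Rightarrow> complex) \<Rightarrow> ('a \<times> 'a \<Rightarrow> 'a \<times> 'a) \<Rightarrow> bool"
  where "has_order_integral F M \<mu> f J \<longleftrightarrow>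
    f \<in> borel_measurable M \<and> bounded (f ` space M) \<and>
    (\<exists>A B. has_real_order_integral F M \<mu> (\<lambda>t. Re (f t)) A \<and>
      has_real_order_integral F M \<mu> (\<lambda>t. Im (f t)) B \<and> J = complex_op A B)"

abbreviation borel_on :: "'x::topological_space set \<Rightarrow> 'x measure"
  where "borel_on X \<equiv> restrict_space borel X"

text \<open>Used for compact \<open>X\<close> only.\<close>

definition regular_borel_measure ::
    "('a::dedekind_complete_banach_lattice \<Rightarrow> 'a) set \<Rightarrow> 'x::t2_space set \<Rightarrow>
      ('x set \<Rightarrow> 'a \<Rightarrow> 'a) \<Rightarrow> bool"
  where "regular_borel_measure F X \<mu> \<longleftrightarrow>
    op_measure F (borel_on X) \<mu> \<and>
    (\<forall>V. openin (top_of_set X) V \<longrightarrow> is_sup_in F (\<mu> ` {K. compact K \<and> K \<subseteq> V}) (\<mu> V)) \<and>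
    (\<forall>\<Delta>\<in>sets (borel_on X).
      is_inf_in F (\<mu> ` {V. openin (top_of_set X) V \<and> \<Delta> \<subseteq> V}) (\<mu> \<Delta>))"

definition spectral_resolution ::
    "('a::dedekind_complete_banach_lattice \<times> 'a \<Rightarrow> 'a \<times> 'a) \<Rightarrow>
      (complex set \<Rightarrow> 'a \<Rightarrow> 'a) \<Rightarrow> bool"
  where "spectral_resolution T \<mu> \<longleftrightarrow>
    op_measure center (borel_on (spectrum T)) \<mu> \<and> spectral (borel_on (spectrum T)) \<mu> \<and>
    \<mu> (spectrum T) = id \<and> has_order_integral center (borel_on (spectrum T)) \<mu> (\<lambda>t. t) T"

end

theory Submission
  imports Defs "HOL-Library.Lattice_Algebras"
begin

text \<open>
  Write \<open>T = R + iS\<close>. The band projections of \<open>E\<close> form a complete Boolean algebra. For rational \<open>q\<close>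
  attach to the half plane \<open>Re t > q\<close> the smallest band projection off which \<open>R \<le> q\<close>, and treat
  \<open>Im\<close> and \<open>S\<close> alike. This extends to a \<open>\<sigma>\<close>-homomorphism \<open>h\<close> on the Borel sets of the plane: a Borel
  set is the value of a countable infinitary formula in the half planes, and a formula whose value
  in a complete Boolean algebra is nonzero is satisfied at some point (Rasiowa--Sikorski), so
  formulas with equal sets have equal projections.

  On the band of \<open>h A\<close> the operator \<open>R\<close> lies between any lower and upper bound of \<open>Re\<close> on \<open>A\<close>. These
  two-sided bounds are equivalent to \<open>R\<close> being the order integral of \<open>Re\<close>, and they force the value
  of \<open>h\<close> on half planes; this gives existence and uniqueness. The spectrum is the support of \<open>h\<close>:
  near \<open>a + ib\<close> in the support \<open>T - (a + ib)\<close> is arbitrarily small on a nonzero band, and off the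
  support \<open>(R - a)\<^sup>2 + (S - b)\<^sup>2\<close> is bounded below by a positive multiple of the identity, hence
  invertible by a contraction argument.

  Outer regularity rests on normality. If an order continuous functional \<open>f\<close> separates \<open>\<mu> A\<close> from the
  infimum of \<open>\<mu> V\<close> over open \<open>V \<supseteq> A\<close>, then the positive variations of the signed measures \<open>f \<circ> \<mu>\<close> and
  \<open>- f \<circ> \<mu>\<close> are finite Borel measures on the plane, so they are outer regular, a contradiction.
\<close>


section \<open>Vector lattices\<close>

text \<open>The obstacle is that the band projections form a Boolean algebra without points: it can
  be atomless, so two formulas in the half planes with the same planar set cannot be compared inside
  it directly, and a projection might depend on the formula instead of its set. The detour through
  valuations removes this ambiguity. It works with countably many relations between generators,
  which is why the levels are rational; the half planes are strict, so the decisive relation is the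
  right continuity of the levels.

  All estimates on operators take the form \<open>K \<ge> s\<close> or \<open>K \<le> s\<close> on a
  band. Such inequalities pass to arbitrary suprema of bands, so a global one may be checked piece
  by piece, and two contradictory ones force their common band to vanish. A spectral measure with
  total mass \<open>I\<close> has projections as values, so uniqueness is argued in the same Boolean
  algebra.\<close>

instance dedekind_complete_banach_lattice \<subseteq> lattice_ab_group_add ..

context lattice_ab_group_add
begin

lemma le_pprt: "x \<le> pprt x"
  by (simp add: pprt_def)

lemma pprt_diff: "pprt x - pprt (- x) = x"
  using prts[of x] pprt_neg[of x] by simp

lemma inf_pprt_uminus: "inf (pprt x) (pprt (- x)) = 0"
proof -
  have "pprt x + pprt (- x) = sup (sup x 0 + - x) (sup x 0 + 0)"
    unfolding pprt_def by (simp only: add_sup_distrib_left)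
  also have "\<dots> = sup (sup 0 (- x)) (sup x 0)"
    by (simp only: add_sup_distrib_right right_minus add_0_left add_0_right)
  finally have a: "pprt x + pprt (- x) = sup (pprt x) (pprt (- x))"
    by (simp add: pprt_def sup.commute sup.left_commute)
  show ?thesis
    using add_eq_inf_sup[of "pprt x" "pprt (- x)"] a by simp
qed

lemma pprt_add_uminus: "pprt x + pprt (- x) = sup x (- x)"
proof -
  have "pprt x + pprt (- x) = sup (sup x 0 + - x) (sup x 0 + 0)"
    unfolding pprt_def by (simp only: add_sup_distrib_left)
  also have "\<dots> = sup (sup 0 (- x)) (sup x 0)"
    by (simp only: add_sup_distrib_right right_minus add_0_left add_0_right)
  finally have a: "pprt x + pprt (- x) = sup 0 (sup x (- x))"
    by (simp add: sup.commute sup.left_commute)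
  have "0 \<le> pprt x + pprt (- x)" by simp
  \<comment> \<open>Twice the modulus dominates \<open>x + - x = 0\<close>, and in a lattice-ordered
    group an element with nonnegative double is nonnegative.\<close>
  moreover have "0 \<le> sup x (- x)"
  proof -
    have "x + - x \<le> sup x (- x) + sup x (- x)" by (rule add_mono) auto
    then show ?thesis by simp
  qed
  ultimately show ?thesis using a by (simp add: sup_absorb2)
qed

lemma modulus_nonneg: "0 \<le> sup x (- x)"
  using pprt_add_uminus[of x] by (metis add_nonneg_nonneg zero_le_pprt)

lemma modulus_of_nonneg: "0 \<le> x \<Longrightarrow> sup x (- x) = x"
  by (metis pprt_add_uminus pprt_eq_0 pprt_eq_id add_0_right neg_le_0_iff_le)

lemma modulus_add_le: "sup (x + y) (- (x + y)) \<le> sup x (- x) + sup y (- y)"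
proof (rule sup_least)
  show "x + y \<le> sup x (- x) + sup y (- y)" by (rule add_mono) auto
  have "- x + - y \<le> sup x (- x) + sup y (- y)" by (rule add_mono) auto
  then show "- (x + y) \<le> sup x (- x) + sup y (- y)" by simp
qed

text \<open>Distributivity comes from the group structure: by \<open>add_eq_inf_sup\<close> both
  \<open>b\<close> and \<open>c\<close> are at most \<open>d + s - a\<close>, with \<open>d\<close>
  the right-hand side and \<open>s\<close> the join of all three, and the same identity turns
  \<open>inf a (sup b c)\<close> into \<open>a + sup b c - s\<close>.\<close>

lemma inf_sup_distrib_le: "inf a (sup b c) \<le> sup (inf a b) (inf a c)"
proof -
  define d where "d = sup (inf a b) (inf a c)"
  define s where "s = sup a (sup b c)"
  have "b = inf a b + sup a b - a"
    using add_eq_inf_sup[of a b] by (simp add: algebra_simps)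
  also have "\<dots> \<le> d + s - a"
    by (intro diff_right_mono add_mono) (auto simp: d_def s_def intro: le_supI1 le_supI2)
  finally have b: "b \<le> d + s - a" .
  have "c = inf a c + sup a c - a"
    using add_eq_inf_sup[of a c] by (simp add: algebra_simps)
  also have "\<dots> \<le> d + s - a"
    by (intro diff_right_mono add_mono) (auto simp: d_def s_def intro: le_supI1 le_supI2)
  finally have c: "c \<le> d + s - a" .
  have "inf a (sup b c) = a + sup b c - s"
    unfolding s_def add_eq_inf_sup[of a "sup b c"] by (simp only: add_diff_cancel_left')
  also have "\<dots> \<le> a + (d + s - a) - s"
    using b c by (intro diff_right_mono add_left_mono sup_least)
  also have "a + (d + s - a) - s = d"
    using diff_add_cancel[of "d + s" a] by (simp only: add.commute[of a] add_diff_cancel_right')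
  finally show ?thesis by (simp only: d_def)
qed

text \<open>The right-hand side expands into an infimum of four terms, three of which lie above
  \<open>a\<close>. This makes polars closed under addition.\<close>

lemma inf_add_le:
  assumes "0 \<le> u" "0 \<le> v" "0 \<le> a"
  shows "inf (u + v) a \<le> inf u a + inf v a"
proof -
  have "inf u a + inf v a = inf (inf (u + v) (u + a)) (inf (a + v) (a + a))"
    by (simp add: add_inf_distrib_left add_inf_distrib_right inf.commute inf.left_commute)
  moreover have "a \<le> u + a" "a \<le> a + v" "a \<le> a + a"
    using assms by auto
  ultimately show ?thesis
    by (auto intro: le_infI2 le_infI1)
qed

text \<open>Since \<open>sup a b = a + b\<close> for a disjoint pair, such a pair must consist of
  the positive and negative parts of its difference.\<close>

lemma pprt_of_disjoint:
  assumes "inf a b = 0"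
  shows "pprt (a - b) = a"
proof -
  have "pprt (a - b) = sup a b - b"
    by (simp add: pprt_def add_sup_distrib_right diff_conv_add_uminus del: add_uminus_conv_diff)
  also have "\<dots> = a" using add_eq_inf_sup[of a b] assms by (simp add: algebra_simps)
  finally show ?thesis .
qed

end

section \<open>Scalars, norm and positive cone\<close>

lemma scaleR_inf:
  fixes x y :: "'a::dedekind_complete_banach_lattice"
  assumes "0 < r"
  shows "r *\<^sub>R inf x y = inf (r *\<^sub>R x) (r *\<^sub>R y)"
proof (rule antisym)
  show "r *\<^sub>R inf x y \<le> inf (r *\<^sub>R x) (r *\<^sub>R y)"
    using assms by (simp add: scaleR_left_mono)
  have "inverse r *\<^sub>R inf (r *\<^sub>R x) (r *\<^sub>R y) \<le> inverse r *\<^sub>R (r *\<^sub>R x)"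
       "inverse r *\<^sub>R inf (r *\<^sub>R x) (r *\<^sub>R y) \<le> inverse r *\<^sub>R (r *\<^sub>R y)"
    using assms by (intro scaleR_left_mono; simp)+
  then have "inverse r *\<^sub>R inf (r *\<^sub>R x) (r *\<^sub>R y) \<le> inf x y"
    using assms by simp
  then have "r *\<^sub>R (inverse r *\<^sub>R inf (r *\<^sub>R x) (r *\<^sub>R y)) \<le> r *\<^sub>R inf x y"
    using assms by (intro scaleR_left_mono) auto
  then show "inf (r *\<^sub>R x) (r *\<^sub>R y) \<le> r *\<^sub>R inf x y"
    using assms by simp
qed

lemma scaleR_pprt:
  fixes x :: "'a::dedekind_complete_banach_lattice"
  assumes "0 \<le> r"
  shows "pprt (r *\<^sub>R x) = r *\<^sub>R pprt x"
proof (cases "r = 0")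
  case False
  then have r: "0 < r" using assms by simp
  have "r *\<^sub>R x = r *\<^sub>R pprt x - r *\<^sub>R pprt (- x)"
    by (metis pprt_diff scaleR_right_diff_distrib)
  moreover have "inf (r *\<^sub>R pprt x) (r *\<^sub>R pprt (- x)) = 0"
    using scaleR_inf[OF r, of "pprt x" "pprt (- x)"] by (simp add: inf_pprt_uminus)
  ultimately show ?thesis by (simp add: pprt_of_disjoint)
qed simp

lemma norm_mono_nonneg:
  fixes x y :: "'a::dedekind_complete_banach_lattice"
  assumes "0 \<le> x" "x \<le> y"
  shows "norm x \<le> norm y"
  using assms by (intro norm_mono_modulus) (simp add: modulus_of_nonneg order_trans[OF assms])

lemma norm_le_of_modulus_le:
  fixes x y :: "'a::dedekind_complete_banach_lattice"
  assumes "sup x (- x) \<le> y"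
  shows "norm x \<le> norm y"
proof -
  have "0 \<le> y" using assms modulus_nonneg order_trans by blast
  then show ?thesis using assms by (intro norm_mono_modulus) (simp add: modulus_of_nonneg)
qed

lemma norm_modulus:
  fixes x :: "'a::dedekind_complete_banach_lattice"
  shows "norm (sup x (- x)) = norm x"
proof (rule antisym)
  show "norm (sup x (- x)) \<le> norm x"
    by (rule norm_mono_modulus, subst modulus_of_nonneg[OF modulus_nonneg], rule order_refl)
  show "norm x \<le> norm (sup x (- x))"
    by (rule norm_le_of_modulus_le, rule order_refl)
qed

text \<open>The lattice norm supplies the Archimedean property: \<open>pprt (x - y)\<close> is
  dominated by every positive multiple of \<open>pprt z\<close>, so its norm vanishes. The sign of
  \<open>z\<close> is free.\<close>

lemma archimedean_le:
  fixes x y z :: "'a::dedekind_complete_banach_lattice"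
  assumes "\<And>e. 0 < e \<Longrightarrow> x \<le> y + e *\<^sub>R z"
  shows "x \<le> y"
proof -
  have "norm (pprt (x - y)) \<le> e * norm (pprt z)" if "0 < e" for e
  proof -
    have "x - y \<le> e *\<^sub>R z" using assms[OF that] by (simp add: algebra_simps)
    then have "pprt (x - y) \<le> e *\<^sub>R pprt z"
      using pprt_mono[of "x - y" "e *\<^sub>R z"] that by (simp add: scaleR_pprt)
    then have "norm (pprt (x - y)) \<le> norm (e *\<^sub>R pprt z)"
      by (intro norm_mono_nonneg) auto
    then show ?thesis using that by simp
  qed
  then have *: "norm (pprt (x - y)) \<le> e * norm (pprt z)" if "0 < e" for e using that by blast
  have "norm (pprt (x - y)) \<le> 0"
  proof (rule field_le_epsilon)
    fix d :: real assume "0 < d"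
    have "norm (pprt (x - y)) \<le> d / (norm (pprt z) + 1) * norm (pprt z)"
      using \<open>0 < d\<close> by (intro *) (simp add: add_nonneg_pos)
    also have "\<dots> \<le> d"
    proof -
      have "norm (pprt z) / (norm (pprt z) + 1) \<le> 1" by (simp add: add_nonneg_pos)
      then have "d * (norm (pprt z) / (norm (pprt z) + 1)) \<le> d * 1"
        using \<open>0 < d\<close> by (intro mult_left_mono) auto
      then show ?thesis by simp
    qed
    finally show "norm (pprt (x - y)) \<le> 0 + d" by simp
  qed
  then have "x - y \<le> 0" by (simp add: le_zero_iff_zero_pprt)
  then show ?thesis by simp
qed

lemma archimedean_le_nat:
  fixes x y z :: "'a::dedekind_complete_banach_lattice"
  assumes "0 \<le> z" "\<And>n::nat. x \<le> y + (1 / real (Suc n)) *\<^sub>R z"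
  shows "x \<le> y"
proof (rule archimedean_le)
  fix e :: real assume "0 < e"
  then obtain n where n: "inverse (real (Suc n)) < e" using reals_Archimedean by blast
  then have "(1 / real (Suc n)) *\<^sub>R z \<le> e *\<^sub>R z"
    using assms(1) by (intro scaleR_right_mono) (auto simp: inverse_eq_divide)
  then show "x \<le> y + e *\<^sub>R z" using assms(2)[of n] by (meson add_left_mono order_trans)
qed

lemma archimedean_le_pow2:
  fixes x y z :: "'a::dedekind_complete_banach_lattice"
  assumes "0 \<le> z" "\<And>n::nat. x \<le> y + (1 / 2 ^ n) *\<^sub>R z"
  shows "x \<le> y"
proof (rule archimedean_le)
  fix e :: real assume "0 < e"
  then obtain n where n: "(1 / 2) ^ n < e"
    using real_arch_pow_inv[of e "1 / 2"] by auto
  then have "(1 / 2 ^ n) *\<^sub>R z \<le> e *\<^sub>R z"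
    using assms(1) by (intro scaleR_right_mono) (auto simp: power_one_over)
  then show "x \<le> y + e *\<^sub>R z" using assms(2)[of n] by (meson add_left_mono order_trans)
qed

text \<open>Kantorovich's extension: by additivity on the cone, the value at a difference
  \<open>a - b\<close> of positive vectors does not depend on the decomposition, and linearity is
  checked on convenient decompositions.\<close>

lemma linear_extension_of_cone:
  fixes p :: "'a::dedekind_complete_banach_lattice \<Rightarrow> 'a"
  assumes add: "\<And>x y. 0 \<le> x \<Longrightarrow> 0 \<le> y \<Longrightarrow> p (x + y) = p x + p y"
    and scale: "\<And>r x. 0 \<le> r \<Longrightarrow> 0 \<le> x \<Longrightarrow> p (r *\<^sub>R x) = r *\<^sub>R p x"
  obtains P where "linear P" "\<And>x. 0 \<le> x \<Longrightarrow> P x = p x"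
proof
  define P where "P x = p (pprt x) - p (pprt (- x))" for x
  have p0: "p 0 = 0" using scale[of 0 0] by simp
  have decomp: "P (a - b) = p a - p b" if "0 \<le> a" "0 \<le> b" for a b
  proof -
    have "pprt (a - b) + b = pprt (- (a - b)) + a"
      using pprt_diff[of "a - b"] by (simp add: algebra_simps)
    then have "p (pprt (a - b)) + p b = p (pprt (- (a - b))) + p a"
      using that by (metis add zero_le_pprt)
    then show ?thesis by (simp add: P_def algebra_simps)
  qed
  show "P x = p x" if "0 \<le> x" for x using decomp[of x 0] that p0 by simp
  show "linear P"
  proof (rule linearI)
    fix x y :: 'a
    have "P (x + y) = P ((pprt x + pprt y) - (pprt (- x) + pprt (- y)))"
      by (metis pprt_diff add_diff_add)
    also have "\<dots> = P x + P y"
      by (subst decomp) (simp_all add: add P_def algebra_simps)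
    finally show "P (x + y) = P x + P y" .
    have sc: "P (r *\<^sub>R x) = r *\<^sub>R P x" if "0 \<le> r" for r x
    proof -
      have "pprt (- (r *\<^sub>R x)) = r *\<^sub>R pprt (- x)"
        using scaleR_pprt[OF that, of "- x"] by simp
      then show ?thesis
        using that by (simp add: P_def scale scaleR_pprt scaleR_right_diff_distrib)
    qed
    have neg: "P (- x) = - P x" for x by (simp add: P_def)
    fix r :: real
    show "P (r *\<^sub>R x) = r *\<^sub>R P x"
    proof (cases "0 \<le> r")
      case False
      then show ?thesis using sc[of "- r" x] neg[of "r *\<^sub>R x"] by simp
    qed (rule sc)
  qed
qed

lemma linear_eqI_nonneg:
  fixes P Q :: "'a::dedekind_complete_banach_lattice \<Rightarrow> 'a"
  assumes "linear P" "linear Q" "\<And>x. 0 \<le> x \<Longrightarrow> P x = Q x"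
  shows "P = Q"
proof
  fix x
  have "P (pprt x - pprt (- x)) = Q (pprt x - pprt (- x))"
    using assms(3) by (simp add: linear_diff[OF assms(1)] linear_diff[OF assms(2)])
  then show "P x = Q x" by (simp only: pprt_diff)
qed


section \<open>Band projections\<close>

lemma order_projectionD:
  assumes "order_projection P"
  shows "linear P" "P (P x) = P x" "0 \<le> x \<Longrightarrow> 0 \<le> P x" "0 \<le> x \<Longrightarrow> P x \<le> x"
  using assms unfolding order_projection_def op_le_def by (auto simp: fun_eq_iff)

lemma order_projection_compl:
  assumes "order_projection P"
  shows "order_projection (\<lambda>x. x - P x)"
proof -
  note P = order_projectionD[OF assms]
  have "linear (\<lambda>x. x - P x)"
    by (intro linear_compose_sub P linear_ident)
  then show ?thesis
    using P by (auto simp: order_projection_def op_le_def fun_eq_iff linear_diff[OF P(1)])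
qed

lemma order_projection_fixes:
  assumes "order_projection P" "0 \<le> w" "w \<le> P x"
  shows "P w = w"
proof -
  note P = order_projectionD[OF assms(1)]
  note C = order_projectionD[OF order_projection_compl[OF assms(1)]]
  have "P x - w - P (P x - w) \<ge> 0" using C(3)[of "P x - w"] assms by simp
  then have "w - P w \<le> 0" by (simp add: linear_diff[OF P(1)] P(2))
  moreover have "0 \<le> w - P w" using C(3) assms by simp
  ultimately have "w - P w = 0" by (rule antisym)
  then show ?thesis by simp
qed

lemma order_projection_kills:
  assumes "order_projection P" "0 \<le> w" "w \<le> x - P x"
  shows "P w = 0"
  using order_projection_fixes[OF order_projection_compl[OF assms(1)], OF assms(2,3)] by simp

lemma order_projection_disjoint:
  assumes "order_projection P" "0 \<le> x" "0 \<le> y"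
  shows "inf (P x) (y - P y) = 0"
proof -
  define w where "w = inf (P x) (y - P y)"
  have w: "0 \<le> w" "w \<le> P x" "w \<le> y - P y"
    using order_projectionD[OF assms(1)] assms by (auto simp: w_def)
  show ?thesis
    using order_projection_fixes[OF assms(1) w(1,2)] order_projection_kills[OF assms(1) w(1,3)]
    by (simp add: w_def)
qed

text \<open>Riesz's projection theorem for the positive part \<open>B\<close> of the band disjoint
  from \<open>A\<close>: \<open>p x\<close> is the largest element of \<open>B\<close> below
  \<open>x\<close>, and \<open>x - p x\<close> lies in the polar \<open>D\<close> of
  \<open>B\<close>. The splitting of \<open>x\<close> into members of \<open>B\<close> and
  \<open>D\<close> is unique, which makes \<open>p\<close> additive and homogeneous on the
  cone.\<close>

lemma band_projection_of_polar:
  fixes A :: "'a::dedekind_complete_banach_lattice set"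
  assumes A: "\<And>a. a \<in> A \<Longrightarrow> 0 \<le> a"
  obtains P where "order_projection P"
    "\<And>x a. 0 \<le> x \<Longrightarrow> a \<in> A \<Longrightarrow> inf (P x) a = 0"
    "\<And>y. 0 \<le> y \<Longrightarrow> (\<And>a. a \<in> A \<Longrightarrow> inf y a = 0) \<Longrightarrow> P y = y"
proof -
  define B where "B = {y. 0 \<le> y \<and> (\<forall>a\<in>A. inf y a = 0)}"
  define D where "D = {v. 0 \<le> v \<and> (\<forall>b\<in>B. inf v b = 0)}"
  have polar_add: "0 \<le> u + v \<and> (\<forall>a\<in>C. inf (u + v) a = 0)"
    if "0 \<le> u \<and> (\<forall>a\<in>C. inf u a = 0)" "0 \<le> v \<and> (\<forall>a\<in>C. inf v a = 0)" "\<And>a. a \<in> C \<Longrightarrow> 0 \<le> a"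
    for u v :: 'a and C
  proof (intro conjI ballI)
    fix a assume a: "a \<in> C"
    have "inf (u + v) a \<le> 0" using inf_add_le[of u v a] that a by auto
    then show "inf (u + v) a = 0" using that a by (intro antisym) auto
  qed (use that in auto)
  have polar_scale: "0 \<le> r *\<^sub>R u \<and> (\<forall>a\<in>C. inf (r *\<^sub>R u) a = 0)"
    if "0 \<le> u \<and> (\<forall>a\<in>C. inf u a = 0)" "\<And>a. a \<in> C \<Longrightarrow> 0 \<le> a" "0 \<le> r" for u :: 'a and C r
  proof (intro conjI ballI)
    fix a assume a: "a \<in> C"
    define s where "s = max r 1"
    have "r *\<^sub>R u \<le> s *\<^sub>R u" "1 *\<^sub>R a \<le> s *\<^sub>R a"
      using that a by (intro scaleR_right_mono; simp add: s_def)+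
    then have "inf (r *\<^sub>R u) a \<le> inf (s *\<^sub>R u) (s *\<^sub>R a)"
      by (intro inf_mono) auto
    also have "\<dots> = 0" using that a scaleR_inf[of s u a] by (simp add: s_def)
    finally have "inf (r *\<^sub>R u) a \<le> 0" .
    moreover have "0 \<le> r *\<^sub>R u" "0 \<le> a" using that a by (auto intro: scaleR_nonneg_nonneg)
    ultimately show "inf (r *\<^sub>R u) a = 0" by (intro antisym le_infI)
  qed (use that in \<open>auto intro: scaleR_nonneg_nonneg\<close>)
  have B_add: "u + v \<in> B" if "u \<in> B" "v \<in> B" for u v
    using polar_add[of u A v] that A by (auto simp: B_def)
  have B_pos: "0 \<le> b" if "b \<in> B" for b using that by (auto simp: B_def)
  have D_add: "u + v \<in> D" if "u \<in> D" "v \<in> D" for u v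
    using polar_add[of u B v] that B_pos by (auto simp: D_def)
  have B_scale: "r *\<^sub>R u \<in> B" if "u \<in> B" "0 \<le> r" for r u
    using polar_scale[of u A r] that A by (auto simp: B_def)
  have D_scale: "r *\<^sub>R u \<in> D" if "u \<in> D" "0 \<le> r" for r u
    using polar_scale[of u B r] that B_pos by (auto simp: D_def)
  have B_solid: "w \<in> B" if "v \<in> B" "0 \<le> w" "w \<le> v" for v w
  proof -
    have "inf w a = 0" if a: "a \<in> A" for a
    proof (rule antisym)
      have "inf w a \<le> inf v a" using \<open>w \<le> v\<close> by (intro inf_mono) auto
      also have "inf v a = 0" using \<open>v \<in> B\<close> a by (simp add: B_def)
      finally show "inf w a \<le> 0" .
    qed (use A a \<open>0 \<le> w\<close> in auto)
    then show ?thesis using that by (simp add: B_def)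
  qed
  define p where "p x = Sup {y\<in>B. y \<le> x}" for x
  have zB: "0 \<in> B" using A by (auto simp: B_def inf_absorb1)
  have ub: "y \<le> p x" if "y \<in> B" "y \<le> x" for x y
    unfolding p_def by (rule cSup_upper) (use that in auto)
  have least: "p x \<le> z" if "0 \<le> x" "\<And>y. y \<in> B \<Longrightarrow> y \<le> x \<Longrightarrow> y \<le> z" for x z
    unfolding p_def by (rule cSup_least) (use that zB in auto)
  have p_le: "p x \<le> x" if "0 \<le> x" for x by (rule least) (use that in auto)
  have p_pos: "0 \<le> p x" if "0 \<le> x" for x using ub[OF zB] that by simp
  have p_B: "p x \<in> B" if "0 \<le> x" for x
  proof -
    have "inf (p x) a = 0" if a: "a \<in> A" for a
    proof -
      define w where "w = inf (p x) a"
      \<comment> \<open>Removing the overlap \<open>w\<close> of \<open>p x\<close> with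
        \<open>a\<close> still leaves an upper bound of the competitors \<open>y\<close>, because
        each \<open>y\<close> is disjoint from \<open>a\<close>; leastness then gives
        \<open>w \<le> 0\<close>.\<close>
      have "p x \<le> p x - w"
      proof (rule least[OF \<open>0 \<le> x\<close>])
        fix y assume y: "y \<in> B" "y \<le> x"
        have "w + y - p x \<le> y"
          unfolding w_def by (simp add: algebra_simps add_mono)
        moreover have "w + y - p x \<le> a"
        proof -
          have "w + y \<le> a + p x" using ub[OF y] by (intro add_mono) (auto simp: w_def)
          then show ?thesis by (simp add: algebra_simps)
        qed
        ultimately have "w + y - p x \<le> inf y a" by (rule inf_greatest)
        also have "inf y a = 0" using y a by (simp add: B_def)
        finally show "y \<le> p x - w" by (simp add: algebra_simps)
      qed
      then have "w \<le> 0" by simp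
      moreover have "0 \<le> w"
        unfolding w_def using p_pos[OF \<open>0 \<le> x\<close>] A[OF a] by (rule le_infI)
      ultimately have "w = 0" by (rule antisym)
      then show ?thesis by (simp add: w_def)
    qed
    then show ?thesis using p_pos[OF that] by (auto simp: B_def)
  qed
  have p_D: "x - p x \<in> D" if "0 \<le> x" for x
  proof -
    have "inf (x - p x) b = 0" if b: "b \<in> B" for b
    proof -
      define w where "w = inf (x - p x) b"
      have w: "0 \<le> w" "w \<le> b" using p_le[OF \<open>0 \<le> x\<close>] b by (auto simp: w_def B_def)
      \<comment> \<open>The overlap with \<open>b\<close> lies in \<open>B\<close> again, so adding
        it to \<open>p x\<close> gives another competitor below \<open>x\<close>.\<close>
      have "w \<in> B" using B_solid[OF b w] .
      then have "w + p x \<in> B" using B_add p_B[OF \<open>0 \<le> x\<close>] by blast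
      moreover have "w + p x \<le> x"
        using inf.cobounded1[of "x - p x" b] unfolding w_def by (simp only: le_diff_eq)
      ultimately have "w + p x \<le> p x" by (rule ub)
      then have "w \<le> 0" by simp
      then have "w = 0" using w(1) by (rule antisym)
      then show ?thesis by (simp add: w_def)
    qed
    then show ?thesis using p_le[OF that] by (auto simp: D_def)
  qed
  have p_unique: "p x = u" if "u \<in> B" "x - u \<in> D" for x u
  proof -
    have x: "0 \<le> x" and ux: "u \<le> x" using that add_nonneg_nonneg[of u "x - u"] by (auto simp: B_def D_def)
    have le: "u \<le> p x" using ub that ux by auto
    have "p x - u \<in> B"
      using le B_pos[OF that(1)] by (intro B_solid[OF p_B[OF x]]) auto
    then have "inf (x - u) (p x - u) = 0" using that by (auto simp: D_def)
    moreover have "inf (x - u) (p x - u) = p x - u"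
      using p_le[OF x] by (intro inf_absorb2) simp
    ultimately show ?thesis by simp
  qed
  obtain P where P: "linear P" "\<And>x. 0 \<le> x \<Longrightarrow> P x = p x"
  proof (rule linear_extension_of_cone[of p])
    show "p (x + y) = p x + p y" if "0 \<le> x" "0 \<le> y" for x y
      using p_unique[of "p x + p y" "x + y"] B_add p_B D_add[of "x - p x" "y - p y"] p_D that
      by (simp add: algebra_simps)
    show "p (r *\<^sub>R x) = r *\<^sub>R p x" if "0 \<le> r" "0 \<le> x" for r x
      using p_unique[of "r *\<^sub>R p x" "r *\<^sub>R x"] B_scale p_B D_scale[of "x - p x" r] p_D that
      by (simp add: algebra_simps)
  qed (rule that)
  have zD: "0 \<in> D" using B_pos by (auto simp: D_def inf_absorb1)
  have p_id: "p u = u" if "u \<in> B" for u using p_unique[of u u] that zD by simp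
  show thesis
  proof
    have "P \<circ> P = P"
      by (rule linear_eqI_nonneg) (auto intro: linear_compose simp: P p_pos p_id p_B)
    then show "order_projection P"
      using P p_pos p_le by (auto simp: order_projection_def op_le_def)
    show "inf (P x) a = 0" if "0 \<le> x" "a \<in> A" for x a
      using p_B that by (auto simp: P B_def)
    show "P y = y" if "0 \<le> y" "\<And>a. a \<in> A \<Longrightarrow> inf y a = 0" for y
      using that p_id by (auto simp: P B_def)
  qed
qed


lemma order_projection_mono:
  assumes "order_projection P" "x \<le> y"
  shows "P x \<le> P y"
  using order_projectionD(3)[OF assms(1), of "y - x"] assms
  by (simp add: linear_diff[OF order_projectionD(1)[OF assms(1)]])

section \<open>The complete Boolean algebra of band projections\<close>

typedef (overloaded) ('a::dedekind_complete_banach_lattice) band_proj =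
    "{P :: 'a \<Rightarrow> 'a. order_projection P}"
  morphisms app_proj Abs_band_proj
  by (rule exI[of _ "\<lambda>x. x"]) (simp add: order_projection_def op_le_def linear_ident o_def id_def)

setup_lifting type_definition_band_proj

lemma order_projection_app: "order_projection (app_proj p)"
  using app_proj by simp

lemmas linear_app = order_projectionD(1)[OF order_projection_app]
lemmas app_idem = order_projectionD(2)[OF order_projection_app]
lemmas app_nonneg = order_projectionD(3)[OF order_projection_app]
lemmas app_le = order_projectionD(4)[OF order_projection_app]
lemmas app_mono = order_projection_mono[OF order_projection_app]
lemmas app_diff = linear_diff[OF linear_app]
lemmas app_add = linear_add[OF linear_app]
lemmas app_scaleR = linear_cmul[OF linear_app]

text \<open>The bound is a parameter because later arguments halve it or use it as a contraction
  constant. It carries no sign; \<open>orth_bound_pos\<close> supplies a positive one on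
  demand.\<close>

definition orth_bound :: "real \<Rightarrow> ('a::dedekind_complete_banach_lattice \<Rightarrow> 'a) \<Rightarrow> bool"
  where "orth_bound c K \<longleftrightarrow>
    linear K \<and> (\<forall>x\<ge>0. - (c *\<^sub>R x) \<le> K x \<and> K x \<le> c *\<^sub>R x)"

lemma orth_boundD:
  assumes "orth_bound c K"
  shows "linear K" "0 \<le> x \<Longrightarrow> - (c *\<^sub>R x) \<le> K x" "0 \<le> x \<Longrightarrow> K x \<le> c *\<^sub>R x"
  using assms unfolding orth_bound_def by auto

text \<open>\<open>Q\<close> annihilates \<open>x - Q x\<close>, and \<open>K (x - Q x)\<close> lies
  between two multiples of that vector, so \<open>Q K (I - Q) = 0\<close>. Taking for
  \<open>Q\<close> both \<open>P\<close> and its complement gives the two halves of the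
  commutation.\<close>

lemma order_projection_commute_le:
  assumes P: "order_projection P" and K: "orth_bound c K"
  shows "P (K x) = K (P x)"
proof -
  note k = orth_boundD[OF K]
  note p = order_projectionD[OF P]
  have a: "Q (K (x - Q x)) = 0" if Q: "order_projection Q" and x: "0 \<le> x" for Q x
  proof -
    note q = order_projectionD[OF Q]
    have y: "0 \<le> x - Q x" "Q (x - Q x) = 0" using q(2,4) x by (simp_all add: linear_diff[OF q(1)])
    have "Q (- (c *\<^sub>R (x - Q x))) \<le> Q (K (x - Q x))" "Q (K (x - Q x)) \<le> Q (c *\<^sub>R (x - Q x))"
      using k(2,3)[OF y(1)] by (auto intro!: order_projection_mono[OF Q])
    then show ?thesis by (simp add: linear_neg[OF q(1)] linear_cmul[OF q(1)] y(2))
  qed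
  have "(\<lambda>x. P (K x)) = (\<lambda>x. K (P x))"
  proof (rule linear_eqI_nonneg)
    show "linear (\<lambda>x. P (K x))" "linear (\<lambda>x. K (P x))"
      using linear_compose[OF k(1) p(1)] linear_compose[OF p(1) k(1)] by (simp_all add: o_def)
    fix x :: 'a assume x: "0 \<le> x"
    show "P (K x) = K (P x)"
      using a[OF P x] a[OF order_projection_compl[OF P] x]
      by (simp add: linear_diff[OF p(1)] linear_diff[OF k(1)])
  qed
  then show ?thesis by (rule fun_cong)
qed

lemma orth_bound_projection:
  assumes "order_projection P"
  shows "orth_bound 1 P"
  unfolding orth_bound_def
  using order_projectionD[OF assms] by (auto intro: order_trans[of _ 0])

lemma app_commute_orth:
  "orth_bound c K \<Longrightarrow> app_proj p (K x) = K (app_proj p x)"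
  by (rule order_projection_commute_le[OF order_projection_app])

lemma app_commute: "app_proj p (app_proj q x) = app_proj q (app_proj p x)"
  by (rule app_commute_orth[OF orth_bound_projection[OF order_projection_app]])

lemma order_projection_comp:
  assumes "order_projection P" "order_projection Q"
  shows "order_projection (\<lambda>x. P (Q x))"
proof -
  note p = order_projectionD[OF assms(1)] and q = order_projectionD[OF assms(2)]
  have "P (Q (P (Q x))) = P (Q x)" for x
    using order_projection_commute_le[OF assms(1) orth_bound_projection[OF assms(2)]] p(2) q(2)
    by metis
  moreover have "P (Q x) \<le> x" if "0 \<le> x" for x
    using p(4)[of "Q x"] q(3,4)[OF that] by auto
  ultimately show ?thesis
    using p(3) q(3) linear_compose[OF q(1) p(1)]
    by (auto simp: order_projection_def op_le_def o_def fun_eq_iff)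
qed

lemma band_proj_eqI: "(\<And>x. 0 \<le> x \<Longrightarrow> app_proj p x = app_proj q x) \<Longrightarrow> p = q"
  by (metis app_proj_inject linear_app linear_eqI_nonneg)

instantiation band_proj :: (dedekind_complete_banach_lattice) "{boolean_algebra, complete_lattice}"
begin

definition less_eq_band_proj :: "'a band_proj \<Rightarrow> 'a band_proj \<Rightarrow> bool"
  where "p \<le> q \<longleftrightarrow> (\<forall>x\<ge>0. app_proj p x \<le> app_proj q x)"

definition less_band_proj :: "'a band_proj \<Rightarrow> 'a band_proj \<Rightarrow> bool"
  where "p < q \<longleftrightarrow> p \<le> q \<and> \<not> q \<le> (p :: 'a band_proj)"

lift_definition inf_band_proj :: "'a band_proj \<Rightarrow> 'a band_proj \<Rightarrow> 'a band_proj"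
  is "\<lambda>P Q x. P (Q x)" by (rule order_projection_comp)

lift_definition uminus_band_proj :: "'a band_proj \<Rightarrow> 'a band_proj"
  is "\<lambda>P x. x - P x" by (rule order_projection_compl)

lift_definition top_band_proj :: "'a band_proj" is "\<lambda>x. x"
  by (simp add: order_projection_def op_le_def linear_ident o_def id_def)

definition sup_band_proj :: "'a band_proj \<Rightarrow> 'a band_proj \<Rightarrow> 'a band_proj"
  where "sup p q = - inf (- p) (- q :: 'a band_proj)"

definition minus_band_proj :: "'a band_proj \<Rightarrow> 'a band_proj \<Rightarrow> 'a band_proj"
  where "p - q = inf p (- q :: 'a band_proj)"

definition bot_band_proj :: "'a band_proj" where "bot = - (top :: 'a band_proj)"

definition Inf_band_proj :: "'a band_proj set \<Rightarrow> 'a band_proj"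
  where "Inf A = (THE p :: 'a band_proj. (\<forall>q\<in>A. p \<le> q) \<and> (\<forall>r. (\<forall>q\<in>A. r \<le> q) \<longrightarrow> r \<le> p))"

definition Sup_band_proj :: "'a band_proj set \<Rightarrow> 'a band_proj"
  where "Sup A = - Inf (uminus ` A :: 'a band_proj set)"

text \<open>Inclusion of ranges written as an equation; the meet laws then follow from the algebra
  of commuting idempotents.\<close>

lemma band_proj_le_iff: "p \<le> q \<longleftrightarrow> (\<forall>x. app_proj q (app_proj p x) = app_proj p x)"
  for p q :: "'a band_proj"
proof
  assume le: "p \<le> q"
  have "(\<lambda>x. app_proj q (app_proj p x)) = app_proj p"
  proof (rule linear_eqI_nonneg)
    show "linear (\<lambda>x. app_proj q (app_proj p x))"
      using linear_compose[OF linear_app linear_app] by (simp add: o_def)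
    fix x :: 'a assume x: "0 \<le> x"
    have "app_proj p (app_proj p x) \<le> app_proj q (app_proj p x)"
      using le x by (simp add: less_eq_band_proj_def app_nonneg)
    then show "app_proj q (app_proj p x) = app_proj p x"
      using app_le[of "app_proj p x" q] x by (intro antisym) (simp_all add: app_idem app_nonneg)
  qed (rule linear_app)
  then show "\<forall>x. app_proj q (app_proj p x) = app_proj p x" by (simp add: fun_eq_iff)
next
  assume r: "\<forall>x. app_proj q (app_proj p x) = app_proj p x"
  show "p \<le> q"
    unfolding less_eq_band_proj_def
  proof (intro allI impI)
    fix x :: 'a assume "0 \<le> x"
    then have "app_proj q (app_proj p x) \<le> app_proj q x" by (intro app_mono app_le)
    then show "app_proj p x \<le> app_proj q x" using r by simp
  qed
qed

text \<open>The positive vectors fixed by all members of \<open>A\<close> are those disjoint from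
  every \<open>x - app_proj q x\<close> with \<open>q \<in> A\<close>, so the projection onto this
  polar is the infimum.\<close>

lemma ex_Inf_band_proj:
  fixes A :: "'a band_proj set"
  shows "\<exists>p. (\<forall>q\<in>A. p \<le> q) \<and> (\<forall>r. (\<forall>q\<in>A. r \<le> q) \<longrightarrow> r \<le> p)"
proof -
  define C where "C = {x - app_proj q x | x q. 0 \<le> x \<and> q \<in> A}"
  obtain P where P: "order_projection P" "\<And>x a. 0 \<le> x \<Longrightarrow> a \<in> C \<Longrightarrow> inf (P x) a = 0"
    "\<And>y. 0 \<le> y \<Longrightarrow> (\<And>a. a \<in> C \<Longrightarrow> inf y a = 0) \<Longrightarrow> P y = y"
    by (rule band_projection_of_polar[of C]) (auto simp: C_def app_le)
  define p where "p = Abs_band_proj P"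
  have p: "app_proj p = P" using P(1) by (simp add: p_def Abs_band_proj_inverse)
  show ?thesis
  proof (intro exI conjI ballI allI impI)
    fix q assume q: "q \<in> A"
    show "p \<le> q"
      unfolding less_eq_band_proj_def p
    proof (intro allI impI)
      fix x :: 'a assume x: "0 \<le> x"
      have Px: "0 \<le> P x" "P x \<le> x" using order_projectionD[OF P(1)] x by auto
      have "inf (P x) (P x - app_proj q (P x)) = 0" using P(2)[OF x] Px(1) q by (auto simp: C_def)
      moreover have "P x - app_proj q (P x) \<le> P x" using app_nonneg[OF Px(1)] by simp
      ultimately have "P x = app_proj q (P x)" by (simp add: inf_absorb2)
      also have "\<dots> \<le> app_proj q x" using Px by (intro app_mono)
      finally show "P x \<le> app_proj q x" .
    qed
  next
    fix r assume r: "\<forall>q\<in>A. r \<le> q"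
    have "P (app_proj r x) = app_proj r x" if x: "0 \<le> x" for x
    proof (rule P(3))
      show "0 \<le> app_proj r x" using x by (rule app_nonneg)
      fix a assume "a \<in> C"
      then obtain y q where a: "a = y - app_proj q y" "0 \<le> y" "q \<in> A" by (auto simp: C_def)
      have "app_proj q (app_proj r x) = app_proj r x" using r a(3) by (auto simp: band_proj_le_iff)
      then show "inf (app_proj r x) a = 0"
        using order_projection_disjoint[OF order_projection_app, of "app_proj r x" y q] a x
        by (simp add: app_nonneg)
    qed
    then show "r \<le> p"
      unfolding less_eq_band_proj_def p
      by (metis app_le order_projection_mono[OF P(1)])
  qed
qed

instance
proof
  fix x y z :: "'a band_proj"
  show "x < y \<longleftrightarrow> x \<le> y \<and> \<not> y \<le> x" by (rule less_band_proj_def)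
  show "x \<le> x" by (simp add: less_eq_band_proj_def)
  show "x \<le> y \<Longrightarrow> y \<le> z \<Longrightarrow> x \<le> z" unfolding less_eq_band_proj_def using order_trans by blast
  show anti: "x \<le> y \<Longrightarrow> y \<le> x \<Longrightarrow> x = y" for x y :: "'a band_proj"
    unfolding less_eq_band_proj_def by (intro band_proj_eqI antisym) auto
  have inf_le1: "inf x y \<le> x" and inf_le2: "inf x y \<le> y" for x y :: "'a band_proj"
    by (simp_all add: band_proj_le_iff inf_band_proj.rep_eq app_idem)
       (metis app_commute app_idem)
  show "inf x y \<le> x" "inf x y \<le> y" by (rule inf_le1 inf_le2)+
  show inf_greatest: "x \<le> y \<Longrightarrow> x \<le> z \<Longrightarrow> x \<le> inf y z" for x y z :: "'a band_proj"
    by (simp add: band_proj_le_iff inf_band_proj.rep_eq)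
  have compl: "- (- x) = x" for x :: "'a band_proj"
    by (rule band_proj_eqI) (simp add: uminus_band_proj.rep_eq)
  have compl_mono: "x \<le> y \<Longrightarrow> - y \<le> - x" for x y :: "'a band_proj"
    by (simp add: less_eq_band_proj_def uminus_band_proj.rep_eq)
  have le_compl: "x \<le> - y \<longleftrightarrow> y \<le> - x" for x y :: "'a band_proj"
    using compl_mono compl by metis
  show "x \<le> sup x y" "y \<le> sup x y"
    unfolding sup_band_proj_def using inf_le1 inf_le2 le_compl by metis+
  show "y \<le> x \<Longrightarrow> z \<le> x \<Longrightarrow> sup y z \<le> x"
    unfolding sup_band_proj_def using inf_greatest compl compl_mono by metis
  show "bot \<le> x"
    by (simp add: bot_band_proj_def less_eq_band_proj_def uminus_band_proj.rep_eq top_band_proj.rep_eq app_nonneg)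
  have le_top: "x \<le> top" for x :: "'a band_proj"
    by (simp add: less_eq_band_proj_def top_band_proj.rep_eq app_le)
  then show "x \<le> top" .
  show "sup x (inf y z) = inf (sup x y) (sup x z)"
  proof (rule band_proj_eqI)
    fix v :: 'a
    show "app_proj (sup x (inf y z)) v = app_proj (inf (sup x y) (sup x z)) v"
      by (simp add: sup_band_proj_def inf_band_proj.rep_eq uminus_band_proj.rep_eq app_diff app_add app_idem
          app_commute[of y x] app_commute[of z x] algebra_simps)
  qed
  show "inf x (- x) = bot"
    by (rule band_proj_eqI)
      (simp add: bot_band_proj_def inf_band_proj.rep_eq uminus_band_proj.rep_eq top_band_proj.rep_eq app_diff app_idem)
  show "sup x (- x) = top"
    by (rule band_proj_eqI)
      (simp add: sup_band_proj_def inf_band_proj.rep_eq uminus_band_proj.rep_eq top_band_proj.rep_eq app_diff app_idem)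
  show "x - y = inf x (- y)" by (rule minus_band_proj_def)
  fix A :: "'a band_proj set"
  have Inf: "(\<forall>q\<in>A. Inf A \<le> q) \<and> (\<forall>r. (\<forall>q\<in>A. r \<le> q) \<longrightarrow> r \<le> Inf A)" for A :: "'a band_proj set"
    unfolding Inf_band_proj_def
    by (rule theI') (use ex_Inf_band_proj[of A] anti in blast)
  show "x \<in> A \<Longrightarrow> Inf A \<le> x" using Inf by blast
  show "(\<And>x. x \<in> A \<Longrightarrow> z \<le> x) \<Longrightarrow> z \<le> Inf A" using Inf by blast
  show "x \<in> A \<Longrightarrow> x \<le> Sup A"
    unfolding Sup_band_proj_def using Inf[of "uminus ` A"] le_compl by blast
  show "(\<And>x. x \<in> A \<Longrightarrow> x \<le> z) \<Longrightarrow> Sup A \<le> z"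
    unfolding Sup_band_proj_def using Inf[of "uminus ` A"] compl compl_mono
    by (metis (no_types, lifting) imageE)
  show "Inf {} = (top :: 'a band_proj)"
    using Inf[of "{}"] le_top by (intro anti) blast+
  then have "Inf (uminus ` {}) = (top :: 'a band_proj)" by simp
  then show "Sup {} = (bot :: 'a band_proj)"
    unfolding Sup_band_proj_def bot_band_proj_def by simp
qed

end

lemma app_inf: "app_proj (inf p q) x = app_proj p (app_proj q x)"
  by (rule inf_band_proj.rep_eq[THEN fun_cong])

lemma app_compl: "app_proj (- p) x = x - app_proj p x"
  by (rule uminus_band_proj.rep_eq[THEN fun_cong])

lemma app_top: "app_proj top x = x"
  by (simp add: top_band_proj.rep_eq)

lemma app_bot: "app_proj bot x = 0"
  unfolding bot_band_proj_def by (simp only: app_compl app_top diff_self)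

lemma app_sup_disjoint:
  assumes "inf p q = bot"
  shows "app_proj (sup p q) x = app_proj p x + app_proj q x"
proof -
  have "app_proj p (app_proj q x) = 0" using assms by (metis app_inf app_bot)
  moreover have "sup p q = - inf (- p) (- q)" by simp
  ultimately show ?thesis
    by (simp only: app_compl app_inf app_diff) (simp add: algebra_simps)
qed

lemma app_le_app: "p \<le> q \<Longrightarrow> 0 \<le> x \<Longrightarrow> app_proj p x \<le> app_proj q x"
  by (simp add: less_eq_band_proj_def)

lemma app_app_of_le: "p \<le> q \<Longrightarrow> app_proj q (app_proj p x) = app_proj p x"
  by (simp add: band_proj_le_iff)

text \<open>Let \<open>v\<close> be the excess of \<open>app_proj (Sup A) x\<close> over
  \<open>z\<close>. Every member of \<open>A\<close> kills \<open>v\<close>, hence lies below the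
  projection \<open>q\<close> onto the polar of \<open>v\<close>, and so does \<open>Sup A\<close>;
  but \<open>Sup A\<close> fixes \<open>v\<close> while \<open>q\<close> kills it. This ties the
  abstract supremum to the order of vectors.\<close>

lemma app_Sup_least:
  fixes A :: "'a::dedekind_complete_banach_lattice band_proj set"
  assumes ne: "A \<noteq> {}" and x: "0 \<le> x" and ub: "\<And>p. p \<in> A \<Longrightarrow> app_proj p x \<le> z"
  shows "app_proj (Sup A) x \<le> z"
proof -
  define s where "s = inf z (app_proj (Sup A) x)"
  define v where "v = app_proj (Sup A) x - s"
  have ps: "app_proj p x \<le> s" if "p \<in> A" for p
    using ub[OF that] x that by (auto simp: s_def intro: app_le_app Sup_upper)
  have v0: "0 \<le> v" unfolding v_def s_def by (simp only: diff_ge_0_iff_ge inf.cobounded2)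
  have s0: "0 \<le> s" using ne ps app_nonneg[OF x] by (metis all_not_in_conv order_trans)
  obtain P where P: "order_projection P" "\<And>x a. 0 \<le> x \<Longrightarrow> a \<in> {v} \<Longrightarrow> inf (P x) a = 0"
    "\<And>y. 0 \<le> y \<Longrightarrow> (\<And>a. a \<in> {v} \<Longrightarrow> inf y a = 0) \<Longrightarrow> P y = y"
    by (rule band_projection_of_polar[of "{v}"]) (use v0 in auto)
  define q where "q = Abs_band_proj P"
  have q: "app_proj q = P" using P(1) by (simp add: q_def Abs_band_proj_inverse)
  have Pv: "P v = 0"
  proof -
    have "0 \<le> P v" "P v \<le> v" using order_projectionD[OF P(1)] v0 by auto
    then show ?thesis using P(2)[OF v0, of v] by (simp add: inf_absorb1)
  qed
  have "p \<le> q" if p: "p \<in> A" for p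
  proof -
    have "app_proj p v = app_proj p (app_proj (Sup A) x) - app_proj p s" by (simp add: v_def app_diff)
    also have "app_proj p (app_proj (Sup A) x) = app_proj p x"
      using p by (metis Sup_upper app_app_of_le app_commute)
    also have "app_proj p x - app_proj p s \<le> 0"
      using app_mono[OF ps[OF p], of p] by (simp add: app_idem)
    finally have "app_proj p v = 0" using app_nonneg[OF v0] by (rule antisym)
    then have "inf (app_proj p y) v = 0" if "0 \<le> y" for y
      using order_projection_disjoint[OF order_projection_app that v0, of p] by simp
    then have "app_proj q (app_proj p y) = app_proj p y" if "0 \<le> y" for y
      unfolding q using that app_nonneg by (intro P(3)) auto
    then show ?thesis
      unfolding less_eq_band_proj_def by (metis app_le app_mono)
  qed
  then have "Sup A \<le> q" by (rule Sup_least)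
  moreover have "app_proj (Sup A) v = v"
  proof (rule order_projection_fixes[OF order_projection_app v0])
    show "v \<le> app_proj (Sup A) x" using s0 by (simp add: v_def)
  qed
  ultimately have "v \<le> app_proj q v" using app_le_app v0 by metis
  then have "v \<le> 0" using Pv q by simp
  then have "v = 0" using v0 by (rule antisym)
  then show ?thesis by (metis v_def s_def eq_iff_diff_eq_0 inf.cobounded1)
qed

lemma app_Inf_greatest:
  assumes "A \<noteq> {}" "0 \<le> x" "\<And>p. p \<in> A \<Longrightarrow> z \<le> app_proj p x"
  shows "z \<le> app_proj (Inf A) x"
proof -
  have "app_proj (Sup (uminus ` A)) x \<le> x - z"
  proof (rule app_Sup_least)
    show "app_proj p x \<le> x - z" if p: "p \<in> uminus ` A" for p
    proof -
      obtain q where "q \<in> A" "p = - q" using p by auto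
      then show ?thesis using assms(3)[of q] by (simp add: app_compl)
    qed
  qed (use assms in auto)
  moreover have "- Inf A = Sup (uminus ` A)"
  proof (rule antisym)
    have "- Sup (uminus ` A) \<le> Inf A"
      by (rule Inf_greatest) (metis Sup_upper compl_le_swap2 imageI)
    then show "- Inf A \<le> Sup (uminus ` A)" by (rule compl_le_swap2)
    show "Sup (uminus ` A) \<le> - Inf A" by (rule Sup_least) (auto intro: Inf_lower)
  qed
  ultimately have "x - app_proj (Inf A) x \<le> x - z" by (simp only: app_compl[symmetric])
  then show ?thesis by simp
qed


section \<open>Orthomorphisms\<close>

lemma orth_boundI:
  assumes "linear K" "\<And>x. 0 \<le> x \<Longrightarrow> K x \<le> c *\<^sub>R x" "\<And>x. 0 \<le> x \<Longrightarrow> - K x \<le> c *\<^sub>R x"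
  shows "orth_bound c K"
  using assms by (auto simp: orth_bound_def minus_le_iff)

lemma orth_modulus_le:
  assumes "orth_bound c K"
  shows "sup (K x) (- K x) \<le> c *\<^sub>R sup x (- x)"
proof -
  note k = orth_boundD[OF assms]
  have x: "K x = K (pprt x) - K (pprt (- x))" by (metis linear_diff[OF k(1)] pprt_diff)
  have "K (pprt x) - K (pprt (- x)) \<le> c *\<^sub>R pprt x + c *\<^sub>R pprt (- x)"
    using add_mono[OF k(3)[OF zero_le_pprt[of x]], of "- K (pprt (- x))" "c *\<^sub>R pprt (- x)"]
      k(2)[OF zero_le_pprt[of "- x"]] by (simp add: minus_le_iff)
  moreover have "K (pprt (- x)) - K (pprt x) \<le> c *\<^sub>R pprt x + c *\<^sub>R pprt (- x)"
    using add_mono[OF k(3)[OF zero_le_pprt[of "- x"]], of "- K (pprt x)" "c *\<^sub>R pprt x"]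
      k(2)[OF zero_le_pprt[of x]] by (simp add: minus_le_iff add.commute)
  ultimately have "sup (K x) (- K x) \<le> c *\<^sub>R pprt x + c *\<^sub>R pprt (- x)"
    unfolding x by (intro sup_least) simp_all
  then show ?thesis by (simp only: scaleR_add_right[symmetric] pprt_add_uminus)
qed

lemma orth_bound_mono:
  assumes "orth_bound c K" "c \<le> d"
  shows "orth_bound d K"
proof (rule orth_boundI)
  note k = orth_boundD[OF assms(1)]
  show "linear K" by (rule k)
  fix x :: 'a assume x: "0 \<le> x"
  have "c *\<^sub>R x \<le> d *\<^sub>R x" using assms(2) x by (rule scaleR_right_mono)
  then show "K x \<le> d *\<^sub>R x" "- K x \<le> d *\<^sub>R x"
    using k(2,3)[OF x] by (auto simp: minus_le_iff intro: order_trans)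
qed

lemma orth_bound_pos:
  assumes "orth_bound c K"
  obtains d where "0 < d" "orth_bound d K"
  using orth_bound_mono[OF assms, of "max c 1"] by (meson less_max_iff_disj max.cobounded1 zero_less_one)

lemma orth_bound_id: "orth_bound 1 (\<lambda>x. x)"
  by (rule orth_boundI) (auto simp: linear_ident intro: order_trans[of _ 0])

lemma orth_bound_app: "orth_bound 1 (app_proj p)"
  by (rule orth_bound_projection[OF order_projection_app])

lemma orth_bound_add:
  assumes "orth_bound c K" "orth_bound d L"
  shows "orth_bound (c + d) (\<lambda>x. K x + L x)"
proof (rule orth_boundI)
  note k = orth_boundD[OF assms(1)] and l = orth_boundD[OF assms(2)]
  show "linear (\<lambda>x. K x + L x)" by (rule linear_compose_add[OF k(1) l(1)])
  fix x :: 'a assume x: "0 \<le> x"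
  show "K x + L x \<le> (c + d) *\<^sub>R x" using add_mono[OF k(3) l(3)] x by (simp add: scaleR_add_left)
  show "- (K x + L x) \<le> (c + d) *\<^sub>R x"
    using le_imp_neg_le[OF add_mono[OF k(2)[OF x] l(2)[OF x]]] by (simp add: scaleR_add_left add.commute)
qed

lemma orth_bound_scaleR:
  assumes "orth_bound c K"
  shows "orth_bound (\<bar>r\<bar> * c) (\<lambda>x. r *\<^sub>R K x)"
proof (rule orth_boundI)
  note k = orth_boundD[OF assms]
  show "linear (\<lambda>x. r *\<^sub>R K x)" by (rule linear_compose_scale_right[OF k(1)])
  fix x :: 'a assume x: "0 \<le> x"
  have a: "\<bar>r\<bar> *\<^sub>R K x \<le> (\<bar>r\<bar> * c) *\<^sub>R x" "- (\<bar>r\<bar> *\<^sub>R K x) \<le> (\<bar>r\<bar> * c) *\<^sub>R x"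
    using scaleR_left_mono[OF k(3)[OF x], of "\<bar>r\<bar>"] scaleR_left_mono[OF k(2)[OF x], of "\<bar>r\<bar>"]
    by (simp_all add: minus_le_iff)
  show "r *\<^sub>R K x \<le> (\<bar>r\<bar> * c) *\<^sub>R x" "- (r *\<^sub>R K x) \<le> (\<bar>r\<bar> * c) *\<^sub>R x"
    using a by (cases "0 \<le> r"; simp)+
qed

lemma orth_bound_uminus:
  "orth_bound c K \<Longrightarrow> orth_bound c (\<lambda>x. - K x)"
  using orth_bound_scaleR[of c K "- 1"] by simp

lemma orth_bound_diff:
  "orth_bound c K \<Longrightarrow> orth_bound d L \<Longrightarrow> orth_bound (c + d) (\<lambda>x. K x - L x)"
  using orth_bound_add[OF _ orth_bound_uminus] by fastforce

lemma orth_bound_comp: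
  assumes K: "orth_bound c K" and L: "orth_bound d L" and "0 \<le> c"
  shows "orth_bound (c * d) (\<lambda>x. K (L x))"
proof (rule orth_boundI)
  note k = orth_boundD[OF K] and l = orth_boundD[OF L]
  show "linear (\<lambda>x. K (L x))" using linear_compose[OF l(1) k(1)] by (simp add: o_def)
  fix x :: 'a assume x: "0 \<le> x"
  have "sup (L x) (- L x) \<le> d *\<^sub>R x"
    using orth_modulus_le[OF L, of x] by (simp only: modulus_of_nonneg[OF x])
  then have "c *\<^sub>R sup (L x) (- L x) \<le> c *\<^sub>R (d *\<^sub>R x)"
    by (rule scaleR_left_mono[OF _ \<open>0 \<le> c\<close>])
  then have "c *\<^sub>R sup (L x) (- L x) \<le> (c * d) *\<^sub>R x"
    by (simp only: scaleR_scaleR)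
  then have "sup (K (L x)) (- K (L x)) \<le> (c * d) *\<^sub>R x"
    using orth_modulus_le[OF K, of "L x"] by (rule order_trans[rotated])
  then show "K (L x) \<le> (c * d) *\<^sub>R x" "- K (L x) \<le> (c * d) *\<^sub>R x" by (simp_all only: le_sup_iff)
qed

section \<open>Disjointness and the sign of an orthomorphism\<close>

lemma ex_band_proj_generated:
  fixes w :: "'a::dedekind_complete_banach_lattice"
  assumes "0 \<le> w"
  obtains p where "app_proj p w = w" "\<And>v. 0 \<le> v \<Longrightarrow> inf v w = 0 \<Longrightarrow> app_proj p v = 0"
proof -
  obtain P where P: "order_projection P" "\<And>x a. 0 \<le> x \<Longrightarrow> a \<in> {w} \<Longrightarrow> inf (P x) a = 0"
    "\<And>y. 0 \<le> y \<Longrightarrow> (\<And>a. a \<in> {w} \<Longrightarrow> inf y a = 0) \<Longrightarrow> P y = y"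
    by (rule band_projection_of_polar[of "{w}"]) (use assms in auto)
  have q: "app_proj (Abs_band_proj P) = P" using P(1) by (simp add: Abs_band_proj_inverse)
  have "P w = 0"
    using P(2)[OF assms, of w] order_projectionD(4)[OF P(1) assms] by (simp add: inf_absorb1)
  then show thesis
    using P(3) by (intro that[of "- Abs_band_proj P"]) (auto simp: app_compl q)
qed

text \<open>Pointwise reading: where \<open>u \<le> v\<close> the claim is clear; where
  \<open>u \<le> - v\<close>, the first bound on \<open>u\<close> is either \<open>d\<close> or
  \<open>2 d + v\<close>, and the average of the latter with \<open>- v\<close> is \<open>d\<close>.
  Distributivity carries this case distinction to the lattice.\<close>

lemma grid_step:
  fixes u v d :: "'a::dedekind_complete_banach_lattice"
  assumes "0 \<le> d" "u \<le> d + pprt (v + d)" "u \<le> sup v (- v)"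
  shows "u \<le> d + pprt v"
proof -
  have pv: "0 \<le> pprt v" "v \<le> pprt v" by (auto simp: pprt_def)
  have "u \<le> inf u (sup v (- v))" using assms by simp
  also have "\<dots> \<le> sup (inf u v) (inf u (- v))" by (rule inf_sup_distrib_le)
  also have "\<dots> \<le> d + pprt v"
  proof (rule sup_least)
    have "inf u v \<le> v" by simp
    also have "v \<le> d + pprt v" using add_mono[OF assms(1) pv(2)] by simp
    finally show "inf u v \<le> d + pprt v" .
    have "inf u (- v) \<le> inf (- v) (sup (d + (v + d)) (d + 0))"
      using assms(2) by (intro le_infI inf.cobounded2) (auto simp: pprt_def add_sup_distrib_left intro: le_infI1)
    also have "\<dots> \<le> sup (inf (- v) (d + (v + d))) (inf (- v) (d + 0))"
      by (rule inf_sup_distrib_le)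
    also have "\<dots> \<le> d"
    proof (rule sup_least)
      define i where "i = inf (- v) (d + (v + d))"
      have "i + i \<le> - v + (d + (v + d))" unfolding i_def by (intro add_mono) simp_all
      also have "\<dots> = d + d" by simp
      finally have "0 \<le> (d - i) + (d - i)" by (simp add: algebra_simps)
      then have "0 \<le> d - i" by (simp only: zero_le_double_add_iff_zero_le_single_add)
      then have "i \<le> d" by simp
      then show "inf (- v) (d + (v + d)) \<le> d" by (simp only: i_def)
    qed simp
    also have "d \<le> d + pprt v" using pv by simp
    finally show "inf u (- v) \<le> d + pprt v" .
  qed
  finally show ?thesis .
qed

text \<open>
  For real functions one takes \<open>t = x / y\<close> at each point; the grid \<open>t = k / n\<close> replaces this choice.
\<close>

lemma le_zero_of_le_modulus_pencil:
  fixes u x y :: "'a::dedekind_complete_banach_lattice"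
  assumes x: "0 \<le> x" and y: "0 \<le> y" and uy: "u \<le> y"
    and pencil: "\<And>t. 0 \<le> t \<Longrightarrow> u \<le> sup (x - t *\<^sub>R y) (- (x - t *\<^sub>R y))"
  shows "u \<le> 0"
proof -
  have grid: "u \<le> (1 / real (Suc n)) *\<^sub>R y + pprt (x - (real k / real (Suc n)) *\<^sub>R y)" for n k
  proof (induction k)
    case 0
    have "u \<le> x" using pencil[of 0] by (simp add: modulus_of_nonneg[OF x])
    moreover have "0 \<le> (1 / real (Suc n)) *\<^sub>R y" using y by (intro scaleR_nonneg_nonneg) auto
    ultimately show ?case using x by (simp add: add_increasing)
  next
    case (Suc k)
    define d where "d = (1 / real (Suc n)) *\<^sub>R y"
    define v where "v = x - (real (Suc k) / real (Suc n)) *\<^sub>R y"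
    have "(real (Suc k) / real (Suc n)) *\<^sub>R y = (real k / real (Suc n)) *\<^sub>R y + d"
      unfolding d_def scaleR_add_left[symmetric] by (simp add: add_divide_distrib)
    then have "x - (real k / real (Suc n)) *\<^sub>R y = v + d" by (simp add: v_def)
    then have "u \<le> d + pprt (v + d)" using Suc.IH by (simp add: d_def)
    moreover have "u \<le> sup v (- v)" unfolding v_def by (rule pencil) simp
    moreover have "0 \<le> d" unfolding d_def using y by (intro scaleR_nonneg_nonneg) auto
    ultimately have "u \<le> d + pprt v" using grid_step by blast
    then show ?case by (simp add: d_def v_def)
  qed
  \<comment> \<open>At \<open>k = m * Suc n\<close> the grid hits \<open>t = m\<close> exactly, and
    the mesh \<open>y / (n + 1)\<close> is then removed by letting \<open>n\<close> grow.\<close>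
  have le: "u \<le> pprt (x - real m *\<^sub>R y)" for m
  proof (rule archimedean_le_nat[OF y])
    fix n
    have "real (m * Suc n) / real (Suc n) = real m" by (simp only: of_nat_mult) simp
    then show "u \<le> pprt (x - real m *\<^sub>R y) + (1 / real (Suc n)) *\<^sub>R y"
      using grid[of n "m * Suc n"] by (metis add.commute)
  qed
  \<comment> \<open>Replacing \<open>y\<close> by the smaller \<open>u\<close> gives
    \<open>u \<le> pprt (x - m u)\<close>, and the induction hypothesis removes the positive part.
    All multiples of \<open>u\<close> thus stay below \<open>x\<close>.\<close>
  have mult: "real m *\<^sub>R u \<le> x" for m
  proof (induction m)
    case (Suc m)
    have "real m *\<^sub>R u \<le> real m *\<^sub>R y" using uy by (intro scaleR_left_mono) auto
    then have "x - real m *\<^sub>R y \<le> x - real m *\<^sub>R u" by simp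
    then have "u \<le> pprt (x - real m *\<^sub>R u)" using le[of m] pprt_mono order_trans by blast
    also have "\<dots> = x - real m *\<^sub>R u" using Suc.IH by simp
    finally show ?case by (simp add: scaleR_add_left algebra_simps)
  qed (use x in simp)
  show ?thesis
  proof (rule archimedean_le_nat[OF x])
    fix n
    have "(1 / real (Suc n)) *\<^sub>R (real (Suc n) *\<^sub>R u) \<le> (1 / real (Suc n)) *\<^sub>R x"
      by (rule scaleR_left_mono[OF mult]) simp
    then show "u \<le> 0 + (1 / real (Suc n)) *\<^sub>R x" by (simp del: of_nat_Suc)
  qed
qed

text \<open>On the band generated by the overlap \<open>w\<close>, \<open>K\<close> is at least
  \<open>w\<close> at the piece of \<open>x\<close> and at most \<open>- w\<close> at that of
  \<open>y\<close>; hence \<open>w \<le> c |x - t y|\<close> there for every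
  \<open>t \<ge> 0\<close>, and \<open>le_zero_of_le_modulus_pencil\<close> applies. Since
  \<open>x\<close> and \<open>y\<close> may differ, one projection can separate the signs of
  \<open>K\<close> on all positive vectors at once.\<close>

lemma orth_pprt_disjoint:
  fixes x y :: "'a::dedekind_complete_banach_lattice"
  assumes K0: "orth_bound c0 K" and x: "0 \<le> x" and y: "0 \<le> y"
  shows "inf (pprt (K x)) (pprt (- K y)) = 0"
proof -
  obtain c where c: "0 < c" and K: "orth_bound c K" using orth_bound_pos[OF K0] .
  note k = orth_boundD[OF K]
  define w where "w = inf (pprt (K x)) (pprt (- K y))"
  have w: "0 \<le> w" by (simp add: w_def)
  obtain p where p: "app_proj p w = w" "\<And>v. 0 \<le> v \<Longrightarrow> inf v w = 0 \<Longrightarrow> app_proj p v = 0"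
    by (rule ex_band_proj_generated[OF w]) blast
  have disj: "app_proj p v = 0" if v: "0 \<le> v" "inf a v = 0" "w \<le> a" for a v
  proof (rule p(2)[OF v(1)])
    have "inf v w \<le> inf a v" using v(3) by (auto intro: le_infI1 le_infI2)
    then show "inf v w = 0" using v w by (intro antisym) (auto intro: le_infI)
  qed
  have Kx: "w \<le> K (app_proj p x)"
  proof -
    have "app_proj p (pprt (- K x)) = 0"
      by (rule disj[OF _ inf_pprt_uminus]) (simp_all add: w_def)
    then have "app_proj p (K x) = app_proj p (pprt (K x))"
      by (metis app_diff diff_zero pprt_diff)
    moreover have "app_proj p w \<le> app_proj p (pprt (K x))" by (rule app_mono) (simp add: w_def)
    ultimately show ?thesis by (simp add: p(1) app_commute_orth[OF K])
  qed
  have Ky: "w \<le> - K (app_proj p y)"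
  proof -
    have "app_proj p (pprt (K y)) = 0"
      by (rule disj[of _ "pprt (- K y)"]) (simp_all add: w_def inf_pprt_uminus inf.commute)
    moreover have "app_proj p (K y) = app_proj p (pprt (K y)) - app_proj p (pprt (- K y))"
      by (metis app_diff pprt_diff)
    moreover have "app_proj p w \<le> app_proj p (pprt (- K y))" by (rule app_mono) (simp add: w_def)
    ultimately show ?thesis by (simp add: p(1) app_commute_orth[OF K, symmetric])
  qed
  have "(1 / c) *\<^sub>R w \<le> 0"
  proof (rule le_zero_of_le_modulus_pencil[of "app_proj p x" "app_proj p y"])
    have sc: "(1 / c) *\<^sub>R w \<le> z" if "w \<le> c *\<^sub>R z" for z
      using scaleR_left_mono[OF that, of "1 / c"] c by simp
    show "0 \<le> app_proj p x" "0 \<le> app_proj p y" using x y by (simp_all add: app_nonneg)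
    show "(1 / c) *\<^sub>R w \<le> app_proj p y"
      using Ky k(2)[of "app_proj p y"] y by (intro sc) (simp add: app_nonneg minus_le_iff order_trans)
    fix t :: real assume t: "0 \<le> t"
    define z where "z = app_proj p x - t *\<^sub>R app_proj p y"
    have "w \<le> K (app_proj p x)" by (rule Kx)
    also have "\<dots> \<le> K (app_proj p x) + t *\<^sub>R (- K (app_proj p y))"
      using scaleR_nonneg_nonneg[OF t order_trans[OF w Ky]] by simp
    also have "\<dots> = K z" by (simp add: z_def linear_diff[OF k(1)] linear_cmul[OF k(1)])
    also have "\<dots> \<le> sup (K z) (- K z)" by simp
    also have "\<dots> \<le> c *\<^sub>R sup z (- z)" by (rule orth_modulus_le[OF K])
    finally show "(1 / c) *\<^sub>R w \<le> sup (app_proj p x - t *\<^sub>R app_proj p y) (- (app_proj p x - t *\<^sub>R app_proj p y))"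
      unfolding z_def by (rule sc)
  qed
  then have "c *\<^sub>R ((1 / c) *\<^sub>R w) \<le> c *\<^sub>R 0" using c by (intro scaleR_left_mono) auto
  then have "w \<le> 0" using c by simp
  then have "w = 0" using w by (rule antisym)
  then show ?thesis by (simp add: w_def)
qed

text \<open>
  Minimality makes this projection the counterpart of the open set \<open>K > 0\<close>; the right continuity of
  \<open>level_proj\<close> below depends on it.
\<close>

definition pos_proj :: "('a::dedekind_complete_banach_lattice \<Rightarrow> 'a) \<Rightarrow> 'a band_proj"
  where "pos_proj K = Inf {q. \<forall>x\<ge>0. K (x - app_proj q x) \<le> 0}"

lemma pos_proj_least:
  "(\<And>x. 0 \<le> x \<Longrightarrow> K (x - app_proj q x) \<le> 0) \<Longrightarrow> pos_proj K \<le> q"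
  unfolding pos_proj_def by (rule Inf_lower) simp

lemma app_pos_proj:
  assumes K: "orth_bound c K" and x: "0 \<le> x"
  shows "app_proj (pos_proj K) (K x) = pprt (K x)"
proof -
  note k = orth_boundD[OF K]
  define A where "A = {pprt (K x) |x. 0 \<le> x}"
  obtain N where N: "order_projection N" "\<And>x a. 0 \<le> x \<Longrightarrow> a \<in> A \<Longrightarrow> inf (N x) a = 0"
    "\<And>y. 0 \<le> y \<Longrightarrow> (\<And>a. a \<in> A \<Longrightarrow> inf y a = 0) \<Longrightarrow> N y = y"
    by (rule band_projection_of_polar[of A]) (auto simp: A_def)
  define p where "p = - Abs_band_proj N"
  have p: "app_proj p x = x - N x" for x
    using N(1) by (simp add: p_def app_compl Abs_band_proj_inverse)
  have pK: "app_proj p (K x) = pprt (K x)" if x: "0 \<le> x" for x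
  proof -
    have "N (pprt (K x)) = 0"
      using N(2)[of "pprt (K x)" "pprt (K x)"] order_projectionD(4)[OF N(1), of "pprt (K x)"] x
      by (auto simp: A_def inf_absorb1)
    moreover have "N (pprt (- K x)) = pprt (- K x)"
      using orth_pprt_disjoint[OF K _ x] by (intro N(3)) (auto simp: A_def inf.commute)
    ultimately have "app_proj p (pprt (K x) - pprt (- K x)) = pprt (K x)"
      unfolding app_diff by (simp add: p)
    then show ?thesis by (simp only: pprt_diff)
  qed
  have "p \<le> q" if q: "\<forall>x\<ge>0. K (x - app_proj q x) \<le> 0" for q
  proof -
    have fix_q: "app_proj q (pprt (K x)) = pprt (K x)" if x: "0 \<le> x" for x
    proof (rule antisym)
      have "K x - app_proj q (K x) \<le> 0"
        using q x by (simp add: linear_diff[OF k(1)] app_commute_orth[OF K])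
      then have "K x \<le> app_proj q (K x)" by simp
      also have "\<dots> \<le> app_proj q (pprt (K x))" by (rule app_mono) (simp add: pprt_def)
      finally show "pprt (K x) \<le> app_proj q (pprt (K x))"
        by (simp add: pprt_def[of "K x"] app_nonneg)
    qed (simp add: app_le)
    have "N (z - app_proj q z) = z - app_proj q z" if z: "0 \<le> z" for z
    proof (rule N(3))
      show "0 \<le> z - app_proj q z" using z by (simp add: app_le)
      fix a assume "a \<in> A"
      then obtain x where "a = pprt (K x)" "0 \<le> x" by (auto simp: A_def)
      then show "inf (z - app_proj q z) a = 0"
        using order_projection_disjoint[OF order_projection_app, of a z q] z fix_q
        by (simp add: inf.commute)
    qed
    moreover have "N (z - app_proj q z) \<le> N z" if "0 \<le> z" for z
      using that by (intro order_projection_mono[OF N(1)]) (simp add: app_nonneg)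
    ultimately have "z - app_proj q z \<le> N z" if "0 \<le> z" for z using that by metis
    then show ?thesis by (simp add: less_eq_band_proj_def p) (metis diff_le_eq add.commute)
  qed
  moreover have "\<forall>x\<ge>0. K (x - app_proj p x) \<le> 0"
  proof (intro allI impI)
    fix x :: 'a assume "0 \<le> x"
    then have "K (x - app_proj p x) = K x - pprt (K x)"
      using pK by (simp add: linear_diff[OF k(1)] app_commute_orth[OF K, symmetric])
    then show "K (x - app_proj p x) \<le> 0" using le_pprt[of "K x"] by simp
  qed
  ultimately have "pos_proj K = p"
    unfolding pos_proj_def by (intro antisym Inf_lower Inf_greatest) auto
  then show ?thesis using pK[OF x] by simp
qed

lemma pos_proj_nonneg:
  assumes "orth_bound c K" "0 \<le> x"
  shows "0 \<le> K (app_proj (pos_proj K) x)"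
  using app_pos_proj[OF assms] by (simp add: app_commute_orth[OF assms(1), symmetric])

lemma pos_proj_nonpos:
  assumes "orth_bound c K" "0 \<le> x"
  shows "K (x - app_proj (pos_proj K) x) \<le> 0"
  using app_pos_proj[OF assms] le_pprt[of "K x"]
  by (simp add: app_commute_orth[OF assms(1), symmetric] linear_diff[OF orth_boundD(1)[OF assms(1)]])

text \<open>One direction reads the bound off the modulus. For the other the modulus has to be
  produced: it is \<open>K\<close> on the band of \<open>pos_proj K\<close> and \<open>- K\<close>
  on the complementary band, and an operator dominating \<open>K\<close> and \<open>- K\<close>
  dominates it on each of the two.\<close>

lemma center_iff: "K \<in> center \<longleftrightarrow> (\<exists>c\<ge>0. orth_bound c K)"
proof
  assume "K \<in> center"
  then obtain U c where *: "K \<in> regular_ops" "is_sup_in regular_ops {K, \<lambda>x. - K x} U" "0 \<le> c" "op_le U (\<lambda>x. c *\<^sub>R x)"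
    by (auto simp: center_def is_modulus_in_def)
  have "linear K" using *(1) by (auto simp: regular_ops_def intro: linear_compose_sub)
  moreover have "K x \<le> c *\<^sub>R x" "- K x \<le> c *\<^sub>R x" if "0 \<le> x" for x
    using *(2,4) that unfolding is_sup_in_def op_le_def by (auto intro: order_trans)
  ultimately show "\<exists>c\<ge>0. orth_bound c K"
    using *(3) by (blast intro: orth_boundI)
next
  assume "\<exists>c\<ge>0. orth_bound c K"
  then obtain c where c: "0 \<le> c" and K: "orth_bound c K" by blast
  have regular: "L \<in> regular_ops" if L: "orth_bound d L" for L :: "'a \<Rightarrow> 'a" and d
  proof -
    have s: "orth_bound \<bar>d\<bar> L" using orth_bound_mono[OF L] by simp
    have "linear (\<lambda>x::'a. \<bar>d\<bar> *\<^sub>R x)" by (rule linear_scaleR)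
    moreover have "linear (\<lambda>x. L x + \<bar>d\<bar> *\<^sub>R x)"
      by (intro linear_compose_add orth_boundD[OF L] linear_scaleR)
    moreover have "op_le (\<lambda>_. 0) (\<lambda>x. L x + \<bar>d\<bar> *\<^sub>R x)"
      unfolding op_le_def
    proof (intro allI impI)
      fix x :: 'a assume "0 \<le> x"
      from add_right_mono[OF orth_boundD(2)[OF s this], of "\<bar>d\<bar> *\<^sub>R x"]
      show "0 \<le> L x + \<bar>d\<bar> *\<^sub>R x" by simp
    qed
    moreover have "op_le (\<lambda>_. 0) (\<lambda>x::'a. \<bar>d\<bar> *\<^sub>R x)" by (auto simp: op_le_def intro: scaleR_nonneg_nonneg)
    ultimately show ?thesis
      unfolding regular_ops_def
      by - (rule CollectI, rule exI[of _ "\<lambda>x. L x + \<bar>d\<bar> *\<^sub>R x"], rule exI[of _ "\<lambda>x. \<bar>d\<bar> *\<^sub>R x"], auto)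
  qed
  note k = orth_boundD[OF K]
  define p where "p = pos_proj K"
  define U where "U x = K (app_proj p x) - K (app_proj (- p) x)" for x
  have lin: "linear U"
    unfolding U_def using linear_compose[OF linear_app k(1)] by (auto intro!: linear_compose_sub simp: o_def)
  have sgn: "0 \<le> K (app_proj p x)" "K (app_proj (- p) x) \<le> 0" if "0 \<le> x" for x
    using pos_proj_nonneg[OF K that] pos_proj_nonpos[OF K that] by (simp_all add: p_def app_compl)
  have split: "K x = K (app_proj p x) + K (app_proj (- p) x)" for x
    by (simp add: app_compl linear_diff[OF k(1)])
  have Uc: "U x \<le> c *\<^sub>R x" if x: "0 \<le> x" for x
  proof -
    have "U x \<le> c *\<^sub>R app_proj p x + c *\<^sub>R app_proj (- p) x"
      using add_mono[OF k(3)[of "app_proj p x"], of "- K (app_proj (- p) x)"] k(2)[of "app_proj (- p) x"] x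
      by (auto simp: U_def app_nonneg minus_le_iff)
    also have "\<dots> = c *\<^sub>R x" by (simp only: app_compl scaleR_right_diff_distrib) simp
    finally show ?thesis .
  qed
  have U: "orth_bound c U"
  proof (rule orth_boundI[OF lin Uc])
    fix x :: 'a assume x: "0 \<le> x"
    have "- U x \<le> 0" using add_mono[OF sgn(2)[OF x], of "- K (app_proj p x)" 0] sgn(1)[OF x] by (simp add: U_def)
    then show "- U x \<le> c *\<^sub>R x" using x c by (meson order_trans scaleR_nonneg_nonneg)
  qed
  have "is_modulus_in regular_ops K U"
    unfolding is_modulus_in_def is_sup_in_def op_le_def
  proof (intro conjI ballI allI impI)
    show "U \<in> regular_ops" by (rule regular[OF U])
    fix L :: "'a \<Rightarrow> 'a" and x :: 'a assume L: "L \<in> {K, \<lambda>x. - K x}" and x: "0 \<le> x"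
    have "K (app_proj (- p) x) \<le> - K (app_proj (- p) x)" "- K (app_proj p x) \<le> K (app_proj p x)"
      using sgn[OF x] by (metis neg_0_le_iff_le order_trans, metis neg_le_0_iff_le order_trans)
    then show "L x \<le> U x"
      using L split[of x] by (auto simp: U_def)
  next
    fix V :: "'a \<Rightarrow> 'a" and x :: 'a
    assume V: "V \<in> regular_ops" "\<forall>L\<in>{K, \<lambda>x. - K x}. \<forall>x\<ge>0. L x \<le> V x" and x: "0 \<le> x"
    have "linear V" using V(1) by (auto simp: regular_ops_def intro: linear_compose_sub)
    then have "V x = V (app_proj p x) + V (app_proj (- p) x)"
      by (simp add: app_compl linear_diff)
    moreover have "K (app_proj p x) \<le> V (app_proj p x)" "- K (app_proj (- p) x) \<le> V (app_proj (- p) x)"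
      using V(2) x by (simp_all add: app_nonneg)
    ultimately show "U x \<le> V x" unfolding U_def by (metis add_mono diff_conv_add_uminus)
  qed
  then show "K \<in> center"
    using regular[OF K] Uc c by (auto simp: center_def op_le_def)
qed

text \<open>
  Subtracting \<open>c/2 (2 P - I)\<close> with \<open>P\<close> the projection onto the positive part of \<open>K\<close> halves the bound
  of \<open>K\<close> and does not change its commutator with \<open>L\<close>.
\<close>

lemma orth_commutator_le:
  fixes x :: "'a::dedekind_complete_banach_lattice"
  assumes "orth_bound c K" "0 \<le> c" "orth_bound d L" "0 \<le> d" "0 \<le> x"
  shows "K (L x) - L (K x) \<le> (2 * c * d / 2 ^ n) *\<^sub>R x"
  using assms(1,2)
proof (induction n arbitrary: c K)
  case 0
  have "orth_bound (c * d + d * c) (\<lambda>x. K (L x) - L (K x))"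
    using orth_bound_diff[OF orth_bound_comp[OF 0(1) assms(3) 0(2)]
        orth_bound_comp[OF assms(3) 0(1) assms(4)]] .
  from orth_boundD(3)[OF this assms(5)] show ?case by (simp add: mult_ac)
next
  case (Suc n)
  note k = orth_boundD[OF Suc.prems(1)]
  define p where "p = pos_proj K"
  define M where "M x = K x - (c / 2) *\<^sub>R (app_proj p x - app_proj (- p) x)" for x
  have "orth_bound (c / 2) M"
  proof (rule orth_boundI)
    show "linear M" unfolding M_def
      by (intro linear_compose_sub linear_compose_scale_right k linear_app)
    fix x :: 'a assume x: "0 \<le> x"
    have split: "K x = K (app_proj p x) + K (app_proj (- p) x)" "x = app_proj p x + app_proj (- p) x"
      by (simp_all add: app_compl linear_diff[OF k(1)])
    have bd: "K (app_proj p x) \<le> c *\<^sub>R app_proj p x" "- (c *\<^sub>R app_proj (- p) x) \<le> K (app_proj (- p) x)"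
      "0 \<le> K (app_proj p x)" "K (app_proj (- p) x) \<le> 0"
      using k(2,3) x pos_proj_nonneg[OF Suc.prems(1) x] pos_proj_nonpos[OF Suc.prems(1) x]
      by (auto simp: app_nonneg app_le p_def app_compl)
    have half: "c *\<^sub>R z = (c / 2) *\<^sub>R z + (c / 2) *\<^sub>R z" for z :: 'a
      by (simp add: scaleR_add_left[symmetric])
    have "M x = (K (app_proj p x) - c *\<^sub>R app_proj p x) + K (app_proj (- p) x) + (c / 2) *\<^sub>R (app_proj p x + app_proj (- p) x)"
      unfolding M_def half split(1) by (simp add: scaleR_add_right scaleR_right_diff_distrib algebra_simps)
    also have "\<dots> \<le> 0 + 0 + (c / 2) *\<^sub>R (app_proj p x + app_proj (- p) x)"
      using bd by (intro add_mono) auto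
    finally show "M x \<le> (c / 2) *\<^sub>R x" by (simp only: split(2)[symmetric] add_0_left)
    have "- M x = - K (app_proj p x) + (- K (app_proj (- p) x) - c *\<^sub>R app_proj (- p) x) + (c / 2) *\<^sub>R (app_proj p x + app_proj (- p) x)"
      unfolding M_def half split(1) by (simp add: scaleR_add_right scaleR_right_diff_distrib algebra_simps)
    also have "\<dots> \<le> 0 + 0 + (c / 2) *\<^sub>R (app_proj p x + app_proj (- p) x)"
      using bd by (intro add_mono) (auto simp: minus_le_iff)
    finally show "- M x \<le> (c / 2) *\<^sub>R x" by (simp only: split(2)[symmetric] add_0_left)
  qed
  then have "M (L x) - L (M x) \<le> (2 * (c / 2) * d / 2 ^ n) *\<^sub>R x"
    using Suc.prems(2) by (intro Suc.IH) auto
  moreover have "M (L x) - L (M x) = K (L x) - L (K x)"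
    unfolding M_def
    by (simp add: linear_diff[OF orth_boundD(1)[OF assms(3)]] linear_cmul[OF orth_boundD(1)[OF assms(3)]]
        app_commute_orth[OF assms(3)])
  ultimately show ?case by simp
qed

text \<open>Letting \<open>n\<close> grow in \<open>orth_commutator_le\<close> gives one inequality
  on the cone; exchanging \<open>K\<close> and \<open>L\<close> gives the other.\<close>

lemma orth_commute:
  assumes K0: "orth_bound c K" and L0: "orth_bound d L"
  shows "K (L x) = L (K x)"
proof -
  have le: "K (L x) \<le> L (K x)" if KL: "orth_bound c K" "orth_bound d L" "0 \<le> x"
    for c d K L and x :: 'a
  proof -
    obtain c' where c: "0 < c'" "orth_bound c' K"
      by (rule orth_bound_pos[OF KL(1)])
    obtain d' where d: "0 < d'" "orth_bound d' L"
      by (rule orth_bound_pos[OF KL(2)])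
    show ?thesis
    proof (rule archimedean_le_pow2)
      show "0 \<le> (2 * c' * d') *\<^sub>R x" using c d KL by (intro scaleR_nonneg_nonneg) auto
      show "K (L x) \<le> L (K x) + (1 / 2 ^ n) *\<^sub>R (2 * c' * d') *\<^sub>R x" for n
        using orth_commutator_le[OF c(2) less_imp_le[OF c(1)] d(2) less_imp_le[OF d(1)] KL(3), of n]
        by (simp add: algebra_simps)
    qed
  qed
  have "(\<lambda>x. K (L x)) = (\<lambda>x. L (K x))"
  proof (rule linear_eqI_nonneg)
    show "linear (\<lambda>x. K (L x))" "linear (\<lambda>x. L (K x))"
      using linear_compose[OF orth_boundD(1)[OF K0] orth_boundD(1)[OF L0]]
        linear_compose[OF orth_boundD(1)[OF L0] orth_boundD(1)[OF K0]] by (simp_all add: o_def)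
    show "K (L x) = L (K x)" if "0 \<le> x" for x
      using le[OF K0 L0 that] le[OF L0 K0 that] by (rule antisym)
  qed
  then show ?thesis by (rule fun_cong)
qed

section \<open>Scalar bounds for an operator on a band\<close>

definition above_on :: "real \<Rightarrow> ('a::dedekind_complete_banach_lattice \<Rightarrow> 'a) \<Rightarrow> 'a band_proj \<Rightarrow> bool"
  where "above_on s K p \<longleftrightarrow> (\<forall>x\<ge>0. s *\<^sub>R app_proj p x \<le> K (app_proj p x))"

definition below_on :: "real \<Rightarrow> ('a::dedekind_complete_banach_lattice \<Rightarrow> 'a) \<Rightarrow> 'a band_proj \<Rightarrow> bool"
  where "below_on s K p \<longleftrightarrow> (\<forall>x\<ge>0. K (app_proj p x) \<le> s *\<^sub>R app_proj p x)"

lemma below_on_iff_above_on: "below_on s K p \<longleftrightarrow> above_on (- s) (\<lambda>x. - K x) p"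
  by (simp add: below_on_def above_on_def)

lemma above_on_mono:
  assumes "above_on s K p" "q \<le> p" "r \<le> s"
  shows "above_on r K q"
  unfolding above_on_def
proof (intro allI impI)
  fix x :: 'a assume x: "0 \<le> x"
  have "r *\<^sub>R app_proj q x \<le> s *\<^sub>R app_proj q x"
    using assms(3) x by (intro scaleR_right_mono app_nonneg)
  also have "s *\<^sub>R app_proj q x \<le> K (app_proj q x)"
    using assms(1,2) app_nonneg[OF x, of q] unfolding above_on_def by (metis app_app_of_le)
  finally show "r *\<^sub>R app_proj q x \<le> K (app_proj q x)" .
qed

lemma below_on_mono:
  assumes "below_on s K p" "q \<le> p" "s \<le> r"
  shows "below_on r K q"
  using above_on_mono[OF assms(1)[unfolded below_on_iff_above_on] assms(2), of "- r"] assms(3)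
  by (simp add: below_on_iff_above_on)

text \<open>The bound \<open>- d I \<le> L\<close> for \<open>L = K - s I\<close> takes the place of
  a limit: it yields \<open>d p x \<le> L S + d S\<close> for each \<open>p \<in> A\<close>, where
  \<open>S\<close> is the image of \<open>x\<close> under \<open>Sup A\<close>. The right-hand side
  does not depend on \<open>p\<close>, so \<open>app_Sup_least\<close> puts \<open>S\<close> on the
  left, and \<open>d S\<close> cancels.\<close>

lemma above_on_Sup:
  fixes A :: "'a::dedekind_complete_banach_lattice band_proj set"
  assumes K: "orth_bound c K" and A: "\<And>p. p \<in> A \<Longrightarrow> above_on s K p"
  shows "above_on s K (Sup A)"
proof (cases "A = {}")
  case True
  then show ?thesis
    by (simp add: above_on_def app_bot linear_0[OF orth_boundD(1)[OF K]])
next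
  case False
  have "orth_bound (c + \<bar>s\<bar> * 1) (\<lambda>x. K x - s *\<^sub>R x)"
    by (rule orth_bound_diff[OF K orth_bound_scaleR[OF orth_bound_id]])
  then obtain d where d: "0 < d" and L: "orth_bound d (\<lambda>x. K x - s *\<^sub>R x)"
    by (rule orth_bound_pos)
  define L where "L x = K x - s *\<^sub>R x" for x
  have L: "orth_bound d L" using L by (simp add: L_def[abs_def])
  note l = orth_boundD[OF L]
  show ?thesis
    unfolding above_on_def
  proof (intro allI impI)
    fix x :: 'a assume x: "0 \<le> x"
    define S where "S = app_proj (Sup A) x"
    have "S \<le> (1 / d) *\<^sub>R (L S + d *\<^sub>R S)"
      unfolding S_def
    proof (rule app_Sup_least[OF False x], fold S_def)
      fix p assume p: "p \<in> A"
      have "app_proj p x \<le> S" using p x by (simp add: S_def app_le_app Sup_upper)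
      then have "- (d *\<^sub>R (S - app_proj p x)) \<le> L (S - app_proj p x)" by (intro l(2)) simp
      moreover have "0 \<le> L (app_proj p x)"
        using A[OF p] x by (simp add: above_on_def L_def)
      ultimately have "0 + - (d *\<^sub>R (S - app_proj p x)) \<le> L (app_proj p x) + L (S - app_proj p x)"
        by (intro add_mono)
      then have "d *\<^sub>R app_proj p x \<le> L S + d *\<^sub>R S"
        by (simp add: linear_diff[OF l(1)] scaleR_right_diff_distrib algebra_simps)
      then have "(1 / d) *\<^sub>R (d *\<^sub>R app_proj p x) \<le> (1 / d) *\<^sub>R (L S + d *\<^sub>R S)"
        using d by (intro scaleR_left_mono) auto
      then show "app_proj p x \<le> (1 / d) *\<^sub>R (L S + d *\<^sub>R S)" using d by simp
    qed
    then have "d *\<^sub>R S \<le> d *\<^sub>R ((1 / d) *\<^sub>R (L S + d *\<^sub>R S))"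
      using d by (intro scaleR_left_mono) auto
    then have "0 \<le> L S" using d by simp
    then show "s *\<^sub>R app_proj (Sup A) x \<le> K (app_proj (Sup A) x)" by (simp add: L_def S_def)
  qed
qed

lemma below_on_Sup:
  assumes K: "orth_bound c K" and A: "\<And>p. p \<in> A \<Longrightarrow> below_on s K p"
  shows "below_on s K (Sup A)"
  using above_on_Sup[OF orth_bound_uminus[OF K]] A by (simp add: below_on_iff_above_on)

lemma above_on_sup:
  assumes "orth_bound c K" "above_on s K p" "above_on s K q"
  shows "above_on s K (sup p q)"
  using above_on_Sup[OF assms(1), of "{p, q}" s] assms(2,3) by auto

lemma below_on_sup:
  assumes "orth_bound c K" "below_on s K p" "below_on s K q"
  shows "below_on s K (sup p q)"
  using below_on_Sup[OF assms(1), of "{p, q}" s] assms(2,3) by auto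

lemma above_on_below_on_disjoint:
  assumes "above_on s K p" "below_on r K p" "r < s"
  shows "p = bot"
proof (rule band_proj_eqI)
  fix x :: 'a assume x: "0 \<le> x"
  have "s *\<^sub>R app_proj p x \<le> r *\<^sub>R app_proj p x"
    using assms(1,2) x unfolding above_on_def below_on_def by (meson order_trans)
  then have "(s - r) *\<^sub>R app_proj p x \<le> 0" by (simp add: scaleR_left_diff_distrib)
  then have "(1 / (s - r)) *\<^sub>R ((s - r) *\<^sub>R app_proj p x) \<le> (1 / (s - r)) *\<^sub>R 0"
    using assms(3) by (intro scaleR_left_mono) auto
  then have "app_proj p x \<le> 0" using assms(3) by simp
  then show "app_proj p x = app_proj bot x" using x by (simp add: app_bot antisym[OF _ app_nonneg])
qed

lemma above_on_archimedean:
  assumes "\<And>r. r < s \<Longrightarrow> above_on r K p"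
  shows "above_on s K p"
  unfolding above_on_def
proof (intro allI impI)
  fix x :: 'a assume x: "0 \<le> x"
  show "s *\<^sub>R app_proj p x \<le> K (app_proj p x)"
  proof (rule archimedean_le)
    fix e :: real assume "0 < e"
    then show "s *\<^sub>R app_proj p x \<le> K (app_proj p x) + e *\<^sub>R app_proj p x"
      using assms[of "s - e"] x by (simp add: above_on_def scaleR_left_diff_distrib algebra_simps)
  qed
qed

lemma below_on_archimedean:
  assumes "\<And>r. s < r \<Longrightarrow> below_on r K p"
  shows "below_on s K p"
  unfolding below_on_iff_above_on
  by (rule above_on_archimedean) (metis assms below_on_iff_above_on minus_less_iff minus_minus)


section \<open>Borel codes\<close>

text \<open>
  One evaluation function serves three purposes: its value in \<open>bool\<close> is satisfaction at a point, its
  value in sets is the coded Borel set, and its value in band projections is the measure of that set.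
\<close>

datatype 'g borel_code = Gen 'g | Neg "'g borel_code" | Conj "nat \<Rightarrow> 'g borel_code"

primrec eval_code :: "('g \<Rightarrow> 'b::{boolean_algebra, complete_lattice}) \<Rightarrow> 'g borel_code \<Rightarrow> 'b" where
  "eval_code a (Gen n) = a n"
| "eval_code a (Neg c) = - eval_code a c"
| "eval_code a (Conj d) = (INF k. eval_code a (d k))"

text \<open>The requirements that the sequence in the satisfiability proof has to decide; countable
  branching keeps them countable, so they can be met one at a time.\<close>

primrec subcodes :: "'g borel_code \<Rightarrow> 'g borel_code set" where
  "subcodes (Gen n) = {Gen n}"
| "subcodes (Neg c) = insert (Neg c) (subcodes c)"
| "subcodes (Conj d) = insert (Conj d) (\<Union>k. subcodes (d k))"

lemma subcodes_refl: "c \<in> subcodes c"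
  by (cases c) auto

lemma countable_subcodes: "countable (subcodes c)"
  by (induction c) auto

lemma subcodes_closed:
  "Neg d \<in> subcodes c \<Longrightarrow> d \<in> subcodes c"
  "Conj e \<in> subcodes c \<Longrightarrow> e k \<in> subcodes c"
  by (induction c) (auto intro: subcodes_refl)

lemma INF_inf_bot_exists:
  fixes b :: "'b::{boolean_algebra, complete_lattice}"
  assumes "b \<noteq> bot" "inf b (INF k. d k) = bot"
  shows "\<exists>k::nat. inf b (- d k) \<noteq> bot"
proof (rule ccontr)
  assume "\<not> ?thesis"
  then have "b \<le> d k" for k by (simp add: inf_shunt)
  then have "b \<le> (INF k. d k)" by (rule INF_greatest)
  then show False using assms by (simp add: inf_absorb1)
qed

text \<open>
  The Rasiowa--Sikorski construction: a descending sequence of nonzero elements that decides all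
  subcodes of \<open>c\<close>, and decides a conjunction negatively only together with one of its members.
\<close>

lemma eval_code_nonzero_satisfiable:
  fixes a :: "'g \<Rightarrow> 'b::{boolean_algebra, complete_lattice}"
  assumes nz: "eval_code a c \<noteq> bot"
  shows "\<exists>w. eval_code (w :: 'g \<Rightarrow> bool) c"
proof -
  obtain s :: "nat \<Rightarrow> 'g borel_code" where s: "range s = subcodes c"
    using countable_subcodes subcodes_refl by (metis empty_iff range_from_nat_into)
  define good where "good d b \<longleftrightarrow> b \<le> eval_code a d \<or>
    (b \<le> - eval_code a d \<and> (\<forall>e. d = Conj e \<longrightarrow> (\<exists>k. b \<le> - eval_code a (e k))))" for d b
  have step: "\<exists>b'. b' \<noteq> bot \<and> b' \<le> b \<and> good d b'" if b: "b \<noteq> bot" for b d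
  proof (cases "inf b (eval_code a d) = bot")
    case False
    then show ?thesis by (intro exI[of _ "inf b (eval_code a d)"]) (auto simp: good_def)
  next
    case True
    then have le: "b \<le> - eval_code a d" by (simp add: inf_shunt)
    show ?thesis
    proof (cases "\<exists>e. d = Conj e")
      case True
      then obtain e where e: "d = Conj e" by blast
      obtain k where k: "inf b (- eval_code a (e k)) \<noteq> bot"
        using INF_inf_bot_exists[OF b, of "\<lambda>k. eval_code a (e k)"] \<open>inf b _ = bot\<close> e by auto
      show ?thesis
        using k le e by (intro exI[of _ "inf b (- eval_code a (e k))"]) (auto simp: good_def le_infI1 intro: inf.cobounded2)
    next
      case False
      then show ?thesis using b le by (intro exI[of _ b]) (auto simp: good_def)
    qed
  qed
  obtain b where b0: "b 0 = eval_code a c" and b: "\<And>n. b n \<noteq> bot"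
    and bS: "\<And>n. b (Suc n) \<le> b n \<and> good (s n) (b (Suc n))"
  proof -
    have "\<exists>b. \<forall>n. (b n \<noteq> bot \<and> (n = 0 \<longrightarrow> b n = eval_code a c)) \<and> (b (Suc n) \<le> b n \<and> good (s n) (b (Suc n)))"
      by (rule dependent_nat_choice) (use nz step in auto)
    then show thesis using that by blast
  qed
  have dec: "b m \<le> b n" if "n \<le> m" for m n
    using that by (induction rule: dec_induct) (use bS order_trans in blast)+
  \<comment> \<open>\<open>F\<close> collects the codes forced by the sequence. The valuation sought
    is its restriction to the generators; by \<open>truth\<close> below, evaluation under it agrees
    with \<open>F\<close> on all subcodes.\<close>
  define F where "F d \<longleftrightarrow> (\<exists>n. b n \<le> eval_code a d)" for d
  have consistent: "\<not> (F d \<and> (\<exists>m. b m \<le> - eval_code a d))" for d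
  proof
    assume "F d \<and> (\<exists>m. b m \<le> - eval_code a d)"
    then obtain n m where "b n \<le> eval_code a d" "b m \<le> - eval_code a d" by (auto simp: F_def)
    then have "b (max n m) \<le> inf (eval_code a d) (- eval_code a d)"
      using dec[of n "max n m"] dec[of m "max n m"] by (meson le_infI max.cobounded1 max.cobounded2 order_trans)
    then show False using b[of "max n m"] by (simp add: bot_unique)
  qed
  have decided: "F d \<or> (\<exists>m. b m \<le> - eval_code a d \<and> (\<forall>e. d = Conj e \<longrightarrow> (\<exists>k. b m \<le> - eval_code a (e k))))"
    if d: "d \<in> subcodes c" for d
  proof -
    obtain n where n: "d = s n" using d unfolding s[symmetric] by (rule rangeE)
    have "good d (b (Suc n))" using bS n by simp
    then show ?thesis unfolding good_def F_def by (elim disjE) blast+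
  qed
  have truth: "eval_code (\<lambda>n. F (Gen n)) d \<longleftrightarrow> F d" if "d \<in> subcodes c" for d
    using that
  proof (induction d)
    case (Neg d)
    have "F (Neg d) \<longleftrightarrow> \<not> F d"
      using consistent[of d] decided[OF subcodes_closed(1)[OF Neg.prems]] by (auto simp: F_def)
    then show ?case using Neg.IH[OF subcodes_closed(1)[OF Neg.prems]] by simp
  next
    case (Conj e)
    have "F (Conj e) \<longleftrightarrow> (\<forall>k. F (e k))"
    proof
      assume "F (Conj e)"
      then obtain n where n: "b n \<le> (INF k. eval_code a (e k))" by (auto simp: F_def)
      show "\<forall>k. F (e k)"
        unfolding F_def using n by (meson INF_lower UNIV_I order_trans)
    next
      \<comment> \<open>Were \<open>Conj e\<close> decided negatively, a single \<open>e k\<close>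
        would have been refuted with it, against \<open>consistent\<close>.\<close>
      assume all: "\<forall>k. F (e k)"
      show "F (Conj e)"
        using decided[OF Conj.prems] all consistent by blast
    qed
    then show ?case using Conj.IH[OF rangeI subcodes_closed(2)[OF Conj.prems]] by simp
  qed simp
  have "F c" unfolding F_def using b0 by (metis order_refl)
  then show ?thesis using truth[OF subcodes_refl] by blast
qed

definition Conj2 :: "'g borel_code \<Rightarrow> 'g borel_code \<Rightarrow> 'g borel_code"
  where "Conj2 c d = Conj (\<lambda>k. if k = 0 then c else d)"

lemma eval_Conj2: "eval_code a (Conj2 c d) = inf (eval_code a c) (eval_code a d)"
proof (rule antisym)
  show "eval_code a (Conj2 c d) \<le> inf (eval_code a c) (eval_code a d)"
    unfolding Conj2_def eval_code.simps
    by (intro le_infI INF_lower2[of 0] INF_lower2[of 1]) auto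
  show "inf (eval_code a c) (eval_code a d) \<le> eval_code a (Conj2 c d)"
    unfolding Conj2_def eval_code.simps by (rule INF_greatest) auto
qed

lemma eval_code_set: "t \<in> eval_code G c \<longleftrightarrow> eval_code (\<lambda>n. t \<in> G n) c"
  by (induction c) auto

text \<open>If the inequality failed, the code for \<open>c\<close> without \<open>d\<close>,
  conjoined with all relations, would still have a nonzero value because each relation has value
  \<open>top\<close>. A valuation satisfying it is, by \<open>point\<close>, membership of an actual
  \<open>t\<close>, which lies in the first set and not in the second.\<close>

lemma eval_code_mono_of_relations:
  fixes a :: "'g \<Rightarrow> 'b::{boolean_algebra, complete_lattice}" and G :: "'g \<Rightarrow> 't set"
  assumes cnt: "countable Rel" and rel: "\<And>r. r \<in> Rel \<Longrightarrow> eval_code a r = top"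
    and point: "\<And>w. (\<And>r. r \<in> Rel \<Longrightarrow> eval_code w r) \<Longrightarrow> \<exists>t. w = (\<lambda>n. t \<in> G n)"
    and sub: "eval_code G c \<subseteq> eval_code G d"
  shows "eval_code a c \<le> eval_code a d"
proof (rule ccontr)
  \<comment> \<open>The added tautology makes the set nonempty, hence the range of a
    sequence.\<close>
  define Rel' where "Rel' = insert (Neg (Conj2 c (Neg c))) Rel"
  have cnt': "countable Rel'" "Rel' \<noteq> {}" using cnt by (simp_all add: Rel'_def)
  define s where "s = from_nat_into Rel'"
  have s: "range s = Rel'"
    unfolding s_def by (rule range_from_nat_into[OF cnt'(2,1)])
  have "eval_code a (s k) = top" for k
  proof -
    have "s k \<in> Rel'" using s by blast
    then show ?thesis using rel by (auto simp: Rel'_def eval_Conj2)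
  qed
  then have top: "eval_code a (Conj s) = top" by simp
  assume "\<not> eval_code a c \<le> eval_code a d"
  then have "eval_code a (Conj2 (Conj s) (Conj2 c (Neg d))) \<noteq> bot"
    using top by (simp add: eval_Conj2 inf_shunt del: eval_code.simps(3))
  then obtain w where w: "eval_code w (Conj2 (Conj s) (Conj2 c (Neg d)))"
    using eval_code_nonzero_satisfiable by blast
  then have "eval_code w r" if "r \<in> Rel" for r
  proof -
    have "r \<in> range s" using that s by (simp add: Rel'_def)
    then show ?thesis using w by (auto simp: eval_Conj2)
  qed
  then obtain t where t: "w = (\<lambda>n. t \<in> G n)" using point by blast
  have "t \<in> eval_code G c" "t \<notin> eval_code G d"
    using w by (simp_all add: eval_Conj2 eval_code_set[of t] t del: eval_code.simps(3))
  then show False using sub by blast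
qed

lemma sigma_sets_range_eval_code:
  assumes "A \<in> sigma_sets UNIV (range G)"
  shows "\<exists>c. eval_code G c = A"
  using assms
proof (induction rule: sigma_sets.induct)
  case (Basic A)
  then show ?case by (metis eval_code.simps(1) rangeE)
next
  case Empty
  have "eval_code G (Conj2 (Gen undefined) (Neg (Gen undefined))) = {}" by (simp add: eval_Conj2)
  then show ?case by blast
next
  case (Compl A)
  then show ?case by (metis Compl_eq_Diff_UNIV eval_code.simps(2))
next
  case (Union A)
  then obtain c where "\<And>i. eval_code G (c i) = A i" by metis
  then have "eval_code G (Neg (Conj (\<lambda>i. Neg (c i)))) = (\<Union>i. A i)" by simp
  then show ?case by blast
qed

definition Disj :: "(nat \<Rightarrow> 'g borel_code) \<Rightarrow> 'g borel_code"
  where "Disj d = Neg (Conj (\<lambda>i. Neg (d i)))"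

definition Imp :: "'g borel_code \<Rightarrow> 'g borel_code \<Rightarrow> 'g borel_code"
  where "Imp c d = Neg (Conj2 c (Neg d))"

lemma uminus_INF_uminus:
  fixes f :: "'i \<Rightarrow> 'b::{boolean_algebra, complete_lattice}"
  shows "- (INF i\<in>I. - f i) = (SUP i\<in>I. f i)"
proof (rule antisym)
  have "- (SUP i\<in>I. f i) \<le> (INF i\<in>I. - f i)"
    by (rule INF_greatest) (simp add: SUP_upper)
  then show "- (INF i\<in>I. - f i) \<le> (SUP i\<in>I. f i)" by (rule compl_le_swap2)
  show "(SUP i\<in>I. f i) \<le> - (INF i\<in>I. - f i)"
    by (rule SUP_least, rule compl_le_swap1, rule INF_lower)
qed

lemma eval_Disj: "eval_code a (Disj d) = (SUP i. eval_code a (d i))"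
  by (simp add: Disj_def uminus_INF_uminus)

lemma eval_Imp_top: "eval_code a (Imp c d) = top \<longleftrightarrow> eval_code a c \<le> eval_code a d"
proof -
  have "eval_code a (Imp c d) = top \<longleftrightarrow> inf (eval_code a c) (- eval_code a d) = bot"
    unfolding Imp_def eval_code.simps eval_Conj2 by (metis compl_bot_eq compl_top_eq double_compl)
  then show ?thesis by (simp add: inf_shunt)
qed

lemma eval_Imp_bool: "eval_code w (Imp c d) \<longleftrightarrow> (eval_code w c \<longrightarrow> eval_code w d)"
  by (simp add: Imp_def eval_Conj2)


section \<open>Borel homomorphisms\<close>

text \<open>These two clauses make \<open>h\<close> a \<open>\<sigma>\<close>-homomorphism on the
  Borel sets: binary meets come from sequences with two values, and \<open>h {} = bot\<close> from
  the empty set and its complement. Values at other sets are unrestricted.\<close>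

definition borel_hom :: "('t::topological_space set \<Rightarrow> 'b::{boolean_algebra, complete_lattice}) \<Rightarrow> bool"
  where "borel_hom h \<longleftrightarrow> (\<forall>A\<in>sets borel. h (- A) = - h A) \<and>
    (\<forall>A :: nat \<Rightarrow> 't set. range A \<subseteq> sets borel \<longrightarrow> h (\<Inter>i. A i) = (INF i. h (A i)))"

context
  fixes h :: "'t::topological_space set \<Rightarrow> 'b::{boolean_algebra, complete_lattice}"
  assumes h: "borel_hom h"
begin

lemma hom_compl: "A \<in> sets borel \<Longrightarrow> h (- A) = - h A"
  using h by (simp add: borel_hom_def)

lemma hom_INF: "(\<And>i::nat. A i \<in> sets borel) \<Longrightarrow> h (\<Inter>i. A i) = (INF i. h (A i))"
  using h unfolding borel_hom_def by blast

lemma hom_SUP: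
  assumes "\<And>i::nat. A i \<in> sets borel"
  shows "h (\<Union>i. A i) = (SUP i. h (A i))"
proof -
  have "h (\<Union>i. A i) = - h (- (\<Union>i. A i))"
    using assms by (subst hom_compl) auto
  also have "- (\<Union>i. A i) = (\<Inter>i. - A i)" by auto
  also have "h (\<Inter>i. - A i) = (INF i. h (- A i))"
    by (rule hom_INF) (rule borel_comp[OF assms])
  also have "\<dots> = (INF i. - h (A i))"
    using assms by (simp add: hom_compl)
  finally show ?thesis by (simp add: uminus_INF_uminus)
qed

lemma hom_inf:
  assumes "A \<in> sets borel" "B \<in> sets borel"
  shows "h (A \<inter> B) = inf (h A) (h B)"
proof -
  have "h (A \<inter> B) = h (\<Inter>i::nat. if i = 0 then A else B)"
    by (rule arg_cong[of _ _ h]) (auto split: if_splits intro: exI[of _ 0] exI[of _ 1])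
  also have "\<dots> = (INF i::nat. h (if i = 0 then A else B))"
    by (rule hom_INF) (use assms in auto)
  also have "\<dots> = inf (h A) (h B)"
  proof (rule antisym)
    show "(INF i::nat. h (if i = 0 then A else B)) \<le> inf (h A) (h B)"
      by (intro le_infI INF_lower2[of 0] INF_lower2[of 1]) auto
    show "inf (h A) (h B) \<le> (INF i::nat. h (if i = 0 then A else B))"
      by (rule INF_greatest) auto
  qed
  finally show ?thesis .
qed

lemma hom_mono: "A \<in> sets borel \<Longrightarrow> B \<in> sets borel \<Longrightarrow> A \<subseteq> B \<Longrightarrow> h A \<le> h B"
  by (metis hom_inf inf.absorb_iff1 inf.orderI)

lemma hom_empty: "h {} = bot"
  using hom_inf[of "{}" UNIV] hom_compl[of "{}"]
  by (simp add: inf_shunt)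

lemma hom_sup:
  assumes "A \<in> sets borel" "B \<in> sets borel"
  shows "h (A \<union> B) = sup (h A) (h B)"
proof -
  have "h (A \<union> B) = - h (- A \<inter> - B)"
    using assms by (subst hom_compl[symmetric]) auto
  also have "\<dots> = sup (h A) (h B)"
    using assms by (subst hom_inf) (auto simp: hom_compl)
  finally show ?thesis .
qed

lemma hom_disjoint: "A \<in> sets borel \<Longrightarrow> B \<in> sets borel \<Longrightarrow> A \<inter> B = {} \<Longrightarrow> inf (h A) (h B) = bot"
  by (metis hom_inf hom_empty)

end

lemma borel_hom_cong_eval_code:
  assumes h: "borel_hom h" and G: "\<And>g. G g \<in> sets borel"
    and gen: "\<And>g. h (G g) = a g"
  shows "eval_code G c \<in> sets borel \<and> h (eval_code G c) = eval_code a c"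
proof (induction c)
  case (Conj d)
  then have "eval_code G (d i) \<in> sets borel" "h (eval_code G (d i)) = eval_code a (d i)" for i by auto
  then show ?case using hom_INF[OF h, of "\<lambda>i. eval_code G (d i)"] by auto
next
  case (Neg d)
  then show ?case using hom_compl[OF h, of "eval_code G d"] by auto
qed (use G gen in auto)

text \<open>The flag selects the coordinate, \<open>True\<close> for the real part.\<close>

definition half_plane :: "bool \<times> rat \<Rightarrow> complex set"
  where "half_plane = (\<lambda>(b, q). {t. of_rat q < (if b then Re t else Im t)})"

lemma half_plane_borel: "half_plane g \<in> sets borel"
proof -
  have "{t. of_rat q < Re t} \<in> sets borel" "{t. of_rat q < Im t} \<in> sets borel" for q
    by measurable
  then show ?thesis by (auto simp: half_plane_def split: prod.split)
qed

lemma open_half_plane_real: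
  "{t. a < (if b then Re t else Im t)} = (\<Union>q\<in>{q. a < of_rat q}. half_plane (b, q))"
  using of_rat_dense[of a "if b then Re _ else Im _"] less_trans
  by (fastforce simp: half_plane_def)

lemma sets_borel_half_planes: "sets borel = sigma_sets UNIV (range half_plane)"
proof -
  have gt: "{t. a < (if b then Re t else Im t)} \<in> sigma_sets UNIV (range half_plane)" for a b
    unfolding open_half_plane_real
    by (rule sigma_sets_UNION) (auto intro!: sigma_sets.Basic countable_image)
  have "sets (borel :: complex measure) =
      sigma_sets UNIV ((\<lambda>(a, i). {x::complex. a < x \<bullet> i}) ` (UNIV \<times> Basis))"
    unfolding borel_eq_halfspace_greater by (rule sets_measure_of) simp
  also have "\<dots> \<subseteq> sigma_sets UNIV (range half_plane)"
  proof (rule sigma_sets_mono, rule subsetI)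
    fix A assume "A \<in> (\<lambda>(a, i). {x::complex. a < x \<bullet> i}) ` (UNIV \<times> Basis)"
    then obtain a i where "i \<in> {1, \<i>}" "A = {x. a < x \<bullet> i}" by (auto simp: Basis_complex_def)
    then have "A = {t. a < (if i = 1 then Re t else Im t)}" by (cases "i = 1") auto
    then show "A \<in> sigma_sets UNIV (range half_plane)" using gt by blast
  qed
  finally have "sets borel \<subseteq> sigma_sets UNIV (range half_plane)" .
  moreover have "range half_plane \<subseteq> sets borel" using half_plane_borel by blast
  then have "sigma_sets UNIV (range half_plane) \<subseteq> sets borel"
    using sets.sigma_sets_subset[of "range half_plane" borel] by simp
  ultimately show ?thesis by (rule antisym)
qed


section \<open>The spectral homomorphism of a pair of orthomorphisms\<close>

text \<open>The complement of the classical resolution of the identity: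
  \<open>- level_proj K q\<close> is the spectral projection for \<open>K \<le> q\<close>.\<close>

definition level_proj :: "('a::dedekind_complete_banach_lattice \<Rightarrow> 'a) \<Rightarrow> real \<Rightarrow> 'a band_proj"
  where "level_proj K q = pos_proj (\<lambda>x. K x - q *\<^sub>R x)"

lemma orth_bound_shift:
  assumes "orth_bound c K"
  shows "orth_bound (c + \<bar>q\<bar>) (\<lambda>x. K x - q *\<^sub>R x)"
  using orth_bound_diff[OF assms orth_bound_scaleR[OF orth_bound_id, of q]] by simp

context
  fixes K :: "'a::dedekind_complete_banach_lattice \<Rightarrow> 'a" and c :: real
  assumes K: "orth_bound c K"
begin

lemma above_on_level: "above_on q K (level_proj K q)"
  using pos_proj_nonneg[OF orth_bound_shift[OF K]] by (simp add: above_on_def level_proj_def)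

lemma below_on_level: "below_on q K (- level_proj K q)"
  using pos_proj_nonpos[OF orth_bound_shift[OF K]]
  by (simp add: below_on_def level_proj_def app_compl)

lemma level_least: "below_on q K (- p) \<Longrightarrow> level_proj K q \<le> p"
  unfolding level_proj_def by (rule pos_proj_least) (simp add: below_on_def app_compl)

lemma level_antimono: "q \<le> r \<Longrightarrow> level_proj K r \<le> level_proj K q"
  by (intro level_least below_on_mono[OF below_on_level order_refl])

text \<open>Off the join, \<open>K \<le> q + 1 / (n + 1)\<close> for every \<open>n\<close>, hence
  \<open>K \<le> q\<close>, and minimality of the level applies. This infinitary relation is what
  yields strict inequalities at a point.\<close>

lemma level_right_continuous:
  "level_proj K (of_rat q) \<le> (SUP n. level_proj K (of_rat (q + 1 / of_nat (Suc n))))"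
proof (rule level_least, rule below_on_archimedean)
  fix r :: real assume r: "of_rat q < r"
  define p where "p = (SUP n. level_proj K (of_rat (q + 1 / of_nat (Suc n))))"
  obtain n where n: "inverse (real (Suc n)) < r - real_of_rat q"
    using reals_Archimedean[of "r - real_of_rat q"] r by auto
  have "- p \<le> - level_proj K (of_rat (q + 1 / of_nat (Suc n)))"
    unfolding p_def by (simp only: compl_le_compl_iff) (rule SUP_upper, simp)
  then have "below_on (of_rat (q + 1 / of_nat (Suc n))) K (- p)"
    by (rule below_on_mono[OF below_on_level]) simp
  then show "below_on r K (- (SUP n. level_proj K (of_rat (q + 1 / of_nat (Suc n)))))"
    unfolding p_def[symmetric]
    by (rule below_on_mono[OF _ order_refl]) (use n in \<open>simp add: of_rat_add of_rat_divide inverse_eq_divide\<close>)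
qed

lemma level_large: "c \<le> q \<Longrightarrow> level_proj K q = bot"
proof -
  assume q: "c \<le> q"
  have "below_on c K (- bot)"
    using orth_boundD(3)[OF K] by (simp add: below_on_def app_top)
  then have "level_proj K q \<le> bot" by (intro level_least below_on_mono[OF _ order_refl q])
  then show ?thesis by (simp add: bot_unique)
qed

lemma level_small: "q < - c \<Longrightarrow> level_proj K q = top"
proof -
  assume q: "q < - c"
  have "above_on (- c) K top"
    using orth_boundD(2)[OF K] by (simp add: above_on_def app_top)
  then have "above_on (- c) K (- level_proj K q)" by (rule above_on_mono) auto
  then have "- level_proj K q = bot" using below_on_level q by (rule above_on_below_on_disjoint)
  then show ?thesis by (metis compl_bot_eq double_compl)
qed

end

text \<open>The relations say of a valuation that, for each coordinate, the accepted rationals are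
  downward closed, nonempty, bounded above and without a largest element. The pair \<open>r\<close>
  packs two levels into one variable so that \<open>countable_setcompr2\<close> applies.\<close>

definition level_rel :: "real \<Rightarrow> (bool \<times> rat) borel_code set"
  where "level_rel c =
    {Imp (Gen (b, q)) (Disj (\<lambda>n. Gen (b, q + 1 / of_nat (Suc n)))) | b q. True} \<union>
    {Imp (Gen (b, snd r)) (Gen (b, fst r)) | b r. fst r \<le> snd r} \<union>
    {Neg (Gen (b, q)) | b q. c \<le> of_rat q} \<union>
    {Gen (b, q) | b q. of_rat q < - c}"

lemma countable_setcompr2:
  fixes f :: "'x::countable \<Rightarrow> 'y::countable \<Rightarrow> 'z"
  shows "countable {f x y |x y. P x y}"
proof -
  have "{f x y |x y. P x y} = (\<lambda>(x, y). f x y) ` {(x, y). P x y}" by auto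
  then show ?thesis by simp
qed

lemma countable_level_rel: "countable (level_rel c)"
  unfolding level_rel_def by (intro countable_Un countable_setcompr2)

lemma level_rel_point:
  fixes w :: "bool \<times> rat \<Rightarrow> bool"
  assumes rel: "\<And>r. r \<in> level_rel c \<Longrightarrow> eval_code w r"
  shows "\<exists>t. w = (\<lambda>g. t \<in> half_plane g)"
proof -
  have r1: "\<exists>n. w (b, q + 1 / of_nat (Suc n))" if "w (b, q)" for b q
  proof -
    have "Imp (Gen (b, q)) (Disj (\<lambda>n. Gen (b, q + 1 / of_nat (Suc n)))) \<in> level_rel c"
      unfolding level_rel_def by blast
    from rel[OF this] show ?thesis using that by (simp add: eval_Imp_bool eval_Disj del: of_nat_Suc)
  qed
  have r2: "w (b, q)" if "w (b, r)" "q \<le> r" for b q r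
  proof -
    have "Imp (Gen (b, r)) (Gen (b, q)) \<in> {Imp (Gen (b, snd p)) (Gen (b, fst p)) | b p. fst p \<le> snd p}"
      using that(2) by (intro CollectI exI[of _ b] exI[of _ "(q, r)"]) simp
    then have "Imp (Gen (b, r)) (Gen (b, q)) \<in> level_rel c"
      unfolding level_rel_def by (intro UnI1 UnI2)
    from rel[OF this] show ?thesis using that(1) by (simp add: eval_Imp_bool)
  qed
  have r3: "\<not> w (b, q)" if "c \<le> of_rat q" for b q
  proof -
    have "Neg (Gen (b, q)) \<in> level_rel c" unfolding level_rel_def using that by blast
    from rel[OF this] show ?thesis by simp
  qed
  have r4: "w (b, q)" if "of_rat q < - c" for b q
  proof -
    have "Gen (b, q) \<in> level_rel c" unfolding level_rel_def using that by blast
    from rel[OF this] show ?thesis by simp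
  qed
  \<comment> \<open>The coordinates are the suprema of the two cuts; that a cut has no largest
    element makes the inequality in \<open>iff\<close> strict.\<close>
  define x :: "bool \<Rightarrow> real" where "x b = Sup (of_rat ` {q. w (b, q)})" for b
  have bdd: "bdd_above ((of_rat :: rat \<Rightarrow> real) ` {q. w (b, q)})" for b
    using r3 linear by (intro bdd_aboveI[of _ c]) blast
  have ne: "(of_rat :: rat \<Rightarrow> real) ` {q. w (b, q)} \<noteq> {}" for b
  proof -
    obtain q where "(of_rat q :: real) < - c" using of_rat_dense[of "- c - 1" "- c"] by auto
    then show ?thesis using r4 by blast
  qed
  have iff: "w (b, q) \<longleftrightarrow> of_rat q < x b" for b q
  proof
    assume "w (b, q)"
    then obtain n where n: "w (b, q + 1 / of_nat (Suc n))" using r1 by blast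
    have "(of_rat q :: real) < of_rat (q + 1 / of_nat (Suc n))" by (simp add: of_rat_less del: of_nat_Suc)
    also have "\<dots> \<le> x b" unfolding x_def using n by (intro cSup_upper bdd) auto
    finally show "of_rat q < x b" .
  next
    assume "of_rat q < x b"
    then obtain r where "w (b, r)" "(of_rat q :: real) < of_rat r"
      unfolding x_def using less_cSupD[OF ne] by blast
    then show "w (b, q)" using r2 by (simp add: of_rat_less less_imp_le)
  qed
  have "w = (\<lambda>g. Complex (x True) (x False) \<in> half_plane g)"
    using iff by (auto simp: half_plane_def fun_eq_iff)
  then show ?thesis by blast
qed

section \<open>Bounds that characterise the integral\<close>

definition integral_bounds ::
    "('t::topological_space set \<Rightarrow> 'a::dedekind_complete_banach_lattice band_proj) \<Rightarrow> ('t \<Rightarrow> real) \<Rightarrow> ('a \<Rightarrow> 'a) \<Rightarrow> bool"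
  where "integral_bounds h f K \<longleftrightarrow> (\<forall>A\<in>sets borel. \<forall>s.
    ((\<forall>t\<in>A. s \<le> f t) \<longrightarrow> above_on s K (h A)) \<and> ((\<forall>t\<in>A. f t \<le> s) \<longrightarrow> below_on s K (h A)))"

lemma integral_boundsD:
  assumes "integral_bounds h f K" "A \<in> sets borel"
  shows "(\<And>t. t \<in> A \<Longrightarrow> s \<le> f t) \<Longrightarrow> above_on s K (h A)"
    "(\<And>t. t \<in> A \<Longrightarrow> f t \<le> s) \<Longrightarrow> below_on s K (h A)"
  using assms unfolding integral_bounds_def by blast+

definition spectral_hom ::
    "('a::dedekind_complete_banach_lattice \<Rightarrow> 'a) \<Rightarrow> ('a \<Rightarrow> 'a) \<Rightarrow> (complex set \<Rightarrow> 'a band_proj) \<Rightarrow> bool"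
  where "spectral_hom R S h \<longleftrightarrow> borel_hom h \<and> integral_bounds h Re R \<and> integral_bounds h Im S"

definition half_plane_proj ::
    "('a::dedekind_complete_banach_lattice \<Rightarrow> 'a) \<Rightarrow> ('a \<Rightarrow> 'a) \<Rightarrow> bool \<times> rat \<Rightarrow> 'a band_proj"
  where "half_plane_proj R S = (\<lambda>(b, q). level_proj (if b then R else S) (of_rat q))"

lemma integral_bounds_of_levels:
  fixes K :: "'a::dedekind_complete_banach_lattice \<Rightarrow> 'a" and f :: "'t::topological_space \<Rightarrow> real"
  assumes K: "orth_bound c K" and h: "borel_hom h" and f: "f \<in> borel_measurable borel"
    and levels: "\<And>q. h {t. of_rat q < f t} = level_proj K (of_rat q)"
  shows "integral_bounds h f K"
  unfolding integral_bounds_def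
proof (intro ballI allI conjI impI)
  fix A :: "'t set" and s assume A: "A \<in> sets borel"
  have m: "{t. of_rat q < f t} \<in> sets borel" for q using f by measurable
  {
    assume ge: "\<forall>t\<in>A. s \<le> f t"
    show "above_on s K (h A)"
    proof (rule above_on_archimedean)
      fix r assume "r < s"
      then obtain q where q: "r < of_rat q" "of_rat q < s" using of_rat_dense by blast
      have "h A \<le> h {t. of_rat q < f t}" using q ge by (intro hom_mono[OF h A m]) force
      then show "above_on r K (h A)"
        using above_on_mono[OF above_on_level[OF K]] q levels by (simp add: less_imp_le)
    qed
  next
    assume le: "\<forall>t\<in>A. f t \<le> s"
    show "below_on s K (h A)"
    proof (rule below_on_archimedean)
      fix r assume "s < r"
      then obtain q where q: "s < of_rat q" "of_rat q < r" using of_rat_dense by blast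
      have "h A \<le> h (- {t. of_rat q < f t})"
        using q le borel_comp[OF m] by (intro hom_mono[OF h A]) force+
      then have "h A \<le> - level_proj K (of_rat q)" by (simp only: hom_compl[OF h m] levels)
      then show "below_on r K (h A)"
        using below_on_mono[OF below_on_level[OF K]] q by (simp add: less_imp_le)
    qed
  }
qed

text \<open>One inequality is minimality of the level. For the other, \<open>{q < f}\<close> is a
  countable union of sets \<open>{r \<le> f}\<close> with \<open>r > q\<close>; on such a piece
  \<open>K \<ge> r\<close>, while off the level projection \<open>K \<le> q\<close>, so the two have
  no common band.\<close>

lemma levels_of_integral_bounds:
  fixes K :: "'a::dedekind_complete_banach_lattice \<Rightarrow> 'a" and f :: "'t::topological_space \<Rightarrow> real"
  assumes K: "orth_bound c K" and h: "borel_hom h" and f: "f \<in> borel_measurable borel"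
    and bounds: "integral_bounds h f K"
  shows "h {t. q < f t} = level_proj K q"
proof (rule antisym)
  have m: "{t. q < f t} \<in> sets borel" "{t. r \<le> f t} \<in> sets borel" for q r using f by measurable
  have "below_on q K (h (- {t. q < f t}))"
    by (rule integral_boundsD(2)[OF bounds]) (use m(1) borel_comp in auto)
  then show "level_proj K q \<le> h {t. q < f t}" by (intro level_least[OF K]) (simp only: hom_compl[OF h m(1)])
  have "{t. q < f t} = (\<Union>n. {t. q + inverse (real (Suc n)) \<le> f t})"
  proof (intro antisym subsetI)
    fix t assume "t \<in> {t. q < f t}"
    then obtain n where "inverse (real (Suc n)) < f t - q" using reals_Archimedean[of "f t - q"] by auto
    then show "t \<in> (\<Union>n. {t. q + inverse (real (Suc n)) \<le> f t})" by (auto intro!: exI[of _ n])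
  qed (auto intro: less_le_trans[rotated])
  then have "h {t. q < f t} = (SUP n. h {t. q + inverse (real (Suc n)) \<le> f t})"
    using hom_SUP[OF h, of "\<lambda>n. {t. q + inverse (real (Suc n)) \<le> f t}"] m(2) by simp
  also have "\<dots> \<le> level_proj K q"
  proof (rule SUP_least)
    fix n
    define r where "r = q + inverse (real (Suc n))"
    have "above_on r K (h {t. r \<le> f t})" by (rule integral_boundsD(1)[OF bounds]) (use m in auto)
    then have "above_on r K (inf (h {t. r \<le> f t}) (- level_proj K q))" by (rule above_on_mono) auto
    moreover have "below_on q K (inf (h {t. r \<le> f t}) (- level_proj K q))"
      by (rule below_on_mono[OF below_on_level[OF K]]) auto
    ultimately have "inf (h {t. r \<le> f t}) (- level_proj K q) = bot"
      by (rule above_on_below_on_disjoint) (simp add: r_def)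
    then show "h {t. q + inverse (real (Suc n)) \<le> f t} \<le> level_proj K q"
      by (simp add: r_def inf_shunt)
  qed
  finally show "h {t. q < f t} \<le> level_proj K q" .
qed

lemma spectral_hom_exists:
  fixes R S :: "'a::dedekind_complete_banach_lattice \<Rightarrow> 'a"
  assumes R: "orth_bound c R" and S: "orth_bound c S"
  shows "\<exists>h. spectral_hom R S h"
proof -
  define a where "a = half_plane_proj R S"
  \<comment> \<open>The code of \<open>A\<close> is chosen arbitrarily; \<open>cong\<close> shows
    that the value depends on the set alone. At sets without a code the value is
    meaningless.\<close>
  define h where "h A = eval_code a (SOME e. eval_code half_plane e = A)" for A
  have K: "orth_bound c (if b then R else S)" for b using R S by simp
  have rel: "eval_code a r = top" if r: "r \<in> level_rel c" for r
    using r unfolding level_rel_def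
    using level_right_continuous[OF K] level_antimono[OF K] level_large[OF K] level_small[OF K]
    by (auto simp: eval_Imp_top eval_Disj a_def half_plane_proj_def of_rat_less_eq simp del: of_nat_Suc)
  have cong: "eval_code a d = eval_code a e" if "eval_code half_plane d = eval_code half_plane e" for d e
    by (intro antisym eval_code_mono_of_relations[OF countable_level_rel rel level_rel_point])
       (use that in auto)
  have h: "h (eval_code half_plane e) = eval_code a e" for e
    unfolding h_def by (rule cong, rule someI[of _ e]) simp
  have code: "\<exists>e. eval_code half_plane e = A" if "A \<in> sets borel" for A
    using that unfolding sets_borel_half_planes by (rule sigma_sets_range_eval_code)
  have hom: "borel_hom h"
    unfolding borel_hom_def
  proof (intro conjI ballI allI impI)
    fix A :: "complex set" assume "A \<in> sets borel"
    then obtain e where e: "eval_code half_plane e = A" using code by blast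
    show "h (- A) = - h A" using h[of "Neg e"] h[of e] by (simp add: e)
  next
    fix A :: "nat \<Rightarrow> complex set" assume "range A \<subseteq> sets borel"
    then have "\<exists>e. eval_code half_plane e = A i" for i using code by blast
    then obtain e where e: "\<And>i. eval_code half_plane (e i) = A i" by metis
    show "h (\<Inter>i. A i) = (INF i. h (A i))" using h[of "Conj e"] h[of "e _"] by (simp add: e)
  qed
  have levels: "h (half_plane g) = a g" for g using h[of "Gen g"] by simp
  have "integral_bounds h Re R"
    using levels[of "(True, _)"]
    by (intro integral_bounds_of_levels[OF R hom]) (simp_all add: half_plane_def a_def half_plane_proj_def)
  moreover have "integral_bounds h Im S"
    using levels[of "(False, _)"]
    by (intro integral_bounds_of_levels[OF S hom]) (simp_all add: half_plane_def a_def half_plane_proj_def)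
  ultimately show ?thesis using hom by (auto simp: spectral_hom_def)
qed

text \<open>The bounds force the same values at the half planes, and the value at any other Borel
  set is computed from these along a code.\<close>

lemma spectral_hom_unique:
  fixes R S :: "'a::dedekind_complete_banach_lattice \<Rightarrow> 'a"
  assumes R: "orth_bound c R" and S: "orth_bound c S"
    and h: "spectral_hom R S h" "spectral_hom R S h'" and A: "A \<in> sets borel"
  shows "h A = h' A"
proof -
  have levels: "h (half_plane g) = half_plane_proj R S g" if "spectral_hom R S h" for h g
    using levels_of_integral_bounds[OF R, of h Re] levels_of_integral_bounds[OF S, of h Im] that
    by (auto simp: spectral_hom_def half_plane_def half_plane_proj_def split: prod.split)
  obtain e where e: "eval_code half_plane e = A"
    using A unfolding sets_borel_half_planes using sigma_sets_range_eval_code by blast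
  have "g A = eval_code (half_plane_proj R S) e" if g: "spectral_hom R S g" for g
  proof -
    have "borel_hom g" using g by (simp add: spectral_hom_def)
    from borel_hom_cong_eval_code[where G = half_plane and a = "half_plane_proj R S" and c = e,
        OF this half_plane_borel levels[OF g]] show ?thesis
      by (simp add: e)
  qed
  from this[OF h(1)] this[OF h(2)] show ?thesis by (rule trans[OF _ sym])
qed


section \<open>Measures with values in the centre\<close>

lemma centerI: "orth_bound c K \<Longrightarrow> K \<in> center"
  using center_iff orth_bound_pos less_imp_le by metis

lemma centerE:
  assumes "K \<in> center"
  obtains c where "0 \<le> c" "orth_bound c K"
  using assms center_iff by blast

lemma app_in_center: "app_proj p \<in> center"
  by (rule centerI[OF orth_bound_app])

lemma center_linear: "K \<in> center \<Longrightarrow> linear K"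
  using centerE orth_boundD(1) by blast

lemma center_op_le_antisym:
  assumes "K \<in> center" "L \<in> center" "op_le K L" "op_le L K"
  shows "K = L"
  using assms by (intro linear_eqI_nonneg antisym) (auto simp: op_le_def center_linear)

lemma is_sup_in_center_unique:
  "is_sup_in center A U \<Longrightarrow> is_sup_in center A V \<Longrightarrow> U = V"
  unfolding is_sup_in_def by (blast intro: center_op_le_antisym)

lemma inf_Sup_finite_disjoint:
  fixes p :: "nat \<Rightarrow> 'b::{boolean_algebra, complete_lattice}"
  assumes "\<And>i. i \<le> N \<Longrightarrow> inf (p i) q = bot"
  shows "inf (SUP i\<in>{..N}. p i) q = bot"
  unfolding inf_shunt by (rule SUP_least) (use assms inf_shunt in auto)

lemma sum_app_disjoint:
  fixes p :: "nat \<Rightarrow> 'a::dedekind_complete_banach_lattice band_proj"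
  assumes "\<And>i j. i \<noteq> j \<Longrightarrow> inf (p i) (p j) = bot"
  shows "(\<Sum>n\<le>N. app_proj (p n) x) = app_proj (SUP n\<in>{..N}. p n) x"
proof (induction N)
  case (Suc N)
  have "inf (SUP n\<in>{..N}. p n) (p (Suc N)) = bot"
    by (rule inf_Sup_finite_disjoint) (use assms in auto)
  moreover have "(SUP n\<in>{..Suc N}. p n) = sup (SUP n\<in>{..N}. p n) (p (Suc N))"
    by (simp add: atMost_Suc sup.commute)
  ultimately show ?case using Suc by (simp add: app_sup_disjoint)
qed simp

text \<open>Partial sums of disjoint projections are the projections of the finite joins, and by
  \<open>app_Sup_least\<close> every upper bound of these in the centre dominates the full join
  pointwise.\<close>

lemma is_sup_in_center_sum_app:
  fixes p :: "nat \<Rightarrow> 'a::dedekind_complete_banach_lattice band_proj"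
  assumes disj: "\<And>i j. i \<noteq> j \<Longrightarrow> inf (p i) (p j) = bot"
  shows "is_sup_in center (range (\<lambda>N x. \<Sum>n\<le>N. app_proj (p n) x)) (app_proj (SUP n. p n))"
  unfolding is_sup_in_def
proof (intro conjI ballI impI)
  show "app_proj (SUP n. p n) \<in> center" by (rule app_in_center)
  fix L assume "L \<in> range (\<lambda>N x. \<Sum>n\<le>N. app_proj (p n) x)"
  then obtain N where L: "L = app_proj (SUP n\<in>{..N}. p n)"
    using sum_app_disjoint[of p, OF disj] by auto
  have "(SUP n\<in>{..N}. p n) \<le> (SUP n. p n)" by (rule SUP_subset_mono) auto
  then show "op_le L (app_proj (SUP n. p n))"
    unfolding op_le_def L using app_le_app by blast
next
  fix V assume V: "V \<in> center" "\<forall>L\<in>range (\<lambda>N x. \<Sum>n\<le>N. app_proj (p n) x). op_le L V"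
  show "op_le (app_proj (SUP n. p n)) V"
    unfolding op_le_def
  proof (intro allI impI)
    fix x :: 'a assume x: "0 \<le> x"
    show "app_proj (SUP n. p n) x \<le> V x"
    proof (rule app_Sup_least[OF _ x])
      fix q assume "q \<in> range p"
      then obtain n where q: "q = p n" by blast
      have "app_proj q x \<le> app_proj (SUP k\<in>{..n}. p k) x"
        unfolding q using x by (intro app_le_app SUP_upper) auto
      also have "\<dots> = (\<Sum>k\<le>n. app_proj (p k) x)"
        by (rule sum_app_disjoint[symmetric, OF disj])
      also have "\<dots> \<le> V x" using V(2) x by (auto simp: op_le_def)
      finally show "app_proj q x \<le> V x" .
    qed simp
  qed
qed

lemma sets_borel_on:
  assumes "X \<in> sets borel"
  shows "A \<in> sets (borel_on X) \<longleftrightarrow> A \<in> sets borel \<and> A \<subseteq> X"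
  using assms by (auto simp: sets_restrict_space_iff)

lemma borel_hom_op_measure:
  fixes h :: "'t::topological_space set \<Rightarrow> 'a::dedekind_complete_banach_lattice band_proj"
  assumes h: "borel_hom h" and X: "X \<in> sets borel"
  shows "op_measure center (borel_on X) (\<lambda>A. app_proj (h A))"
  unfolding op_measure_def
proof (intro conjI ballI allI impI)
  show "app_proj (h A) \<in> center" for A by (rule app_in_center)
  show "op_le (\<lambda>_. 0) (app_proj (h A))" for A by (simp add: op_le_def app_nonneg)
  show "app_proj (h {}) = (\<lambda>_. 0)" by (simp add: hom_empty[OF h] app_bot fun_eq_iff)
  fix D :: "nat \<Rightarrow> 't set"
  assume D: "range D \<subseteq> sets (borel_on X)" "disjoint_family D"
  have DB: "D n \<in> sets borel" for n using D(1) sets_borel_on[OF X] by blast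
  have "is_sup_in center (range (\<lambda>N x. \<Sum>n\<le>N. app_proj (h (D n)) x)) (app_proj (SUP n. h (D n)))"
    using D(2) by (intro is_sup_in_center_sum_app hom_disjoint[OF h DB DB]) (auto simp: disjoint_family_on_def)
  then show "is_sup_in center (range (\<lambda>N x. \<Sum>n\<le>N. app_proj (h (D n)) x)) (app_proj (h (\<Union>n. D n)))"
    by (simp add: hom_SUP[OF h DB])
qed

lemma borel_hom_spectral:
  assumes h: "borel_hom h" and X: "X \<in> sets borel"
  shows "spectral (borel_on X) (\<lambda>A. app_proj (h A))"
  unfolding spectral_def by (auto simp: sets_borel_on[OF X] hom_inf[OF h] app_inf fun_eq_iff)

text \<open>Multiplicativity makes \<open>\<nu> A\<close> idempotent, and additivity together with
  \<open>\<nu> X = id\<close> puts it below the identity, so it is a band projection. The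
  homomorphism sends \<open>A\<close> to the projection \<open>\<nu> (A \<inter> X)\<close>.\<close>

lemma spectral_measure_borel_hom:
  fixes \<nu> :: "'t::topological_space set \<Rightarrow> 'a::dedekind_complete_banach_lattice \<Rightarrow> 'a"
  assumes meas: "op_measure center (borel_on X) \<nu>" and spec: "spectral (borel_on X) \<nu>"
    and total: "\<nu> X = id" and X: "X \<in> sets borel"
  obtains h where "borel_hom h" "h X = top" "\<And>A. A \<in> sets (borel_on X) \<Longrightarrow> \<nu> A = app_proj (h A)"
proof -
  note sets = sets_borel_on[OF X]
  have cen: "\<nu> A \<in> center" "op_le (\<lambda>_. 0) (\<nu> A)" if "A \<in> sets borel" "A \<subseteq> X" for A
    using meas that by (auto simp: op_measure_def sets)
  have mult: "\<nu> (A \<inter> B) = \<nu> A \<circ> \<nu> B" if "A \<in> sets borel" "A \<subseteq> X" "B \<in> sets borel" "B \<subseteq> X" for A B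
    using spec that by (auto simp: spectral_def sets)
  have union: "is_sup_in center (range (\<lambda>N x. \<Sum>n\<le>N. \<nu> (D n) x)) (\<nu> (\<Union>n. D n))"
    if "\<And>n. D n \<in> sets borel" "\<And>n. D n \<subseteq> X" "disjoint_family D" for D :: "nat \<Rightarrow> 't set"
    using meas that unfolding op_measure_def by (auto simp: sets image_subset_iff)
  have compl: "\<nu> A x + \<nu> (X - A) x = x" if A: "A \<in> sets borel" "A \<subseteq> X" for A x
  proof -
    \<comment> \<open>Additivity is given for sequences, so the pair \<open>A\<close>,
      \<open>X - A\<close> is padded with empty sets. The partial sums are constant from index 1 on;
      at index 0 the sum is \<open>\<nu> A\<close> alone, which is why that case is treated
      separately below.\<close>
    define D where "D n = (if n = 0 then A else if n = Suc 0 then X - A else {})" for n :: nat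
    have D: "D n \<in> sets borel" "D n \<subseteq> X" for n using A X by (auto simp: D_def)
    have disj: "disjoint_family D" by (auto simp: D_def disjoint_family_on_def)
    have un: "(\<Union>n. D n) = X"
      using A by (auto simp: D_def split: if_splits intro: exI[of _ 0] exI[of _ "Suc 0"])
    have emp: "\<nu> {} = (\<lambda>_. 0)" using meas by (simp add: op_measure_def)
    have sums: "(\<Sum>n\<le>Suc N. \<nu> (D n) x) = \<nu> A x + \<nu> (X - A) x" for N x
      by (induction N) (simp_all add: D_def emp)
    have sup: "is_sup_in center (range (\<lambda>N x. \<Sum>n\<le>N. \<nu> (D n) x)) id"
      using union[OF D disj] by (simp add: un total)
    obtain c d where cd: "orth_bound c (\<nu> A)" "orth_bound d (\<nu> (X - A))"
      using cen(1) A X by (metis Diff_subset centerE sets.Diff)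
    define U where "U x = \<nu> A x + \<nu> (X - A) x" for x
    have U: "U \<in> center" unfolding U_def by (rule centerI[OF orth_bound_add[OF cd]])
    have "op_le U id"
    proof -
      have "U = (\<lambda>x. \<Sum>n\<le>Suc 0. \<nu> (D n) x)" using sums[of _ 0] by (simp add: U_def fun_eq_iff)
      then have "U \<in> range (\<lambda>N x. \<Sum>n\<le>N. \<nu> (D n) x)" by (rule range_eqI)
      then show ?thesis using sup unfolding is_sup_in_def by blast
    qed
    moreover have "op_le id U"
    proof -
      have "op_le (\<lambda>x. \<Sum>n\<le>N. \<nu> (D n) x) U" for N
      proof (cases N)
        case 0
        have "op_le (\<lambda>_. 0) (\<nu> (X - A))" using cen(2) A X by (simp add: Diff_subset)
        then show ?thesis using 0 by (simp add: op_le_def U_def D_def)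
      next
        case (Suc M)
        then show ?thesis using sums[of _ M] by (simp add: op_le_def U_def)
      qed
      then show ?thesis using sup U by (auto simp: is_sup_in_def)
    qed
    moreover have "(id :: 'a \<Rightarrow> 'a) \<in> center" by (rule conjunct1[OF sup[unfolded is_sup_in_def]])
    ultimately have "U = id" by (intro center_op_le_antisym[OF U])
    then show ?thesis by (simp add: U_def fun_eq_iff)
  qed
  have proj: "order_projection (\<nu> A)" if A: "A \<in> sets borel" "A \<subseteq> X" for A
  proof -
    have "\<nu> A x \<le> x" if "0 \<le> x" for x
    proof -
      have "0 \<le> \<nu> (X - A) x" using cen(2)[of "X - A"] A X that by (auto simp: op_le_def)
      then have "\<nu> A x + 0 \<le> \<nu> A x + \<nu> (X - A) x" by (rule add_left_mono)
      then show ?thesis by (simp add: compl[OF A])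
    qed
    then show ?thesis
      using cen[OF A] mult[OF A A] center_linear by (auto simp: order_projection_def op_le_def)
  qed
  define h where "h A = Abs_band_proj (\<nu> (A \<inter> X))" for A
  have app: "app_proj (h A) = \<nu> (A \<inter> X)" if "A \<in> sets borel" for A
    unfolding h_def using proj[of "A \<inter> X"] that X by (subst Abs_band_proj_inverse) auto
  have hcompl: "h (- A) = - h A" if A: "A \<in> sets borel" for A
  proof (rule band_proj_eqI)
    fix x :: 'a
    have eq: "- A \<inter> X = X - A \<inter> X" by auto
    have "\<nu> (A \<inter> X) x + \<nu> (X - A \<inter> X) x = x" using A X by (intro compl) auto
    then show "app_proj (h (- A)) x = app_proj (- h A) x"
      by (simp only: app_compl app[OF A] app[OF borel_comp[OF A]] eq) (simp add: algebra_simps)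
  qed
  have hinf: "h (A \<inter> B) = inf (h A) (h B)" if AB: "A \<in> sets borel" "B \<in> sets borel" for A B
  proof (rule band_proj_eqI)
    fix x :: 'a
    have eq: "A \<inter> B \<inter> X = (A \<inter> X) \<inter> (B \<inter> X)" by auto
    show "app_proj (h (A \<inter> B)) x = app_proj (inf (h A) (h B)) x"
      using AB X by (simp add: app_inf app eq mult)
  qed
  have hmono: "h A \<le> h B" if "A \<in> sets borel" "B \<in> sets borel" "A \<subseteq> B" for A B
    using hinf[OF that(1,2)] that(3) by (metis inf.absorb_iff1 inf.orderI)
  have hemp: "h {} = bot"
    by (rule band_proj_eqI) (use meas in \<open>simp add: app op_measure_def app_bot\<close>)
  have hSUP: "h (\<Union>i. A i) \<le> (SUP i. h (A i))" if A: "\<And>i::nat. A i \<in> sets borel" for A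
  proof -
    \<comment> \<open>The axiom speaks of disjoint sequences, so an arbitrary union is rewritten as
      a disjoint one with smaller terms.\<close>
    define D where "D = disjointed A"
    have D: "D i \<in> sets borel" for i unfolding D_def using sets.range_disjointed_sets[of A borel] A by blast
    have disj: "disjoint_family D" unfolding D_def by (rule disjoint_family_disjointed)
    then have disj': "disjoint_family (\<lambda>i. D i \<inter> X)" by (auto simp: disjoint_family_on_def)
    have "is_sup_in center (range (\<lambda>N x. \<Sum>n\<le>N. \<nu> (D n \<inter> X) x)) (\<nu> (\<Union>n. D n \<inter> X))"
      using D X by (intro union disj') auto
    moreover have "(\<Union>n. D n \<inter> X) = (\<Union>i. A i) \<inter> X" unfolding D_def using UN_disjointed_eq[of A] by auto
    moreover have "(\<Union>i. A i) \<in> sets borel" using A by auto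
    ultimately have "is_sup_in center (range (\<lambda>N x. \<Sum>n\<le>N. app_proj (h (D n)) x)) (app_proj (h (\<Union>i. A i)))"
      using D by (simp add: app)
    moreover have "is_sup_in center (range (\<lambda>N x. \<Sum>n\<le>N. app_proj (h (D n)) x)) (app_proj (SUP n. h (D n)))"
    proof (rule is_sup_in_center_sum_app)
      fix i j :: nat assume "i \<noteq> j"
      then have "D i \<inter> D j = {}" using disj by (auto simp: disjoint_family_on_def)
      then show "inf (h (D i)) (h (D j)) = bot" using hinf[OF D D] hemp by metis
    qed
    ultimately have "app_proj (h (\<Union>i. A i)) = app_proj (SUP n. h (D n))"
      by (rule is_sup_in_center_unique)
    then have "h (\<Union>i. A i) = (SUP n. h (D n))" by (simp add: app_proj_inject)
    also have "\<dots> \<le> (SUP i. h (A i))"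
      by (rule SUP_mono) (use hmono D A disjointed_subset in \<open>metis D_def UNIV_I\<close>)
    finally show ?thesis .
  qed
  have hom: "borel_hom h"
    unfolding borel_hom_def
  proof (intro conjI ballI allI impI hcompl antisym)
    fix A :: "nat \<Rightarrow> 't set" assume "range A \<subseteq> sets borel"
    then have A: "A i \<in> sets borel" for i by blast
    then have Int: "(\<Inter>i. A i) \<in> sets borel" by auto
    show "h (\<Inter>i. A i) \<le> (INF i. h (A i))"
      by (rule INF_greatest) (use A Int in \<open>auto intro: hmono\<close>)
    have "- (\<Inter>i. A i) = (\<Union>i. - A i)" by auto
    then have "- h (\<Inter>i. A i) \<le> (SUP i. h (- A i))"
      using hSUP[of "\<lambda>i. - A i"] A Int by (simp add: hcompl[symmetric] borel_comp)
    also have "\<dots> = - (INF i. h (A i))"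
      using uminus_INF_uminus[of "\<lambda>i. h (- A i)" UNIV] by (simp add: hcompl[OF A])
    finally show "(INF i. h (A i)) \<le> h (\<Inter>i. A i)" by (simp only: compl_le_compl_iff)
  qed
  show thesis
  proof
    show "borel_hom h" by (rule hom)
    show "h X = top" by (rule band_proj_eqI) (simp add: app[OF X] total app_top)
    show "\<nu> A = app_proj (h A)" if "A \<in> sets (borel_on X)" for A
      using that by (auto simp: sets app Int_absorb2)
  qed
qed


section \<open>Order integrals\<close>

lemma above_on_add:
  "above_on a K p \<Longrightarrow> above_on b L p \<Longrightarrow> above_on (a + b) (\<lambda>x. K x + L x) p"
  unfolding above_on_def by (simp add: scaleR_add_left add_mono)

lemma below_on_add:
  "below_on a K p \<Longrightarrow> below_on b L p \<Longrightarrow> below_on (a + b) (\<lambda>x. K x + L x) p"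
  unfolding below_on_def by (simp add: scaleR_add_left add_mono)

lemma above_on_diff:
  "above_on a K p \<Longrightarrow> below_on b L p \<Longrightarrow> above_on (a - b) (\<lambda>x. K x - L x) p"
  unfolding above_on_def below_on_def by (simp add: scaleR_left_diff_distrib diff_mono)

lemma below_on_diff:
  "below_on a K p \<Longrightarrow> above_on b L p \<Longrightarrow> below_on (a - b) (\<lambda>x. K x - L x) p"
  unfolding above_on_def below_on_def by (simp add: scaleR_left_diff_distrib diff_mono)

lemma above_on_bot: "linear K \<Longrightarrow> above_on s K bot"
  by (simp add: above_on_def app_bot linear_0)

lemma below_on_bot: "linear K \<Longrightarrow> below_on s K bot"
  by (simp add: below_on_def app_bot linear_0)

lemma app_app_disjoint: "inf p q = bot \<Longrightarrow> app_proj p (app_proj q x) = 0"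
  by (metis app_inf app_bot)

lemma orth_sum:
  "\<exists>c. orth_bound c (\<lambda>x. \<Sum>i<(n::nat). r i *\<^sub>R app_proj (p i) x)"
proof (induction n)
  case 0
  have "orth_bound (0 * 1) (\<lambda>x. 0 *\<^sub>R x)"
    using orth_bound_scaleR[OF orth_bound_id, of 0] by simp
  then show ?case by auto
next
  case (Suc n)
  then obtain c where "orth_bound c (\<lambda>x. \<Sum>i<n. r i *\<^sub>R app_proj (p i) x)" by blast
  from orth_bound_add[OF this orth_bound_scaleR[OF orth_bound_app]]
  show ?case by auto
qed

context
  fixes h :: "'t::topological_space set \<Rightarrow> 'a::dedekind_complete_banach_lattice band_proj"
  assumes h: "borel_hom h"
begin

text \<open>Induction on the number of terms: the last set \<open>E\<close> splits \<open>A\<close>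
  into a part where the remaining sum is at most \<open>s - r n\<close> and a part where it is at
  most \<open>s\<close>. Coefficients may have any sign, so lower bounds follow by negation.\<close>

lemma below_on_simple:
  fixes r :: "nat \<Rightarrow> real"
  assumes "\<And>i. i < n \<Longrightarrow> D i \<in> sets borel" "A \<in> sets borel"
    and "\<And>t. t \<in> A \<Longrightarrow> (\<Sum>i<n. r i * indicator (D i) t) \<le> s"
  shows "below_on s (\<lambda>x. \<Sum>i<n. r i *\<^sub>R app_proj (h (D i)) x) (h A)"
  using assms
proof (induction n arbitrary: A s)
  case 0
  show ?case
  proof (cases "A = {}")
    case True
    then show ?thesis by (simp add: hom_empty[OF h] below_on_def app_bot)
  next
    case False
    then have "0 \<le> s" using 0(3) by auto
    then show ?thesis by (auto simp: below_on_def app_nonneg intro: scaleR_nonneg_nonneg)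
  qed
next
  case (Suc n)
  define K where "K x = (\<Sum>i<n. r i *\<^sub>R app_proj (h (D i)) x)" for x
  define E where "E = D n"
  have E: "E \<in> sets borel" using Suc.prems(1) by (simp add: E_def)
  have AE: "A \<inter> E \<in> sets borel" "A - E \<in> sets borel" using E Suc.prems(2) by auto
  have "below_on (s - r n) K (h (A \<inter> E))"
    unfolding K_def
    by (rule Suc.IH) (use Suc.prems AE in \<open>force simp: E_def\<close>)+
  moreover have "below_on (r n) (\<lambda>x. r n *\<^sub>R app_proj (h E) x) (h (A \<inter> E))"
    using hom_mono[OF h AE(1) E] by (simp add: below_on_def app_app_of_le)
  ultimately have 1: "below_on s (\<lambda>x. K x + r n *\<^sub>R app_proj (h E) x) (h (A \<inter> E))"
    using below_on_add by fastforce
  have "below_on s K (h (A - E))"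
    unfolding K_def
    by (rule Suc.IH) (use Suc.prems AE in \<open>force simp: E_def\<close>)+
  moreover have "below_on 0 (\<lambda>x. r n *\<^sub>R app_proj (h E) x) (h (A - E))"
    using hom_disjoint[OF h E AE(2)] by (simp add: below_on_def app_app_disjoint)
  ultimately have 2: "below_on s (\<lambda>x. K x + r n *\<^sub>R app_proj (h E) x) (h (A - E))"
    using below_on_add by fastforce
  obtain c where "orth_bound c (\<lambda>x. \<Sum>i<Suc n. r i *\<^sub>R app_proj (h (D i)) x)"
    using orth_sum[where n = "Suc n" and r = r and p = "\<lambda>i. h (D i)"] by blast
  then have "orth_bound c (\<lambda>x. K x + r n *\<^sub>R app_proj (h E) x)"
    by (simp add: K_def E_def)
  from below_on_sup[OF this 1 2] have "below_on s (\<lambda>x. K x + r n *\<^sub>R app_proj (h E) x) (h A)"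
    unfolding hom_sup[OF h AE, symmetric] by (simp add: Un_Diff_Int Int_Diff_Un)
  then show ?case by (simp add: K_def E_def)
qed

lemma above_on_simple:
  fixes r :: "nat \<Rightarrow> real"
  assumes "\<And>i. i < n \<Longrightarrow> D i \<in> sets borel" "A \<in> sets borel"
    and "\<And>t. t \<in> A \<Longrightarrow> s \<le> (\<Sum>i<n. r i * indicator (D i) t)"
  shows "above_on s (\<lambda>x. \<Sum>i<n. r i *\<^sub>R app_proj (h (D i)) x) (h A)"
  using assms below_on_simple[of n D A "\<lambda>i. - r i" "- s"]
  by (simp add: below_on_iff_above_on sum_negf)

end

text \<open>The values of \<open>\<mu>\<close> at sets that are not Borel subsets of \<open>X\<close> are arbitrary; \<open>h\<close> carries the measure.\<close>

locale concentrated_measure =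
  fixes h :: "'t::topological_space set \<Rightarrow> 'a::dedekind_complete_banach_lattice band_proj"
    and X :: "'t set" and \<mu> :: "'t set \<Rightarrow> 'a \<Rightarrow> 'a"
  assumes h: "borel_hom h" and X: "X \<in> sets borel" and hX: "h X = top"
    and \<mu>: "\<And>A. A \<in> sets (borel_on X) \<Longrightarrow> \<mu> A = app_proj (h A)"
begin

lemma hom_Int_X: "A \<in> sets borel \<Longrightarrow> h (A \<inter> X) = h A"
  using hom_inf[OF h _ X] hX by simp

lemma space_X: "space (borel_on X) = X"
  by (simp add: space_restrict_space)

lemma integral_bounds_onI:
  assumes "\<And>A s. A \<in> sets borel \<Longrightarrow> A \<subseteq> X \<Longrightarrow> (\<And>t. t \<in> A \<Longrightarrow> s \<le> f t) \<Longrightarrow> above_on s K (h A)"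
    and "\<And>A s. A \<in> sets borel \<Longrightarrow> A \<subseteq> X \<Longrightarrow> (\<And>t. t \<in> A \<Longrightarrow> f t \<le> s) \<Longrightarrow> below_on s K (h A)"
  shows "integral_bounds h f K"
  unfolding integral_bounds_def
proof (intro ballI allI conjI impI)
  fix A :: "'t set" and s assume A: "A \<in> sets borel"
  then have AX: "A \<inter> X \<in> sets borel" using X by auto
  show "above_on s K (h A)" if "\<forall>t\<in>A. s \<le> f t"
    using assms(1)[OF AX, of s] that hom_Int_X[OF A] by auto
  show "below_on s K (h A)" if "\<forall>t\<in>A. f t \<le> s"
    using assms(2)[OF AX, of s] that hom_Int_X[OF A] by auto
qed

text \<open>The integrand is prescribed on \<open>X\<close> alone; \<open>\<psi>\<close> is the same
  simple expression read on the whole space, where Borel measurability and the bounds can be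
  stated.\<close>

lemma simple_integral_bounds:
  assumes "has_simple_order_integral (borel_on X) \<mu> \<phi> L"
  obtains \<psi> where "\<psi> \<in> borel_measurable borel" "\<And>t. t \<in> X \<Longrightarrow> \<phi> t = \<psi> t"
    "integral_bounds h \<psi> L" "L \<in> center"
proof -
  obtain n r D where D: "\<And>i. i < (n::nat) \<Longrightarrow> D i \<in> sets (borel_on X)"
    and \<phi>: "\<And>t. t \<in> X \<Longrightarrow> \<phi> t = (\<Sum>i<n. r i * indicator (D i) t)"
    and L: "L = (\<lambda>x. \<Sum>i<n. r i *\<^sub>R \<mu> (D i) x)"
    using assms unfolding has_simple_order_integral_def space_X by blast
  have DB: "D i \<in> sets borel" if "i < n" for i using D[OF that] by (simp add: sets_borel_on[OF X])
  have L': "L = (\<lambda>x. \<Sum>i<n. r i *\<^sub>R app_proj (h (D i)) x)"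
    unfolding L by (rule ext, rule sum.cong) (simp_all add: \<mu>[OF D])
  show thesis
  proof
    show "(\<lambda>t. \<Sum>i<n. r i * indicator (D i) t) \<in> borel_measurable borel"
      by (intro borel_measurable_sum borel_measurable_times borel_measurable_const borel_measurable_indicator)
        (simp add: DB)
    show "\<phi> t = (\<Sum>i<n. r i * indicator (D i) t)" if "t \<in> X" for t by (rule \<phi>[OF that])
    show "integral_bounds h (\<lambda>t. \<Sum>i<n. r i * indicator (D i) t) L"
      unfolding integral_bounds_def L'
      by (intro ballI allI conjI impI above_on_simple[OF h] below_on_simple[OF h]) (auto simp: DB)
    show "L \<in> center" unfolding L'
      using orth_sum[where n = n and r = r and p = "\<lambda>i. h (D i)"] centerI by blast
  qed
qed

text \<open>Upper bounds use that \<open>P\<close> is the least upper bound. Lower bounds use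
  exhaustion: for \<open>r < s\<close> the parts of \<open>A\<close> where the \<open>k\<close>-th
  simple function is at least \<open>r\<close> cover \<open>A\<close>, and there
  \<open>P \<ge> L k \<ge> r\<close>.\<close>

lemma nonneg_integral_bounds:
  assumes int: "has_nonneg_order_integral center (borel_on X) \<mu> f P"
  shows "integral_bounds h f P" "P \<in> center"
proof -
  obtain \<phi> L where simple: "\<And>k::nat. has_simple_order_integral (borel_on X) \<mu> (\<phi> k) (L k)"
    and incr: "\<And>t. t \<in> X \<Longrightarrow> incseq (\<lambda>k. \<phi> k t)"
    and lim: "\<And>t. t \<in> X \<Longrightarrow> (\<lambda>k. \<phi> k t) \<longlonglongrightarrow> f t"
    and sup: "is_sup_in center (range L) P"
    using int unfolding has_nonneg_order_integral_def space_X by blast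
  show P: "P \<in> center" using sup by (simp add: is_sup_in_def)
  have LP: "L k x \<le> P x" if "0 \<le> x" for k x using sup that by (auto simp: is_sup_in_def op_le_def)
  obtain c where c: "orth_bound c P" using P by (rule centerE)
  have linP: "linear P" using P by (rule center_linear)
  show "integral_bounds h f P"
  proof (rule integral_bounds_onI)
    fix A :: "'t set" and s assume A: "A \<in> sets borel" "A \<subseteq> X" and le: "\<And>t. t \<in> A \<Longrightarrow> f t \<le> s"
    define p where "p = h A"
    \<comment> \<open>\<open>V\<close> is \<open>P\<close> off the band of \<open>A\<close> and
      multiplication by \<open>s\<close> on it. It dominates every \<open>L k\<close>, hence
      \<open>P\<close>, and restriction to the band gives the bound.\<close>
    define V where "V x = P (app_proj (- p) x) + s *\<^sub>R app_proj p x" for x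
    have "orth_bound (\<bar>c\<bar> * 1 + \<bar>s\<bar> * 1) V"
      unfolding V_def
      by (intro orth_bound_add orth_bound_comp orth_bound_scaleR
          orth_bound_app orth_bound_mono[OF c]) auto
    then have V: "V \<in> center" by (rule centerI)
    have "op_le (L k) V" for k
      unfolding op_le_def
    proof (intro allI impI)
      fix x :: 'a assume x: "0 \<le> x"
      obtain \<psi> where \<psi>: "\<And>t. t \<in> X \<Longrightarrow> \<phi> k t = \<psi> t" "integral_bounds h \<psi> (L k)" "L k \<in> center"
        using simple_integral_bounds[OF simple[of k]] by metis
      have "\<psi> t \<le> s" if t: "t \<in> A" for t
      proof -
        have tX: "t \<in> X" using t A by auto
        have "\<phi> k t \<le> f t" by (rule incseq_le[OF incr[OF tX] lim[OF tX]])
        then show ?thesis using \<psi>(1)[OF tX] le[OF t] by simp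
      qed
      then have "below_on s (L k) p" unfolding p_def by (rule integral_boundsD(2)[OF \<psi>(2) A(1)])
      then have "L k (app_proj p x) \<le> s *\<^sub>R app_proj p x" using x by (simp add: below_on_def)
      moreover have "L k (app_proj (- p) x) \<le> P (app_proj (- p) x)" using x by (intro LP app_nonneg)
      moreover have "L k x = L k (app_proj (- p) x) + L k (app_proj p x)"
        using linear_add[OF center_linear[OF \<psi>(3)], of "app_proj (- p) x" "app_proj p x"] by (simp add: app_compl)
      ultimately show "L k x \<le> V x" unfolding V_def by (simp add: add_mono)
    qed
    then have PV: "op_le P V" using sup V by (auto simp: is_sup_in_def)
    show "below_on s P (h A)"
      unfolding below_on_def p_def[symmetric]
    proof (intro allI impI)
      fix x :: 'a assume x: "0 \<le> x"
      have "P (app_proj p x) \<le> V (app_proj p x)" using PV x by (simp add: op_le_def app_nonneg)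
      also have "\<dots> = s *\<^sub>R app_proj p x"
        by (simp add: V_def app_compl app_idem linear_0[OF linP])
      finally show "P (app_proj p x) \<le> s *\<^sub>R app_proj p x" .
    qed
  next
    fix A :: "'t set" and s assume A: "A \<in> sets borel" "A \<subseteq> X" and ge: "\<And>t. t \<in> A \<Longrightarrow> s \<le> f t"
    show "above_on s P (h A)"
    proof (rule above_on_archimedean)
      fix r assume r: "r < s"
      have "\<exists>\<psi>. \<psi> \<in> borel_measurable borel \<and> (\<forall>t\<in>X. \<phi> k t = \<psi> t) \<and> integral_bounds h \<psi> (L k)" for k
        by (rule simple_integral_bounds[OF simple[of k]]) blast
      then obtain \<psi> where \<psi>: "\<And>k. \<psi> k \<in> borel_measurable borel"
        "\<And>k t. t \<in> X \<Longrightarrow> \<phi> k t = \<psi> k t" "\<And>k. integral_bounds h (\<psi> k) (L k)"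
        by metis
      define B where "B k = A \<inter> {t. r \<le> \<psi> k t}" for k
      have "{t. r \<le> \<psi> k t} \<in> sets borel" for k using \<psi>(1)[of k] by measurable
      then have B: "B k \<in> sets borel" for k using A by (auto simp: B_def)
      have "(\<Union>k. B k) = A"
      proof (intro antisym subsetI)
        fix t assume t: "t \<in> A"
        then have tX: "t \<in> X" using A by auto
        have "\<forall>\<^sub>F k in sequentially. r < \<phi> k t"
          using ge[OF t] r by (intro order_tendstoD(1)[OF lim[OF tX]]) simp
        then obtain k where "r < \<phi> k t" by (auto dest: eventually_happens)
        then show "t \<in> (\<Union>k. B k)" using t \<psi>(2)[OF tX] by (auto simp: B_def intro!: exI[of _ k])
      qed (auto simp: B_def)
      then have "h A = (SUP k. h (B k))" using hom_SUP[OF h, of B] B by simp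
      moreover have "above_on r P (h (B k))" for k
      proof -
        have "above_on r (L k) (h (B k))"
          by (rule integral_boundsD(1)[OF \<psi>(3) B]) (simp add: B_def)
        then show ?thesis using LP unfolding above_on_def by (meson app_nonneg order_trans)
      qed
      ultimately show "above_on r P (h A)" using above_on_Sup[OF c, of "range (\<lambda>k. h (B k))" r] by auto
    qed
  qed
qed

lemma real_integral_bounds:
  assumes int: "has_real_order_integral center (borel_on X) \<mu> f J" and f: "f \<in> borel_measurable borel"
  shows "integral_bounds h f J" "J \<in> center"
proof -
  obtain P N where P: "has_nonneg_order_integral center (borel_on X) \<mu> (\<lambda>t. max (f t) 0) P"
    and N: "has_nonneg_order_integral center (borel_on X) \<mu> (\<lambda>t. max (- f t) 0) N"
    and J: "J = (\<lambda>x. P x - N x)"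
    using int unfolding has_real_order_integral_def by blast
  have PN: "P \<in> center" "N \<in> center"
    using nonneg_integral_bounds(2)[OF P] nonneg_integral_bounds(2)[OF N] .
  obtain c where c: "orth_bound c P" using PN(1) by (rule centerE)
  obtain d where d: "orth_bound d N" using PN(2) by (rule centerE)
  \<comment> \<open>Stated for arbitrary \<open>P\<close>, \<open>N\<close> and \<open>f\<close>,
    because the upper bound is the lower bound for \<open>- f\<close> with \<open>P\<close> and
    \<open>N\<close> exchanged.\<close>
  have above: "above_on s (\<lambda>x. P x - N x) (h A)"
    if P: "integral_bounds h (\<lambda>t. max (f t) 0) P" and N: "integral_bounds h (\<lambda>t. max (- f t) 0) N"
      and c: "orth_bound c P" and d: "orth_bound d N"
      and f: "f \<in> borel_measurable borel" and A: "A \<in> sets borel" and ge: "\<And>t. t \<in> A \<Longrightarrow> s \<le> f t"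
    for P N f c d A s
  proof -
    have F: "{t. 0 \<le> f t} \<in> sets borel" using f by measurable
    define A1 where "A1 = A \<inter> {t. 0 \<le> f t}"
    define A2 where "A2 = A - {t. 0 \<le> f t}"
    have m: "A1 \<in> sets borel" "A2 \<in> sets borel" using A F by (auto simp: A1_def A2_def)
    have "above_on s P (h A1)" by (rule integral_boundsD(1)[OF P m(1)]) (use ge in \<open>auto simp: A1_def\<close>)
    moreover have "below_on 0 N (h A1)" by (rule integral_boundsD(2)[OF N m(1)]) (auto simp: A1_def)
    ultimately have 1: "above_on s (\<lambda>x. P x - N x) (h A1)" using above_on_diff by fastforce
    have "above_on 0 P (h A2)" by (rule integral_boundsD(1)[OF P m(2)]) auto
    moreover have "below_on (- s) N (h A2)"
      by (rule integral_boundsD(2)[OF N m(2)]) (use ge in \<open>force simp: A2_def\<close>)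
    ultimately have 2: "above_on s (\<lambda>x. P x - N x) (h A2)" using above_on_diff by fastforce
    have "above_on s (\<lambda>x. P x - N x) (h (A1 \<union> A2))"
      unfolding hom_sup[OF h m] by (rule above_on_sup[OF orth_bound_diff[OF c d] 1 2])
    moreover have "A1 \<union> A2 = A" by (auto simp: A1_def A2_def)
    ultimately show ?thesis by simp
  qed
  note bounds = nonneg_integral_bounds(1)[OF P] nonneg_integral_bounds(1)[OF N]
  show "integral_bounds h f J"
    unfolding integral_bounds_def J below_on_iff_above_on
    using above[OF bounds c d f] above[of "\<lambda>t. - f t" N P d c] bounds c d f
    by simp
  show "J \<in> center" unfolding J by (rule centerI[OF orth_bound_diff[OF c d]])
qed

text \<open>Dyadic approximation from below: on the band of each level set \<open>D k i\<close> the
  bounds give \<open>0 \<le> J - L k \<le> 2^-k\<close>. These bands join to \<open>top\<close>, so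
  the estimate is global and \<open>J\<close> is the supremum of the \<open>L k\<close>.\<close>

lemma nonneg_integral_of_bounds:
  assumes J: "orth_bound c J" and bounds: "integral_bounds h f J"
    and f: "f \<in> borel_measurable borel" and nonneg: "\<And>t. t \<in> X \<Longrightarrow> 0 \<le> f t"
    and bounded: "\<And>t. t \<in> X \<Longrightarrow> f t \<le> real N"
  shows "has_nonneg_order_integral center (borel_on X) \<mu> f J"
proof -
  define D where "D k i = {t\<in>X. real i / 2 ^ k \<le> f t \<and> f t < (real i + 1) / 2 ^ k}" for k i :: nat
  have D: "D k i \<in> sets borel" for k i
  proof -
    have "D k i = X \<inter> {t. real i / 2 ^ k \<le> f t \<and> f t < (real i + 1) / 2 ^ k}" by (auto simp: D_def)
    moreover have "{t. real i / 2 ^ k \<le> f t \<and> f t < (real i + 1) / 2 ^ k} \<in> sets borel"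
      using f by measurable
    ultimately show ?thesis using X by auto
  qed
  \<comment> \<open>The dyadic intervals are half open, so the extra index \<open>N * 2 ^ k\<close>
    is there for the points with \<open>f t = real N\<close>.\<close>
  define n where "n k = N * 2 ^ k + 1" for k :: nat
  define \<psi> where "\<psi> k t = (\<Sum>i<n k. (real i / 2 ^ k) * indicator (D k i) t)" for k t
  define L where "L k x = (\<Sum>i<n k. (real i / 2 ^ k) *\<^sub>R app_proj (h (D k i)) x)" for k x
  define ix where "ix k t = nat \<lfloor>2 ^ k * f t\<rfloor>" for k t
  have D_iff: "t \<in> D k i \<longleftrightarrow> i = ix k t" if t: "t \<in> X" for k i t
  proof -
    have "0 \<le> 2 ^ k * f t" using nonneg[OF t] by simp
    moreover have "t \<in> D k i \<longleftrightarrow> real i \<le> 2 ^ k * f t \<and> 2 ^ k * f t < real i + 1"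
      using t by (simp add: D_def field_simps)
    ultimately show ?thesis unfolding ix_def by (auto intro!: nat_eq_iff2[THEN iffD2] simp: floor_eq_iff)
  qed
  have ix_less: "ix k t < n k" if t: "t \<in> X" for k t
  proof -
    have "2 ^ k * f t \<le> real (N * 2 ^ k)" using bounded[OF t] by (simp add: mult.commute)
    then have "\<lfloor>2 ^ k * f t\<rfloor> \<le> int (N * 2 ^ k)" by linarith
    then have "ix k t \<le> N * 2 ^ k" unfolding ix_def by (simp only: nat_le_iff)
    then show ?thesis by (simp add: n_def)
  qed
  have \<psi>: "\<psi> k t = real (ix k t) / 2 ^ k" if t: "t \<in> X" for k t
  proof -
    have "\<psi> k t = (\<Sum>i<n k. if i = ix k t then real i / 2 ^ k else 0)"
      unfolding \<psi>_def by (rule sum.cong) (auto simp: D_iff[OF t] indicator_def)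
    then show ?thesis using ix_less[OF t] by simp
  qed
  have in_D: "t \<in> D k (ix k t)" if "t \<in> X" for k t using D_iff[OF that] by simp
  have approx: "\<psi> k t \<le> f t" "f t < \<psi> k t + 1 / 2 ^ k" if t: "t \<in> X" for k t
    using in_D[OF t, of k] unfolding \<psi>[OF t] by (auto simp: D_def add_divide_distrib)
  have cover: "(\<Union>i. D k i) = X" for k using in_D by (auto simp: D_def)
  have top: "(SUP i. h (D k i)) = top" for k
    using hom_SUP[OF h, of "D k"] D cover hX by simp
  have simple: "has_simple_order_integral (borel_on X) \<mu> (\<psi> k) (L k)" for k
  proof -
    have sets: "D k i \<in> sets (borel_on X)" for i using D by (simp add: sets_borel_on[OF X] D_def)
    show ?thesis
      unfolding has_simple_order_integral_def
      by (rule exI[of _ "n k"], rule exI[of _ "\<lambda>i. real i / 2 ^ k"], rule exI[of _ "D k"])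
        (simp add: sets \<psi>_def L_def \<mu>[OF sets] fun_eq_iff)
  qed
  have ortho_L: "\<exists>d. orth_bound d (L k)" for k
    unfolding L_def by (rule orth_sum)
  have diff: "0 \<le> J x - L k x \<and> J x - L k x \<le> (1 / 2 ^ k) *\<^sub>R x" if x: "0 \<le> x" for k x
  proof -
    obtain d where d: "orth_bound d (L k)" using ortho_L by blast
    have JL: "orth_bound (c + d) (\<lambda>x. J x - L k x)" by (rule orth_bound_diff[OF J d])
    have \<psi>D: "(\<Sum>j<n k. (real j / 2 ^ k) * indicator (D k j) t) = real i / 2 ^ k" if "t \<in> D k i" for t i
    proof -
      have "t \<in> X" using that by (simp add: D_def)
      then show ?thesis using \<psi>[of t k] D_iff[of t k i] that by (simp add: \<psi>_def)
    qed
    have "above_on 0 (\<lambda>x. J x - L k x) (h (D k i))" "below_on (1 / 2 ^ k) (\<lambda>x. J x - L k x) (h (D k i))" for i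
    proof -
      have "above_on (real i / 2 ^ k) J (h (D k i))"
        by (rule integral_boundsD(1)[OF bounds D]) (simp add: D_def)
      moreover have "below_on (real i / 2 ^ k) (L k) (h (D k i))"
        unfolding L_def by (rule below_on_simple[OF h D D]) (simp only: \<psi>D order_refl)
      ultimately show "above_on 0 (\<lambda>x. J x - L k x) (h (D k i))" using above_on_diff by fastforce
      have "below_on ((real i + 1) / 2 ^ k) J (h (D k i))"
        by (rule integral_boundsD(2)[OF bounds D]) (simp add: D_def)
      moreover have "above_on (real i / 2 ^ k) (L k) (h (D k i))"
        unfolding L_def by (rule above_on_simple[OF h D D]) (simp only: \<psi>D order_refl)
      ultimately have "below_on ((real i + 1) / 2 ^ k - real i / 2 ^ k) (\<lambda>x. J x - L k x) (h (D k i))"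
        by (rule below_on_diff)
      then show "below_on (1 / 2 ^ k) (\<lambda>x. J x - L k x) (h (D k i))"
        by (simp add: add_divide_distrib)
    qed
    then have "above_on 0 (\<lambda>x. J x - L k x) (SUP i. h (D k i))" "below_on (1 / 2 ^ k) (\<lambda>x. J x - L k x) (SUP i. h (D k i))"
      by (auto intro!: above_on_Sup[OF JL] below_on_Sup[OF JL])
    then show ?thesis using x by (simp add: top above_on_def below_on_def app_top)
  qed
  have "is_sup_in center (range L) J"
    unfolding is_sup_in_def
  proof (intro conjI ballI impI)
    show "J \<in> center" by (rule centerI[OF J])
    show "op_le T J" if "T \<in> range L" for T using that diff by (auto simp: op_le_def)
    fix V assume V: "V \<in> center" "\<forall>T\<in>range L. op_le T V"
    show "op_le J V"
      unfolding op_le_def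
    proof (intro allI impI)
      fix x :: 'a assume x: "0 \<le> x"
      show "J x \<le> V x"
      proof (rule archimedean_le_pow2[OF x])
        fix k
        have "J x \<le> L k x + (1 / 2 ^ k) *\<^sub>R x" using diff[OF x, of k] by (simp add: algebra_simps)
        also have "\<dots> \<le> V x + (1 / 2 ^ k) *\<^sub>R x" using V(2) x by (auto simp: op_le_def)
        finally show "J x \<le> V x + (1 / 2 ^ k) *\<^sub>R x" .
      qed
    qed
  qed
  moreover have "incseq (\<lambda>k. \<psi> k t)" if t: "t \<in> X" for t
  proof (rule incseq_SucI)
    fix k
    have "2 * \<lfloor>2 ^ k * f t\<rfloor> \<le> \<lfloor>2 ^ Suc k * f t\<rfloor>"
      by (simp add: le_floor_iff mult.assoc)
    then have "2 * ix k t \<le> ix (Suc k) t"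
      using nonneg[OF t] by (simp add: ix_def nat_le_iff nat_mult_distrib)
    then have "real (2 * ix k t) \<le> real (ix (Suc k) t)" by (simp only: of_nat_le_iff)
    then show "\<psi> k t \<le> \<psi> (Suc k) t" by (simp add: \<psi>[OF t] field_simps)
  qed
  moreover have "(\<lambda>k. \<psi> k t) \<longlonglongrightarrow> f t" if t: "t \<in> X" for t
  proof (rule tendsto_sandwich[of "\<lambda>k. f t - (1 / 2) ^ k" _ _ "\<lambda>k. f t"])
    show "\<forall>\<^sub>F k in sequentially. f t - (1 / 2) ^ k \<le> \<psi> k t"
      using approx(2)[OF t] by (intro always_eventually allI) (simp add: power_one_over less_imp_le algebra_simps)
    show "\<forall>\<^sub>F k in sequentially. \<psi> k t \<le> f t" using approx(1)[OF t] by simp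
    have "(\<lambda>k. f t - (1 / 2) ^ k) \<longlonglongrightarrow> f t - 0"
      by (intro tendsto_intros LIMSEQ_power_zero) simp
    then show "(\<lambda>k. f t - (1 / 2) ^ k) \<longlonglongrightarrow> f t" by simp
  qed simp
  ultimately show ?thesis
    unfolding has_nonneg_order_integral_def space_X using simple by blast
qed

text \<open>The integrals of the positive and negative parts of \<open>f\<close> are
  \<open>J\<close> cut down to the band of \<open>{f \<ge> 0}\<close> and \<open>- J\<close> cut
  down to the complementary band; \<open>part\<close> treats both.\<close>

lemma real_integral_of_bounds:
  assumes J: "orth_bound c J" and bounds: "integral_bounds h f J"
    and f: "f \<in> borel_measurable borel" and bounded: "\<And>t. t \<in> X \<Longrightarrow> \<bar>f t\<bar> \<le> real N"
  shows "has_real_order_integral center (borel_on X) \<mu> f J"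
proof -
  have part: "has_nonneg_order_integral center (borel_on X) \<mu> (\<lambda>t. max (g t) 0) (\<lambda>x. K (app_proj (h F) x))"
    if K: "orth_bound c K" and bounds: "integral_bounds h g K"
      and g: "g \<in> borel_measurable borel" and bounded: "\<And>t. t \<in> X \<Longrightarrow> \<bar>g t\<bar> \<le> real N"
      and F: "F \<in> sets borel" "\<And>t. t \<in> F \<Longrightarrow> 0 \<le> g t" "\<And>t. t \<notin> F \<Longrightarrow> g t \<le> 0"
    for K g F
  proof -
    obtain d where d: "0 < d" "orth_bound d K" by (rule orth_bound_pos[OF K])
    have KF: "orth_bound (d * 1) (\<lambda>x. K (app_proj (h F) x))"
      using d by (intro orth_bound_comp orth_bound_app) auto
    have lin: "linear K" using K by (rule orth_boundD)
    show ?thesis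
    proof (rule nonneg_integral_of_bounds[OF KF, of _ N])
      show "integral_bounds h (\<lambda>t. max (g t) 0) (\<lambda>x. K (app_proj (h F) x))"
        unfolding integral_bounds_def
      proof (intro ballI allI)
        fix A :: "'t set" and s assume A: "A \<in> sets borel"
        have m: "A \<inter> F \<in> sets borel" "A - F \<in> sets borel" using A F by auto
        have on1: "K (app_proj (h F) (app_proj (h (A \<inter> F)) x)) = K (app_proj (h (A \<inter> F)) x)" for x
          using hom_mono[OF h m(1) F(1)] by (simp add: app_app_of_le)
        have on2: "K (app_proj (h F) (app_proj (h (A - F)) x)) = 0" for x
          using hom_disjoint[OF h F(1) m(2)] by (simp add: app_app_disjoint linear_0[OF lin])
        have un: "h A = sup (h (A \<inter> F)) (h (A - F))"
          using hom_sup[OF h m] by (simp add: Un_Diff_Int Int_Diff_Un)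
        have empty: "h (A - F) = bot" if "A - F = {}" by (simp only: that hom_empty[OF h])
        show "((\<forall>t\<in>A. s \<le> max (g t) 0) \<longrightarrow> above_on s (\<lambda>x. K (app_proj (h F) x)) (h A)) \<and>
          ((\<forall>t\<in>A. max (g t) 0 \<le> s) \<longrightarrow> below_on s (\<lambda>x. K (app_proj (h F) x)) (h A))"
        proof (intro conjI impI)
          assume ge: "\<forall>t\<in>A. s \<le> max (g t) 0"
          have "above_on s K (h (A \<inter> F))"
            by (rule integral_boundsD(1)[OF bounds m(1)]) (use ge F(2) in fastforce)
          moreover have "above_on s (\<lambda>x. K (app_proj (h F) x)) (h (A - F))"
          proof (cases "A - F = {}")
            case False
            then have "s \<le> 0" using ge F(3) by (fastforce simp: max_def split: if_splits)
            then show ?thesis by (auto simp: above_on_def on2 app_nonneg intro: scaleR_nonpos_nonneg)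
          qed (simp add: empty above_on_bot[OF orth_boundD(1)[OF KF]])
          ultimately show "above_on s (\<lambda>x. K (app_proj (h F) x)) (h A)"
            unfolding un by (intro above_on_sup[OF KF]) (simp_all add: above_on_def on1)
        next
          assume le: "\<forall>t\<in>A. max (g t) 0 \<le> s"
          have "below_on s K (h (A \<inter> F))"
            by (rule integral_boundsD(2)[OF bounds m(1)]) (use le in fastforce)
          moreover have "below_on s (\<lambda>x. K (app_proj (h F) x)) (h (A - F))"
          proof (cases "A - F = {}")
            case False
            then have "0 \<le> s" using le by fastforce
            then show ?thesis by (auto simp: below_on_def on2 app_nonneg intro: scaleR_nonneg_nonneg)
          qed (simp add: empty below_on_bot[OF orth_boundD(1)[OF KF]])
          ultimately show "below_on s (\<lambda>x. K (app_proj (h F) x)) (h A)"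
            unfolding un by (intro below_on_sup[OF KF]) (simp_all add: below_on_def on1)
        qed
      qed
      show "(\<lambda>t. max (g t) 0) \<in> borel_measurable borel" using g by measurable
      show "max (g t) 0 \<le> real N" if "t \<in> X" for t using bounded[OF that] by auto
    qed simp
  qed
  define F where "F = {t. 0 \<le> f t}"
  have F: "F \<in> sets borel" unfolding F_def using f by measurable
  have P: "has_nonneg_order_integral center (borel_on X) \<mu> (\<lambda>t. max (f t) 0) (\<lambda>x. J (app_proj (h F) x))"
    by (rule part[OF J bounds f bounded F]) (auto simp: F_def)
  have N: "has_nonneg_order_integral center (borel_on X) \<mu> (\<lambda>t. max (- f t) 0) (\<lambda>x. - J (app_proj (h (- F)) x))"
  proof (rule part[OF orth_bound_uminus[OF J]])
    show "integral_bounds h (\<lambda>t. - f t) (\<lambda>x. - J x)"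
      unfolding integral_bounds_def
    proof (intro ballI allI conjI impI)
      fix A :: "'t set" and s assume A: "A \<in> sets borel"
      show "above_on s (\<lambda>x. - J x) (h A)" if "\<forall>t\<in>A. s \<le> - f t"
        using integral_boundsD(2)[OF bounds A, of "- s"] that by (force simp: below_on_iff_above_on)
      show "below_on s (\<lambda>x. - J x) (h A)" if "\<forall>t\<in>A. - f t \<le> s"
        using integral_boundsD(1)[OF bounds A, of "- s"] that by (force simp: below_on_iff_above_on)
    qed
  qed (use F f bounded borel_comp[OF F] in \<open>auto simp: F_def\<close>)
  show ?thesis
    unfolding has_real_order_integral_def
  proof (intro exI conjI)
    show "J = (\<lambda>x. J (app_proj (h F) x) - - J (app_proj (h (- F)) x))"
      using linear_add[OF orth_boundD(1)[OF J]]
      by (simp add: fun_eq_iff hom_compl[OF h F] app_compl linear_diff[OF orth_boundD(1)[OF J]])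
  qed (rule P N)+
qed

end


section \<open>Operators on the complexification\<close>

lemma scaleR_le_modulus:
  fixes x :: "'a::dedekind_complete_banach_lattice"
  assumes "\<bar>r\<bar> \<le> 1"
  shows "r *\<^sub>R x \<le> sup x (- x)"
proof -
  have "r *\<^sub>R x \<le> \<bar>r\<bar> *\<^sub>R sup x (- x)"
  proof (cases "0 \<le> r")
    case True
    then show ?thesis by (simp add: scaleR_left_mono)
  next
    case False
    then have "(- r) *\<^sub>R (- x) \<le> (- r) *\<^sub>R sup x (- x)" by (intro scaleR_left_mono) auto
    then show ?thesis using False by simp
  qed
  also have "\<dots> \<le> 1 *\<^sub>R sup x (- x)" by (rule scaleR_right_mono[OF assms modulus_nonneg])
  finally show ?thesis by simp
qed

text \<open>The angles \<open>0\<close> and \<open>pi\<close> give the first bound,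
  \<open>\<plusminus> pi / 2\<close> the second. This comparison up to a factor 2 stands in for the
  exact modulus in all norm estimates.\<close>

lemma complex_modulus_bounds:
  fixes x y :: "'a::dedekind_complete_banach_lattice"
  shows "sup x (- x) \<le> complex_modulus (x, y)" "sup y (- y) \<le> complex_modulus (x, y)"
    "complex_modulus (x, y) \<le> sup x (- x) + sup y (- y)"
proof -
  have le: "cos \<theta> *\<^sub>R x + sin \<theta> *\<^sub>R y \<le> sup x (- x) + sup y (- y)" for \<theta>
    by (intro add_mono scaleR_le_modulus) auto
  have bdd: "bdd_above (range (\<lambda>\<theta>::real. cos \<theta> *\<^sub>R x + sin \<theta> *\<^sub>R y))"
    using le by (intro bdd_aboveI[of _ "sup x (- x) + sup y (- y)"]) blast
  have up: "cos \<theta> *\<^sub>R x + sin \<theta> *\<^sub>R y \<le> complex_modulus (x, y)" for \<theta>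
    unfolding complex_modulus_def fst_conv snd_conv by (rule cSUP_upper[OF UNIV_I bdd])
  show "sup x (- x) \<le> complex_modulus (x, y)" using up[of 0] up[of pi] by simp
  show "sup y (- y) \<le> complex_modulus (x, y)" using up[of "pi / 2"] up[of "- (pi / 2)"] by simp
  show "complex_modulus (x, y) \<le> sup x (- x) + sup y (- y)"
    unfolding complex_modulus_def fst_conv snd_conv by (rule cSUP_least) (use le in auto)
qed

lemma complex_modulus_nonneg: "0 \<le> complex_modulus (x, y)"
  by (rule order_trans[OF modulus_nonneg complex_modulus_bounds(1)])

lemma complex_scale_pair:
  "complex_scale c (x, y) = (Re c *\<^sub>R x - Im c *\<^sub>R y, Re c *\<^sub>R y + Im c *\<^sub>R x)"
  by (simp add: complex_scale_def)

lemma complex_op_pair: "complex_op A D (x, y) = (A x - D y, A y + D x)"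
  by (simp add: complex_op_def)

lemma orth_bounded_complex_op:
  assumes A: "orth_bound a A" and D: "orth_bound d D"
  shows "bounded_complex_op (complex_op A D)"
proof -
  note lin = linear_add[OF orth_boundD(1)[OF A]] linear_add[OF orth_boundD(1)[OF D]]
    linear_diff[OF orth_boundD(1)[OF A]] linear_diff[OF orth_boundD(1)[OF D]]
    linear_cmul[OF orth_boundD(1)[OF A]] linear_cmul[OF orth_boundD(1)[OF D]]
  obtain a' where a': "0 < a'" "orth_bound a' A" by (rule orth_bound_pos[OF A])
  obtain d' where d': "0 < d'" "orth_bound d' D" by (rule orth_bound_pos[OF D])
  \<comment> \<open>The factor 2 comes from \<open>|x| + |y| \<le> 2 |x + iy|\<close>.\<close>
  have "complex_norm (complex_op A D z) \<le> (2 * (a' + d')) * complex_norm z" for z :: "'a \<times> 'a"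
  proof -
    obtain x y where z: "z = (x, y)" by (cases z)
    define m where "m v = sup v (- v)" for v :: 'a
    have tri: "m (v + w) \<le> m v + m w" for v w unfolding m_def by (rule modulus_add_le)
    have mneg: "m (- v) = m v" for v by (simp add: m_def sup.commute)
    have Am: "m (A v) \<le> a' *\<^sub>R m v" "m (D v) \<le> d' *\<^sub>R m v" for v
      unfolding m_def by (rule orth_modulus_le a' d')+
    have "complex_modulus (complex_op A D z) \<le> m (A x - D y) + m (A y + D x)"
      unfolding z complex_op_pair m_def by (rule complex_modulus_bounds)
    also have "\<dots> \<le> (m (A x) + m (D y)) + (m (A y) + m (D x))"
      using tri[of "A x" "- D y"] tri[of "A y" "D x"] by (intro add_mono) (simp_all add: mneg)
    also have "\<dots> \<le> (a' *\<^sub>R m x + d' *\<^sub>R m y) + (a' *\<^sub>R m y + d' *\<^sub>R m x)"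
      by (intro add_mono Am)
    also have "\<dots> = (a' + d') *\<^sub>R (m x + m y)" by (simp add: scaleR_add_left scaleR_add_right)
    also have "\<dots> \<le> (a' + d') *\<^sub>R (complex_modulus z + complex_modulus z)"
      unfolding z m_def using a' d' by (intro scaleR_left_mono add_mono complex_modulus_bounds) auto
    also have "\<dots> = (2 * (a' + d')) *\<^sub>R complex_modulus z"
      by (simp only: scaleR_2[symmetric] scaleR_scaleR mult.commute)
    finally have "norm (complex_modulus (complex_op A D z)) \<le> norm ((2 * (a' + d')) *\<^sub>R complex_modulus z)"
      by (intro norm_mono_nonneg) (simp_all add: z complex_op_pair complex_modulus_nonneg)
    then show ?thesis using a' d' by (simp add: complex_norm_def)
  qed
  moreover have "complex_op A D (z + w) = complex_op A D z + complex_op A D w" for z w :: "'a \<times> 'a"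
    by (cases z, cases w) (simp add: complex_op_pair lin)
  moreover have "complex_op A D (complex_scale c z) = complex_scale c (complex_op A D z)" for c z
    by (cases z) (simp add: complex_op_pair complex_scale_pair lin scaleR_right_diff_distrib scaleR_add_right)
  ultimately show ?thesis unfolding bounded_complex_op_def by blast
qed


section \<open>Inverting orthomorphisms\<close>

text \<open>The images of \<open>pprt x\<close> and \<open>pprt (- x)\<close> lie below multiples of
  these vectors and so remain disjoint; they are therefore the positive and negative parts of
  \<open>H x\<close>.\<close>

lemma pprt_orth:
  fixes H :: "'a::dedekind_complete_banach_lattice \<Rightarrow> 'a"
  assumes H: "orth_bound c H" and pos: "above_on 0 H top"
  shows "pprt (H x) = H (pprt x)"
proof -
  note l = orth_boundD[OF H]
  obtain d where d: "0 < d" "orth_bound d H" by (rule orth_bound_pos[OF H])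
  have nonneg: "0 \<le> H v" if "0 \<le> v" for v using pos that by (simp add: above_on_def app_top)
  have "inf (H (pprt x)) (H (pprt (- x))) \<le> inf (d *\<^sub>R pprt x) (d *\<^sub>R pprt (- x))"
    by (intro inf_mono orth_boundD(3)[OF d(2)]) simp_all
  also have "\<dots> = 0" using scaleR_inf[OF d(1), of "pprt x" "pprt (- x)"] by (simp add: inf_pprt_uminus)
  finally have "inf (H (pprt x)) (H (pprt (- x))) = 0"
    by (rule antisym) (intro le_infI nonneg zero_le_pprt)
  then have "pprt (H (pprt x) - H (pprt (- x))) = H (pprt x)" by (rule pprt_of_disjoint)
  then show ?thesis by (simp only: linear_diff[OF l(1), symmetric] pprt_diff)
qed

lemma orth_norm_le:
  assumes "orth_bound c K" "0 \<le> c"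
  shows "norm (K x) \<le> c * norm x"
proof -
  have "norm (K x) \<le> norm (c *\<^sub>R sup x (- x))"
    by (rule norm_le_of_modulus_le[OF orth_modulus_le[OF assms(1)]])
  then show ?thesis using assms(2) by (simp add: norm_modulus)
qed

text \<open>\<open>I - H / M\<close> is bounded by \<open>k = 1 - \<delta> / M\<close>, so
  \<open>x - (H x - y) / M\<close> is a contraction in \<open>x\<close> whose fixed point solves
  \<open>H x = y\<close>. Injectivity of \<open>H\<close> and positivity of the inverse come from
  \<open>reflect\<close>, which rests on \<open>pprt_orth\<close>.\<close>

lemma orth_inverse:
  fixes H :: "'a::dedekind_complete_banach_lattice \<Rightarrow> 'a"
  assumes H0: "orth_bound c H" and pos: "above_on \<delta> H top" and \<delta>: "0 < \<delta>"
  obtains G where "orth_bound (1 / \<delta>) G" "\<And>x. H (G x) = x" "\<And>x. G (H x) = x"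
proof -
  \<comment> \<open>The maximum with \<open>\<delta>\<close> keeps the contraction constant
    nonnegative.\<close>
  define M where "M = max c \<delta>"
  have M: "0 < M" "\<delta> \<le> M" using \<delta> by (auto simp: M_def)
  have H: "orth_bound M H" by (rule orth_bound_mono[OF H0]) (simp add: M_def)
  note l = orth_boundD[OF H]
  have below: "\<delta> *\<^sub>R x \<le> H x" if "0 \<le> x" for x using pos that by (simp add: above_on_def app_top)
  have pprtH: "pprt (H x) = H (pprt x)" for x
    using pprt_orth[OF H above_on_mono[OF pos]] \<delta> by simp
  have reflect: "0 \<le> x" if "0 \<le> H x" for x
  proof -
    have "H (pprt (- x)) = pprt (H (- x))" by (simp add: pprtH)
    also have "\<dots> = 0" using that by (simp add: linear_neg[OF l(1)])
    finally have "\<delta> *\<^sub>R pprt (- x) \<le> 0" using below[of "pprt (- x)"] by simp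
    then have "(1 / \<delta>) *\<^sub>R (\<delta> *\<^sub>R pprt (- x)) \<le> (1 / \<delta>) *\<^sub>R 0"
      using \<delta> by (intro scaleR_left_mono) auto
    then have "pprt (- x) \<le> 0" using \<delta> by simp
    then have "- x \<le> 0" using le_pprt order_trans by blast
    then show ?thesis by simp
  qed
  have inj: "x = y" if "H x = H y" for x y
  proof (rule antisym)
    have "0 \<le> y - x" by (rule reflect) (simp add: linear_diff[OF l(1)] that)
    moreover have "0 \<le> x - y" by (rule reflect) (simp add: linear_diff[OF l(1)] that)
    ultimately show "x \<le> y" "y \<le> x" by simp_all
  qed
  define k where "k = 1 - \<delta> / M"
  have k: "0 \<le> k" "k < 1" using M \<delta> by (auto simp: k_def)
  have N: "orth_bound k (\<lambda>v. v - (1 / M) *\<^sub>R H v)"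
  proof (rule orth_boundI)
    show "linear (\<lambda>v. v - (1 / M) *\<^sub>R H v)"
      by (intro linear_compose_sub linear_ident linear_compose_scale_right l)
    fix x :: 'a assume x: "0 \<le> x"
    have "(1 / M) *\<^sub>R (\<delta> *\<^sub>R x) \<le> (1 / M) *\<^sub>R H x"
      using M x by (intro scaleR_left_mono below) auto
    then show "x - (1 / M) *\<^sub>R H x \<le> k *\<^sub>R x" by (simp add: k_def scaleR_left_diff_distrib)
    have "(1 / M) *\<^sub>R H x \<le> (1 / M) *\<^sub>R (M *\<^sub>R x)"
      using M x by (intro scaleR_left_mono l) auto
    then have "- (x - (1 / M) *\<^sub>R H x) \<le> 0" using M by simp
    also have "0 \<le> k *\<^sub>R x" using k x by (intro scaleR_nonneg_nonneg) auto
    finally show "- (x - (1 / M) *\<^sub>R H x) \<le> k *\<^sub>R x" .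
  qed
  have "\<exists>x. H x = y" for y
  proof -
    define F where "F x = x - (1 / M) *\<^sub>R (H x - y)" for x
    have "dist (F x) (F x') \<le> k * dist x x'" for x x'
    proof -
      have "F x - F x' = (x - x') - (1 / M) *\<^sub>R H (x - x')"
        by (simp add: F_def linear_diff[OF l(1)] algebra_simps)
      then show ?thesis using orth_norm_le[OF N k(1), of "x - x'"] by (simp add: dist_norm)
    qed
    then obtain x where "F x = x" using banach_fix_type[OF k, of F] by blast
    then have "H x = y" using M by (simp add: F_def)
    then show ?thesis by blast
  qed
  then obtain G where HG: "\<And>y. H (G y) = y" by metis
  have GH: "G (H x) = x" for x by (rule inj) (rule HG)
  have G_nonneg: "0 \<le> G y" "G y \<le> (1 / \<delta>) *\<^sub>R y" if y: "0 \<le> y" for y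
  proof -
    show 1: "0 \<le> G y" by (rule reflect) (simp add: HG y)
    have "(1 / \<delta>) *\<^sub>R (\<delta> *\<^sub>R G y) \<le> (1 / \<delta>) *\<^sub>R y"
      using \<delta> below[OF 1] by (intro scaleR_left_mono) (auto simp: HG)
    then show "G y \<le> (1 / \<delta>) *\<^sub>R y" using \<delta> by simp
  qed
  have "orth_bound (1 / \<delta>) G"
  proof (rule orth_boundI)
    show "linear G"
      by (rule linearI; rule inj) (simp_all add: HG linear_add[OF l(1)] linear_cmul[OF l(1)])
    fix x :: 'a assume x: "0 \<le> x"
    show "G x \<le> (1 / \<delta>) *\<^sub>R x" by (rule G_nonneg(2)[OF x])
    have "- G x \<le> 0" using G_nonneg(1)[OF x] by simp
    also have "0 \<le> (1 / \<delta>) *\<^sub>R x" using x \<delta> by (intro scaleR_nonneg_nonneg) auto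
    finally show "- G x \<le> (1 / \<delta>) *\<^sub>R x" .
  qed
  then show thesis using that HG GH by blast
qed

text \<open>\<open>K - e I\<close> is positive on the band of \<open>p\<close>, and \<open>p\<close>
  commutes with \<open>K\<close>; so \<open>K y - e y\<close> stays in the band and
  \<open>K \<ge> e\<close> can be applied to it a second time.\<close>

lemma above_on_square:
  assumes K: "orth_bound c K" and above: "above_on e K p" and e: "0 \<le> e"
  shows "above_on (e ^ 2) (\<lambda>x. K (K x)) p"
  unfolding above_on_def
proof (intro allI impI)
  fix x :: 'a assume x: "0 \<le> x"
  define y where "y = app_proj p x"
  have y: "e *\<^sub>R y \<le> K y" "app_proj p y = y" using above x by (simp_all add: above_on_def y_def app_idem)
  then have "0 \<le> K y - e *\<^sub>R y" by simp
  then have "e *\<^sub>R app_proj p (K y - e *\<^sub>R y) \<le> K (app_proj p (K y - e *\<^sub>R y))"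
    using above by (simp only: above_on_def)
  then have "e *\<^sub>R (K y - e *\<^sub>R y) \<le> K (K y) - e *\<^sub>R K y"
    by (simp add: app_diff app_scaleR app_commute_orth[OF K] y(2)
        linear_diff[OF orth_boundD(1)[OF K]] linear_cmul[OF orth_boundD(1)[OF K]])
  moreover have "0 \<le> e *\<^sub>R (K y - e *\<^sub>R y)" using y(1) e by (intro scaleR_nonneg_nonneg) auto
  ultimately have "0 \<le> K (K y) - e *\<^sub>R K y" by (rule order_trans[rotated])
  then have "e *\<^sub>R K y \<le> K (K y)" by simp
  moreover have "e *\<^sub>R (e *\<^sub>R y) \<le> e *\<^sub>R K y" using y(1) e by (rule scaleR_left_mono)
  ultimately have "e ^ 2 *\<^sub>R y \<le> K (K y)" by (simp add: power2_eq_square)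
  then show "e ^ 2 *\<^sub>R app_proj p x \<le> K (K (app_proj p x))" by (simp add: y_def)
qed

lemma above_on_square_of_below_on:
  assumes K: "orth_bound c K" and below: "below_on (- e) K p" and e: "0 \<le> e"
  shows "above_on (e ^ 2) (\<lambda>x. K (K x)) p"
  using above_on_square[OF orth_bound_uminus[OF K], of e p] below e
  by (simp add: below_on_iff_above_on linear_neg[OF orth_boundD(1)[OF K]])

lemma orth_bound_square:
  assumes "orth_bound c K"
  obtains d where "orth_bound d (\<lambda>x. K (K x))"
  using orth_bound_pos[OF assms] orth_bound_comp less_imp_le by metis

lemma above_on_square_nonneg:
  assumes K: "orth_bound c K"
  shows "above_on 0 (\<lambda>x. K (K x)) p"
proof -
  obtain d where d: "orth_bound d (\<lambda>x. K (K x))" by (rule orth_bound_square[OF K])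
  have "above_on 0 K (pos_proj K)" "below_on 0 K (- pos_proj K)"
    using pos_proj_nonneg[OF K] pos_proj_nonpos[OF K] by (simp_all add: above_on_def below_on_def app_compl)
  then have "above_on 0 (\<lambda>x. K (K x)) (pos_proj K)" "above_on 0 (\<lambda>x. K (K x)) (- pos_proj K)"
    using above_on_square[OF K, of 0] above_on_square_of_below_on[OF K, of 0] by auto
  then have "above_on 0 (\<lambda>x. K (K x)) (sup (pos_proj K) (- pos_proj K))"
    by (rule above_on_sup[OF d])
  then show ?thesis by (rule above_on_mono) auto
qed


section \<open>The spectrum is the support of the spectral homomorphism\<close>

text \<open>Squares are used because \<open>integral_bounds\<close> controls the two coordinates
  separately.\<close>

definition square_at :: "complex \<Rightarrow> real \<Rightarrow> complex set"
  where "square_at c e = {t. \<bar>Re t - Re c\<bar> < e \<and> \<bar>Im t - Im c\<bar> < e}"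

lemma open_square_at: "open (square_at c e)"
  unfolding square_at_def
  by (intro open_Collect_conj open_Collect_less continuous_intros)

lemma square_at_borel: "square_at c e \<in> sets borel"
  by (rule borel_open[OF open_square_at])

locale spectral_pair =
  fixes R S :: "'a::dedekind_complete_banach_lattice \<Rightarrow> 'a" and h :: "complex set \<Rightarrow> 'a band_proj" and b :: real
  assumes R: "orth_bound b R" and S: "orth_bound b S" and spectral: "spectral_hom R S h"
begin

lemma hom: "borel_hom h" and bounds_Re: "integral_bounds h Re R" and bounds_Im: "integral_bounds h Im S"
  using spectral by (auto simp: spectral_hom_def)

lemma shift_bounds:
  assumes "integral_bounds h f K" "A \<in> sets borel"
  shows "(\<And>t. t \<in> A \<Longrightarrow> s \<le> f t - q) \<Longrightarrow> above_on s (\<lambda>x. K x - q *\<^sub>R x) (h A)"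
    "(\<And>t. t \<in> A \<Longrightarrow> f t - q \<le> s) \<Longrightarrow> below_on s (\<lambda>x. K x - q *\<^sub>R x) (h A)"
  using integral_boundsD(1)[OF assms, of "s + q"] integral_boundsD(2)[OF assms, of "s + q"]
  by (force simp: above_on_def below_on_def scaleR_add_left algebra_simps)+

lemma complex_op_shift:
  "complex_op R S z - complex_scale c z = complex_op (\<lambda>x. R x - Re c *\<^sub>R x) (\<lambda>x. S x - Im c *\<^sub>R x) z"
  by (cases z) (simp add: complex_op_pair complex_scale_pair)

lemma in_spectrum:
  assumes nz: "\<And>e. 0 < e \<Longrightarrow> h (square_at c e) \<noteq> bot"
  shows "c \<in> spectrum (complex_op R S)"
proof (rule ccontr)
  assume "c \<notin> spectrum (complex_op R S)"
  then obtain B where B: "bounded_complex_op B"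
    and inv: "\<And>z. B (complex_op R S z - complex_scale c z) = z"
    by (auto simp: spectrum_def)
  obtain K where K: "\<And>z. complex_norm (B z) \<le> K * complex_norm z" using B by (auto simp: bounded_complex_op_def)
  \<comment> \<open>For \<open>x\<close> in the band of the square, the image of
    \<open>(x, 0)\<close> under the shifted operator has modulus at most \<open>2 e x\<close>. An
    inverse with bound \<open>K\<close> would give \<open>norm x \<le> 2 |K| e norm x\<close>, and
    this \<open>e\<close> makes the right-hand side at most half of \<open>norm x\<close>.\<close>
  define e where "e = 1 / (4 * (\<bar>K\<bar> + 1))"
  have e: "0 < e" by (simp add: e_def add_nonneg_pos)
  define p where "p = h (square_at c e)"
  obtain x0 where x0: "0 \<le> x0" "app_proj p x0 \<noteq> 0"
    using nz[OF e] band_proj_eqI[of p bot] by (auto simp: p_def app_bot)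
  define x where "x = app_proj p x0"
  have x: "0 \<le> x" "x \<noteq> 0" using x0 by (simp_all add: x_def app_nonneg)
  have small: "sup (L x - q *\<^sub>R x) (- (L x - q *\<^sub>R x)) \<le> e *\<^sub>R x"
    if "integral_bounds h f L" "\<And>t. t \<in> square_at c e \<Longrightarrow> \<bar>f t - q\<bar> < e" for f L q
  proof -
    have "above_on (- e) (\<lambda>x. L x - q *\<^sub>R x) p"
      unfolding p_def using that(2) by (intro shift_bounds(1)[OF that(1) square_at_borel]) force
    then have 1: "- (e *\<^sub>R x) \<le> L x - q *\<^sub>R x" using x0 by (simp add: above_on_def x_def)
    have "below_on e (\<lambda>x. L x - q *\<^sub>R x) p"
      unfolding p_def using that(2) by (intro shift_bounds(2)[OF that(1) square_at_borel]) force
    then have 2: "L x - q *\<^sub>R x \<le> e *\<^sub>R x" using x0 by (simp add: below_on_def x_def)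
    show ?thesis using 2 le_imp_neg_le[OF 1] by (intro sup_least) simp_all
  qed
  define u where "u = R x - Re c *\<^sub>R x"
  define v where "v = S x - Im c *\<^sub>R x"
  have u: "sup u (- u) \<le> e *\<^sub>R x" unfolding u_def by (rule small[OF bounds_Re]) (simp add: square_at_def)
  have v: "sup v (- v) \<le> e *\<^sub>R x" unfolding v_def by (rule small[OF bounds_Im]) (simp add: square_at_def)
  have img: "complex_op R S (x, 0) - complex_scale c (x, 0) = (u, v)"
    unfolding complex_op_shift
    by (simp add: complex_op_pair u_def v_def linear_0[OF orth_boundD(1)[OF R]] linear_0[OF orth_boundD(1)[OF S]])
  have "complex_modulus (u, v) \<le> e *\<^sub>R x + e *\<^sub>R x"
    using complex_modulus_bounds(3)[of u v] add_mono[OF u v] by (rule order_trans)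
  then have "norm (complex_modulus (u, v)) \<le> norm (e *\<^sub>R x + e *\<^sub>R x)"
    by (intro norm_mono_nonneg complex_modulus_nonneg)
  also have "\<dots> = 2 * e * norm x"
    using e by (simp add: scaleR_add_left[symmetric])
  finally have uv: "complex_norm (u, v) \<le> 2 * e * norm x" by (simp add: complex_norm_def)
  have "norm x \<le> complex_norm (x, 0)"
    unfolding complex_norm_def using complex_modulus_bounds(1)[of x 0]
    by (rule norm_le_of_modulus_le)
  also have "\<dots> \<le> K * complex_norm (u, v)" using K[of "(u, v)"] inv[of "(x, 0)"] by (simp add: img)
  also have "\<dots> \<le> \<bar>K\<bar> * complex_norm (u, v)"
    by (rule mult_right_mono) (simp_all add: complex_norm_def)
  also have "\<dots> \<le> \<bar>K\<bar> * (2 * e * norm x)" using uv by (rule mult_left_mono) simp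
  also have "\<dots> = (2 * \<bar>K\<bar> * e) * norm x" by simp
  also have "\<dots> \<le> (1 / 2) * norm x"
  proof (rule mult_right_mono)
    show "2 * \<bar>K\<bar> * e \<le> 1 / 2" by (simp add: e_def divide_simps)
  qed simp
  finally show False using x(2) by simp
qed

lemma not_in_spectrum:
  assumes e: "0 < e" and null: "h (square_at c e) = bot"
  shows "c \<notin> spectrum (complex_op R S)"
proof -
  define K where "K x = R x - Re c *\<^sub>R x" for x
  define L where "L x = S x - Im c *\<^sub>R x" for x
  have K: "orth_bound (b + \<bar>Re c\<bar>) K" unfolding K_def by (rule orth_bound_shift[OF R])
  have L: "orth_bound (b + \<bar>Im c\<bar>) L" unfolding L_def by (rule orth_bound_shift[OF S])
  obtain k where KK: "orth_bound k (\<lambda>x. K (K x))" by (rule orth_bound_square[OF K])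
  obtain l where LL: "orth_bound l (\<lambda>x. L (L x))" by (rule orth_bound_square[OF L])
  define H where "H x = K (K x) + L (L x)" for x
  have H: "orth_bound (k + l) H" unfolding H_def by (rule orth_bound_add[OF KK LL])
  \<comment> \<open>The complement of the square is the union of four closed half planes. On the
    band of each one, \<open>K\<close> or \<open>L\<close> is at least \<open>e\<close> or at most
    \<open>- e\<close>, so \<open>H \<ge> e^2\<close> holds there and hence everywhere.\<close>
  define A where "A f q = {t::complex. q + e \<le> f t}" for f :: "complex \<Rightarrow> real" and q
  define B where "B f q = {t::complex. f t \<le> q - e}" for f :: "complex \<Rightarrow> real" and q
  have m: "A Re q \<in> sets borel" "A Im q \<in> sets borel" "B Re q \<in> sets borel" "B Im q \<in> sets borel" for q
    unfolding A_def B_def by measurable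
  have sq: "above_on (e ^ 2) (\<lambda>x. K (K x)) (h (A Re (Re c)))" "above_on (e ^ 2) (\<lambda>x. K (K x)) (h (B Re (Re c)))"
    "above_on (e ^ 2) (\<lambda>x. L (L x)) (h (A Im (Im c)))" "above_on (e ^ 2) (\<lambda>x. L (L x)) (h (B Im (Im c)))"
    using e unfolding K_def L_def
    by (intro above_on_square[OF K[unfolded K_def]] above_on_square_of_below_on[OF K[unfolded K_def]]
          above_on_square[OF L[unfolded L_def]] above_on_square_of_below_on[OF L[unfolded L_def]]
          shift_bounds[OF bounds_Re m(1)] shift_bounds[OF bounds_Re m(3)]
          shift_bounds[OF bounds_Im m(2)] shift_bounds[OF bounds_Im m(4)]; simp add: A_def B_def)+
  have "above_on (e ^ 2) H (h (A Re (Re c)))" "above_on (e ^ 2) H (h (B Re (Re c)))"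
    "above_on (e ^ 2) H (h (A Im (Im c)))" "above_on (e ^ 2) H (h (B Im (Im c)))"
    using above_on_add[OF sq(1) above_on_square_nonneg[OF L]] above_on_add[OF sq(2) above_on_square_nonneg[OF L]]
      above_on_add[OF above_on_square_nonneg[OF K] sq(3)] above_on_add[OF above_on_square_nonneg[OF K] sq(4)]
    by (simp_all add: H_def[abs_def])
  then have "above_on (e ^ 2) H (sup (sup (h (A Re (Re c))) (h (B Re (Re c)))) (sup (h (A Im (Im c))) (h (B Im (Im c)))))"
    by (intro above_on_sup[OF H])
  also have "sup (sup (h (A Re (Re c))) (h (B Re (Re c)))) (sup (h (A Im (Im c))) (h (B Im (Im c)))) =
      h ((A Re (Re c) \<union> B Re (Re c)) \<union> (A Im (Im c) \<union> B Im (Im c)))"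
    using m by (subst hom_sup[OF hom], simp, simp)+ simp
  also have "(A Re (Re c) \<union> B Re (Re c)) \<union> (A Im (Im c) \<union> B Im (Im c)) = - square_at c e"
    by (auto simp: A_def B_def square_at_def abs_less_iff)
  also have "h (- square_at c e) = top" by (simp add: hom_compl[OF hom square_at_borel] null)
  finally have above: "above_on (e ^ 2) H top" .
  obtain G where G: "orth_bound (1 / e ^ 2) G" and HG: "\<And>x. H (G x) = x" "\<And>x. G (H x) = x"
    by (rule orth_inverse[OF H above]) (use e in auto)
  note lin = linear_add[OF orth_boundD(1)[OF K]] linear_add[OF orth_boundD(1)[OF L]]
    linear_diff[OF orth_boundD(1)[OF K]] linear_diff[OF orth_boundD(1)[OF L]]
    linear_add[OF orth_boundD(1)[OF G]] linear_diff[OF orth_boundD(1)[OF G]]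
  note comm = orth_commute[OF K L] orth_commute[OF G K] orth_commute[OF G L]
  have H_eq: "K (K (G x)) + L (L (G x)) = x" for x using HG(1)[of x] by (simp add: H_def)
  \<comment> \<open>The usual reciprocal \<open>(K - iL) / (K^2 + L^2)\<close> of
    \<open>K + iL\<close>; that it inverts on both sides uses the commutation of \<open>G\<close>,
    \<open>K\<close> and \<open>L\<close>.\<close>
  define D where "D = complex_op (\<lambda>x. K (G x)) (\<lambda>x. - L (G x))"
  obtain k' where k': "0 < k'" "orth_bound k' K" by (rule orth_bound_pos[OF K])
  obtain l' where l': "0 < l'" "orth_bound l' L" by (rule orth_bound_pos[OF L])
  have "bounded_complex_op D"
    unfolding D_def
    by (rule orth_bounded_complex_op[OF orth_bound_comp[OF k'(2) G]
          orth_bound_uminus[OF orth_bound_comp[OF l'(2) G]]]) (use k' l' in auto)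
  moreover have "D (complex_op R S z - complex_scale c z) = z" for z
  proof (cases z)
    case (Pair x y)
    have "K (G (K x - L y)) + L (G (K y + L x)) = K (K (G x)) + L (L (G x))"
      by (simp add: lin comm)
    moreover have "K (G (K y + L x)) - L (G (K x - L y)) = K (K (G y)) + L (L (G y))"
      by (simp add: lin comm)
    ultimately show ?thesis
      unfolding complex_op_shift D_def Pair by (simp add: complex_op_pair K_def[symmetric] L_def[symmetric] H_eq)
  qed
  moreover have "complex_op R S (D z) - complex_scale c (D z) = z" for z
  proof (cases z)
    case (Pair x y)
    have "K (K (G x) + L (G y)) - L (K (G y) - L (G x)) = K (K (G x)) + L (L (G x))"
      by (simp add: lin comm)
    moreover have "K (K (G y) - L (G x)) + L (K (G x) + L (G y)) = K (K (G y)) + L (L (G y))"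
      by (simp add: lin comm)
    ultimately show ?thesis
      unfolding complex_op_shift D_def Pair by (simp add: complex_op_pair K_def[symmetric] L_def[symmetric] H_eq)
  qed
  ultimately show ?thesis unfolding spectrum_def by blast
qed

lemma spectrum_iff: "c \<in> spectrum (complex_op R S) \<longleftrightarrow> (\<forall>e>0. h (square_at c e) \<noteq> bot)"
  using in_spectrum not_in_spectrum by blast

lemma null_square_disjoint:
  assumes "h (square_at c e) = bot" "t \<in> square_at c e"
  shows "t \<notin> spectrum (complex_op R S)"
proof -
  define d where "d = min (e - \<bar>Re t - Re c\<bar>) (e - \<bar>Im t - Im c\<bar>)"
  have d: "0 < d" using assms(2) by (auto simp: d_def square_at_def)
  have "square_at t d \<subseteq> square_at c e" by (auto simp: square_at_def d_def)
  then have "h (square_at t d) \<le> bot"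
    using hom_mono[OF hom square_at_borel square_at_borel] assms(1) by metis
  then show ?thesis using d by (intro not_in_spectrum[of d]) (simp_all add: bot_unique)
qed

lemma in_square_at: "0 < e \<Longrightarrow> c \<in> square_at c e"
  by (simp add: square_at_def)

lemma spectrum_compl: "- spectrum (complex_op R S) = (\<Union>{square_at c e |c e. 0 < e \<and> h (square_at c e) = bot})"
proof (intro antisym subsetI)
  fix c assume "c \<in> - spectrum (complex_op R S)"
  then obtain e where "0 < e" "h (square_at c e) = bot" by (auto simp: spectrum_iff)
  then show "c \<in> (\<Union>{square_at c e |c e. 0 < e \<and> h (square_at c e) = bot})" using in_square_at by blast
qed (use null_square_disjoint in blast)

lemma closed_spectrum: "closed (spectrum (complex_op R S))"
  unfolding closed_def spectrum_compl by (rule open_Union) (auto simp: open_square_at)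

lemma spectrum_borel: "spectrum (complex_op R S) \<in> sets borel"
  by (rule borel_closed[OF closed_spectrum])

text \<open>The complement is a possibly uncountable union of null squares, whereas \<open>h\<close>
  respects countable unions; the Lindelof property selects countably many of them.\<close>

lemma hom_spectrum: "h (spectrum (complex_op R S)) = top"
proof -
  define F where "F = {square_at c e |c e. 0 < e \<and> h (square_at c e) = bot}"
  obtain F' where F': "F' \<subseteq> F" "countable F'" "\<Union>F' = \<Union>F"
    by (rule Lindelof[of F]) (auto simp: F_def open_square_at)
  \<comment> \<open>The empty set is inserted because \<open>F'\<close> may be empty.\<close>
  define s where "s = from_nat_into (insert {} F')"
  have s: "range s = insert {} F'" unfolding s_def using F'(2) by (intro range_from_nat_into) auto
  have "s n \<in> sets borel \<and> h (s n) = bot" for n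
  proof -
    have "s n \<in> insert {} F" using s F'(1) by blast
    then show ?thesis using hom_empty[OF hom] by (auto simp: F_def square_at_borel)
  qed
  then have "h (\<Union>n. s n) = bot" using hom_SUP[OF hom, of s] by simp
  moreover have "(\<Union>n. s n) = - spectrum (complex_op R S)"
    using s F'(3) spectrum_compl by (simp add: F_def)
  ultimately have "- h (spectrum (complex_op R S)) = bot"
    by (simp add: hom_compl[OF hom spectrum_borel, symmetric])
  then show ?thesis by (metis compl_bot_eq double_compl)
qed

lemma spectrum_coordinate_bounds:
  assumes c: "c \<in> spectrum (complex_op R S)"
  shows "\<bar>Re c\<bar> \<le> b" "\<bar>Im c\<bar> \<le> b"
proof -
  have main: "\<bar>f c\<bar> \<le> b"
    if K: "orth_bound b K" and bounds: "integral_bounds h f K" and f: "f \<in> borel_measurable borel"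
      and sq: "\<And>e t. t \<in> square_at c e \<Longrightarrow> \<bar>f t - f c\<bar> < e" for f K
  proof (rule ccontr)
    assume "\<not> \<bar>f c\<bar> \<le> b"
    then consider "b < f c" | "f c < - b" by linarith
    then show False
    proof cases
      case 1
      have "h {t. b < f t} = bot"
        using levels_of_integral_bounds[OF K hom f bounds] level_large[OF K, of b] by simp
      moreover have "{t. b < f t} \<in> sets borel" using f by measurable
      moreover have "square_at c (f c - b) \<subseteq> {t. b < f t}" using sq by fastforce
      ultimately have "h (square_at c (f c - b)) \<le> bot" using hom_mono[OF hom square_at_borel] by metis
      then show False using c 1 by (auto simp: spectrum_iff bot_unique)
    next
      case 2
      \<comment> \<open>\<open>level_small\<close> asks for a level strictly below
        \<open>- b\<close>, hence the midpoint; \<open>level_large\<close> in the other case holds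
        at \<open>b\<close> itself.\<close>
      define q where "q = (f c - b) / 2"
      have q: "f c < q" "q < - b" using 2 by (auto simp: q_def)
      have m: "{t. q < f t} \<in> sets borel" using f by measurable
      have "h (- {t. q < f t}) = bot"
        using levels_of_integral_bounds[OF K hom f bounds] level_small[OF K q(2)]
        by (simp only: hom_compl[OF hom m] compl_top_eq)
      moreover have "square_at c (q - f c) \<subseteq> - {t. q < f t}" using sq by fastforce
      ultimately have "h (square_at c (q - f c)) \<le> bot"
        using hom_mono[OF hom square_at_borel borel_comp[OF m]] by metis
      then show False using c q by (auto simp: spectrum_iff bot_unique)
    qed
  qed
  show "\<bar>Re c\<bar> \<le> b" by (rule main[OF R bounds_Re]) (auto simp: square_at_def)
  show "\<bar>Im c\<bar> \<le> b" by (rule main[OF S bounds_Im]) (auto simp: square_at_def)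
qed

lemma bounded_spectrum: "bounded (spectrum (complex_op R S))"
proof (rule boundedI)
  fix c assume "c \<in> spectrum (complex_op R S)"
  then show "norm c \<le> b + b"
    using spectrum_coordinate_bounds[of c] cmod_le[of c] by linarith
qed

lemma compact_spectrum: "compact (spectrum (complex_op R S))"
  using closed_spectrum bounded_spectrum by (simp add: compact_eq_bounded_closed)

lemma hom_open_nonzero:
  assumes V: "openin (top_of_set (spectrum (complex_op R S))) V" and ne: "V \<noteq> {}"
  shows "h V \<noteq> bot"
proof -
  obtain U where U: "open U" "V = spectrum (complex_op R S) \<inter> U" using V by (auto simp: openin_open)
  obtain c where c: "c \<in> V" using ne by blast
  obtain e where e: "0 < e" "ball c e \<subseteq> U" using U c by (meson IntD2 open_contains_ball)
  \<comment> \<open>Half the radius, because the modulus is at most the sum of the two coordinate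
    distances.\<close>
  have "square_at c (e / 2) \<subseteq> U"
  proof
    fix t assume "t \<in> square_at c (e / 2)"
    then have "norm (t - c) < e" using cmod_le[of "t - c"] by (auto simp: square_at_def)
    then show "t \<in> U" using e(2) by (auto simp: dist_norm norm_minus_commute)
  qed
  then have "h (square_at c (e / 2)) \<le> h U"
    by (intro hom_mono[OF hom square_at_borel borel_open[OF U(1)]])
  moreover have "h (square_at c (e / 2)) \<noteq> bot" using c U e(1) by (auto simp: spectrum_iff)
  ultimately have "h U \<noteq> bot" by (metis bot_unique)
  moreover have "h V = h U"
    using hom_inf[OF hom spectrum_borel borel_open[OF U(1)]] U(2) hom_spectrum by simp
  ultimately show ?thesis by simp
qed

end


section \<open>Order continuous charges\<close>

text \<open>
  The example is \<open>m p = f p\<close> for an order continuous functional \<open>f\<close>. It need not be positive; the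
  positive variation \<open>pos_var\<close> avoids proving that the modulus of \<open>f\<close> is order continuous as well.
\<close>

locale charge =
  fixes m :: "'b::{boolean_algebra, complete_lattice} \<Rightarrow> real"
  assumes additive: "inf p q = bot \<Longrightarrow> m (sup p q) = m p + m q"
    and bounded: "\<exists>B. \<forall>p. \<bar>m p\<bar> \<le> B"
    and continuous: "decseq P \<Longrightarrow> (\<lambda>n. m (P n)) \<longlonglongrightarrow> m (INF n. P n)"
begin

lemma bot: "m bot = 0"
  using additive[of bot bot] by simp

lemma split: "m p = m (inf p q) + m (inf p (- q))"
proof -
  have "sup (inf p q) (inf p (- q)) = p" by (simp add: inf_sup_distrib1[symmetric])
  moreover have "inf (inf p q) (inf p (- q)) = bot"
    by (metis inf_compl_bot inf_bot_right inf.left_commute inf.commute inf.left_idem)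
  ultimately show ?thesis using additive by metis
qed

definition pos_var :: "'b \<Rightarrow> real"
  where "pos_var p = (SUP q\<in>{..p}. m q)"

lemma bdd_above_m: "bdd_above (m ` A)"
proof -
  obtain B where "\<And>p. \<bar>m p\<bar> \<le> B" using bounded by blast
  then show ?thesis by (intro bdd_aboveI[of _ B]) (auto dest: abs_le_D1)
qed

lemma le_pos_var: "q \<le> p \<Longrightarrow> m q \<le> pos_var p"
  unfolding pos_var_def by (rule cSUP_upper[OF _ bdd_above_m]) simp

lemma pos_var_least: "(\<And>q. q \<le> p \<Longrightarrow> m q \<le> c) \<Longrightarrow> pos_var p \<le> c"
  unfolding pos_var_def by (rule cSUP_least) auto

lemma pos_var_nonneg: "0 \<le> pos_var p"
  using le_pos_var[of bot p] bot by simp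

lemma pos_var_additive:
  assumes "inf p q = bot"
  shows "pos_var (sup p q) = pos_var p + pos_var q"
proof (rule antisym)
  show "pos_var (sup p q) \<le> pos_var p + pos_var q"
  proof (rule pos_var_least)
    fix r assume r: "r \<le> sup p q"
    have "inf r (- p) \<le> inf (sup p q) (- p)" using r by (rule inf_mono) simp
    also have "\<dots> = inf q (- p)" by (simp add: inf_sup_distrib2)
    also have "\<dots> \<le> q" by simp
    finally have "inf r (- p) \<le> q" .
    then show "m r \<le> pos_var p + pos_var q"
      using split[of r p] le_pos_var[of "inf r p" p] le_pos_var[of "inf r (- p)" q] by simp
  qed
  have "pos_var p \<le> pos_var (sup p q) - pos_var q"
  proof (rule pos_var_least)
    fix r assume r: "r \<le> p"
    have "pos_var q \<le> pos_var (sup p q) - m r"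
    proof (rule pos_var_least)
      fix s assume s: "s \<le> q"
      have "inf r s \<le> inf p q" using r s by (rule inf_mono)
      then have "m (sup r s) = m r + m s" using assms by (intro additive) (simp add: bot_unique)
      moreover have "m (sup r s) \<le> pos_var (sup p q)" using r s by (intro le_pos_var sup_mono)
      ultimately show "m s \<le> pos_var (sup p q) - m r" by simp
    qed
    then show "m r \<le> pos_var (sup p q) - pos_var q" by simp
  qed
  then show "pos_var p + pos_var q \<le> pos_var (sup p q)" by simp
qed

text \<open>
  Otherwise one could cut the witnesses of non-smallness into disjoint pieces whose charges do not
  tend to zero.
\<close>

lemma pos_var_small:
  assumes dec: "decseq P" and inf: "(INF n. P n) = bot" and \<epsilon>: "0 < \<epsilon>"
  shows "\<exists>n. pos_var (P n) \<le> \<epsilon>"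
proof (rule ccontr)
  assume "\<nexists>n. pos_var (P n) \<le> \<epsilon>"
  then have big: "\<exists>q\<le>P n. \<epsilon> < m q" for n using pos_var_least[of "P n" \<epsilon>] by (meson not_le)
  have le: "P k \<le> P n" if "n \<le> k" for n k using dec that by (simp add: decseqD)
  \<comment> \<open>By continuity of \<open>m\<close> the part of \<open>q\<close> below
    \<open>P k\<close> has small charge for large \<open>k\<close>, so the part off
    \<open>P k\<close> keeps more than half of \<open>\<epsilon>\<close>.\<close>
  have "\<exists>k e. n < k \<and> e \<le> P n \<and> e \<le> - P k \<and> \<epsilon> / 2 < m e" for n
  proof -
    obtain q where q: "q \<le> P n" "\<epsilon> < m q" using big by blast
    have "decseq (\<lambda>k. inf q (P k))" using le by (intro decseq_SucI inf_mono) auto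
    moreover have "(INF k. inf q (P k)) \<le> (INF k. P k)" by (rule INF_mono) (metis UNIV_I inf_le2)
    then have "(INF k. inf q (P k)) = bot" using inf by (simp add: bot_unique)
    ultimately have "(\<lambda>k. m (inf q (P k))) \<longlonglongrightarrow> 0" using continuous[of "\<lambda>k. inf q (P k)"] bot by simp
    then have "\<forall>\<^sub>F k in sequentially. m (inf q (P k)) < \<epsilon> / 2"
      using \<epsilon> by (intro order_tendstoD) auto
    then have "\<forall>\<^sub>F k in sequentially. m (inf q (P k)) < \<epsilon> / 2 \<and> n < k"
      using eventually_gt_at_top[of n] by (rule eventually_conj)
    then obtain k where k: "m (inf q (P k)) < \<epsilon> / 2" "n < k"
      by (auto dest: eventually_happens)
    then have "\<epsilon> / 2 < m (inf q (- P k))" using split[of q "P k"] q(2) by linarith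
    then show ?thesis using k q(1) by (intro exI[of _ k] exI[of _ "inf q (- P k)"]) (auto intro: le_infI1)
  qed
  then obtain K e where Ke: "\<And>n. n < K n" "\<And>n. e n \<le> P n" "\<And>n. e n \<le> - P (K n)" "\<And>n. \<epsilon> / 2 < m (e n)"
    by metis
  \<comment> \<open>The piece chosen at \<open>n\<close> lies off \<open>P (K n)\<close> and the
    next one below it; iterating \<open>K\<close> therefore makes the pieces disjoint.\<close>
  define N where "N j = (K ^^ j) 0" for j
  have N: "N (Suc j) = K (N j)" for j by (simp add: N_def)
  have mono_N: "N i \<le> N j" if "i \<le> j" for i j
    using that
  proof (induction rule: dec_induct)
    case (step k)
    then show ?case using Ke(1)[of "N k"] by (simp add: N)
  qed simp
  have N_ge: "j \<le> N j" for j
  proof (induction j)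
    case (Suc j)
    then show ?case using Ke(1)[of "N j"] by (simp add: N)
  qed simp
  \<comment> \<open>The tails decrease to \<open>bot\<close>, so their charges tend to zero; yet
    consecutive tails differ by the charge of one piece, which exceeds
    \<open>\<epsilon> / 2\<close>.\<close>
  define T where "T J = (SUP j\<in>{J..}. e (N j))" for J :: nat
  have TP: "T J \<le> P (N J)" for J
    unfolding T_def by (rule SUP_least) (use Ke(2) le mono_N order_trans in \<open>metis atLeast_iff\<close>)
  have T_rec: "T J = sup (e (N J)) (T (Suc J))" for J
  proof -
    have "{J..} = insert J {Suc J..}" by auto
    then show ?thesis by (simp add: T_def)
  qed
  have disj: "inf (e (N J)) (T (Suc J)) = bot" for J
  proof -
    have "e (N J) \<le> - T (Suc J)"
      using Ke(3)[of "N J"] TP[of "Suc J"] by (metis N compl_le_compl_iff order_trans)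
    then show ?thesis by (simp add: inf_shunt)
  qed
  have "decseq T" using T_rec by (intro decseq_SucI) (metis sup_ge2)
  moreover have "(INF J. T J) \<le> (INF n. P n)"
    by (rule INF_mono) (use TP le N_ge order_trans in blast)
  then have "(INF J. T J) = bot" using inf by (simp add: bot_unique)
  ultimately have lim: "(\<lambda>J. m (T J)) \<longlonglongrightarrow> 0" using continuous[of T] bot by simp
  then have "(\<lambda>J. m (T J) - m (T (Suc J))) \<longlonglongrightarrow> 0 - 0" by (intro tendsto_diff LIMSEQ_Suc)
  moreover have "m (T J) - m (T (Suc J)) = m (e (N J))" for J
    using additive[OF disj, of J] T_rec[of J] by simp
  ultimately have "(\<lambda>J. m (e (N J))) \<longlonglongrightarrow> 0" by simp
  then have "\<forall>\<^sub>F J in sequentially. m (e (N J)) < \<epsilon> / 2"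
    using \<epsilon> by (intro order_tendstoD) auto
  then obtain J where "m (e (N J)) < \<epsilon> / 2" by (auto dest: eventually_happens)
  then show False using Ke(4)[of "N J"] by simp
qed

lemma pos_var_outer_regular:
  fixes h :: "complex set \<Rightarrow> 'b"
  assumes h: "borel_hom h" and A: "A \<in> sets borel" and \<epsilon>: "0 < \<epsilon>"
  shows "\<exists>U. open U \<and> A \<subseteq> U \<and> pos_var (h (U - A)) \<le> \<epsilon>"
proof -
  define f where "f B = ennreal (pos_var (h B))" for B
  define M where "M = measure_of UNIV (sets borel) f"
  have sets: "sets M = sets (borel :: complex measure)"
    unfolding M_def using sets.sigma_sets_eq[of "borel :: complex measure"] by simp
  have space: "space M = UNIV" by (simp add: M_def)
  have pv_bot: "pos_var bot = 0" using pos_var_additive[of bot bot] by simp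
  have pv_union: "pos_var (h (B \<union> C)) = pos_var (h B) + pos_var (h C)"
    if "B \<in> sets borel" "C \<in> sets borel" "B \<inter> C = {}" for B C
    using hom_sup[OF h that(1,2)] pos_var_additive[OF hom_disjoint[OF h that]] by simp
  have pos: "positive (sets borel) f"
    by (simp add: positive_def f_def hom_empty[OF h] pv_bot)
  have add: "additive (sets borel) f"
    unfolding additive_def f_def by (auto simp: pv_union pos_var_nonneg)
  interpret borel_ring: ring_of_sets UNIV "sets (borel :: complex measure)"
    using sets.ring_of_sets_axioms[of "borel :: complex measure"] by simp
  have ca: "countably_additive (sets borel) f"
  \<comment> \<open>For a finite additive set function, countable additivity reduces to continuity
    at the empty set, which is \<open>pos_var_small\<close>.\<close>
  proof (rule borel_ring.empty_continuous_imp_countably_additive[OF pos add])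
    show "\<forall>B\<in>sets borel. f B \<noteq> \<infinity>" by (simp add: f_def)
    fix B :: "nat \<Rightarrow> complex set"
    assume B: "range B \<subseteq> sets borel" "decseq B" "(\<Inter>i. B i) = {}"
    have BB: "B i \<in> sets borel" for i using B(1) by blast
    have dec: "decseq (\<lambda>i. h (B i))"
      using B(2) by (intro decseq_SucI hom_mono[OF h BB BB]) (simp add: decseq_Suc_iff)
    have "(INF i. h (B i)) = bot" using hom_INF[OF h, of B] BB B(3) hom_empty[OF h] by simp
    note small = pos_var_small[OF dec this]
    have "(\<lambda>i. pos_var (h (B i))) \<longlonglongrightarrow> 0"
    proof (rule LIMSEQ_I)
      fix r :: real assume "0 < r"
      then obtain n where n: "pos_var (h (B n)) \<le> r / 2" using small[of "r / 2"] by auto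
      have "norm (pos_var (h (B k)) - 0) < r" if "n \<le> k" for k
      proof -
        have "h (B k) \<le> h (B n)" using decseqD[OF dec that] .
        then have "pos_var (h (B k)) \<le> pos_var (h (B n))"
          by (intro pos_var_least le_pos_var) (rule order_trans)
        then show ?thesis using n \<open>0 < r\<close> pos_var_nonneg[of "h (B k)"] by simp
      qed
      then show "\<exists>n. \<forall>k\<ge>n. norm (pos_var (h (B k)) - 0) < r" by blast
    qed
    then show "(\<lambda>i. f (B i)) \<longlonglongrightarrow> 0"
      unfolding f_def using tendsto_ennrealI by fastforce
  qed
  have em: "emeasure M B = f B" if "B \<in> sets borel" for B
    by (rule emeasure_measure_of[OF M_def]) (use pos ca that sets in auto)
  have "emeasure M A = (INF U\<in>{U. A \<subseteq> U \<and> open U}. emeasure M U)"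
    by (rule outer_regular) (use sets A in \<open>auto simp: space em f_def\<close>)
  moreover have "emeasure M A < emeasure M A + ennreal \<epsilon>"
    using A \<epsilon> by (simp add: em f_def ennreal_less_iff pos_var_nonneg flip: ennreal_plus)
  ultimately have "(INF U\<in>{U. A \<subseteq> U \<and> open U}. emeasure M U) < emeasure M A + ennreal \<epsilon>" by simp
  then obtain U where U: "A \<subseteq> U" "open U" "emeasure M U < emeasure M A + ennreal \<epsilon>"
    by (auto simp: INF_less_iff)
  have "U \<in> sets borel" using U(2) by simp
  then have "pos_var (h U) < pos_var (h A) + \<epsilon>"
    using U(3) A \<epsilon> by (simp add: em f_def ennreal_less_iff pos_var_nonneg flip: ennreal_plus)
  moreover have "pos_var (h U) = pos_var (h A) + pos_var (h (U - A))"
    using pv_union[of A "U - A"] A \<open>U \<in> sets borel\<close> U(1) by (simp add: Un_absorb1)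
  ultimately show ?thesis using U by (intro exI[of _ U]) auto
qed

end

lemma charge_uminus:
  assumes "charge m"
  shows "charge (\<lambda>p. - m p)"
proof -
  interpret charge m by (rule assms)
  show ?thesis
    by unfold_locales (use additive bounded continuous in \<open>auto intro: tendsto_minus\<close>)
qed


section \<open>Normality of the centre and regularity\<close>

lemma is_modulus_in_center_of_nonneg:
  assumes "T \<in> center" "op_le (\<lambda>_. 0) T"
  shows "is_modulus_in center T T"
proof -
  have "- T x \<le> T x" if "0 \<le> x" for x
    using assms(2) that by (simp add: op_le_def minus_le_self_iff)
  then show ?thesis
    using assms(1) by (simp add: is_modulus_in_def is_sup_in_def op_le_def)
qed

lemma order_continuous_dualD:
  assumes "f \<in> order_continuous_dual center"
  shows "S \<in> center \<Longrightarrow> T \<in> center \<Longrightarrow> f (\<lambda>x. S x + T x) = f S + f T"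
    "T \<in> center \<Longrightarrow> f (\<lambda>x. r *\<^sub>R T x) = r * f T"
    "A \<in> center \<Longrightarrow> B \<in> center \<Longrightarrow> bounded (f ` {T\<in>center. op_le A T \<and> op_le T B})"
    "order_null center \<F> \<Longrightarrow> (f \<longlongrightarrow> 0) \<F>"
  using assms unfolding order_continuous_dual_def by blast+

text \<open>The filter is generated by the tails of the decreasing family
  \<open>app_proj q - app_proj (Inf D)\<close>, and the family serves as its own dominating set: its
  infimum is zero because, by \<open>app_Inf_greatest\<close>, infima of band projections are
  pointwise on positive vectors.\<close>

lemma order_continuous_dual_directed:
  fixes D :: "'a::dedekind_complete_banach_lattice band_proj set"
  assumes f: "f \<in> order_continuous_dual center" and ne: "D \<noteq> {}"
    and dir: "\<And>p q. p \<in> D \<Longrightarrow> q \<in> D \<Longrightarrow> \<exists>r\<in>D. r \<le> p \<and> r \<le> q" and \<epsilon>: "0 < \<epsilon>"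
  shows "\<exists>p\<in>D. \<forall>q\<in>D. q \<le> p \<longrightarrow> \<bar>f (app_proj q) - f (app_proj (Inf D))\<bar> < \<epsilon>"
proof -
  note f = order_continuous_dualD[OF f]
  define d where "d = Inf D"
  define T where "T q x = app_proj q x - app_proj d x" for q and x :: 'a
  define F where "F = (INF p\<in>D. principal (T ` {q\<in>D. q \<le> p}))"
  have ev: "eventually P F \<longleftrightarrow> (\<exists>p\<in>D. \<forall>q\<in>D. q \<le> p \<longrightarrow> P (T q))" for P
  proof -
    have "eventually P F \<longleftrightarrow> (\<exists>p\<in>D. eventually P (principal (T ` {q\<in>D. q \<le> p})))"
      unfolding F_def
    proof (rule eventually_INF_base[OF ne])
      fix p q assume "p \<in> D" "q \<in> D"
      then obtain r where r: "r \<in> D" "r \<le> p" "r \<le> q" using dir by blast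
      then have "T ` {s\<in>D. s \<le> r} \<subseteq> T ` {s\<in>D. s \<le> p} \<inter> T ` {s\<in>D. s \<le> q}"
        using order_trans by blast
      then show "\<exists>r\<in>D. principal (T ` {s\<in>D. s \<le> r}) \<le>
          inf (principal (T ` {s\<in>D. s \<le> p})) (principal (T ` {s\<in>D. s \<le> q}))"
        using r(1) by auto
    qed
    then show ?thesis by (auto simp: eventually_principal)
  qed
  have T: "T q \<in> center" for q
    unfolding T_def by (rule centerI[OF orth_bound_diff[OF orth_bound_app orth_bound_app]])
  have T_mono: "op_le (T q) (T p)" if "q \<le> p" for p q
    using that by (simp add: op_le_def T_def app_le_app)
  have T_pos: "op_le (\<lambda>_. 0) (T q)" if "q \<in> D" for q
    using that by (simp add: op_le_def T_def app_le_app d_def Inf_lower)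
  have zero: "(\<lambda>_::'a. 0::'a) \<in> center"
    using app_in_center[of bot] by (simp add: app_bot[abs_def])
  have "order_null center F"
    unfolding order_null_def
  proof (intro exI[of _ "T ` D"] conjI ballI)
    show "T ` D \<subseteq> center" using T by blast
    show "T ` D \<noteq> {}" using ne by simp
    show "\<exists>C\<in>T ` D. op_le C A \<and> op_le C B" if AB: "A \<in> T ` D" "B \<in> T ` D" for A B
    proof -
      obtain p q where pq: "p \<in> D" "A = T p" "q \<in> D" "B = T q" using AB by blast
      obtain r where "r \<in> D" "r \<le> p" "r \<le> q" using dir pq by blast
      then show ?thesis using T_mono pq by blast
    qed
    show "is_inf_in center (T ` D) (\<lambda>_. 0)"
      unfolding is_inf_in_def
    proof (intro conjI ballI impI)
      show "op_le (\<lambda>_. 0) A" if "A \<in> T ` D" for A using that T_pos by blast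
      fix V assume V: "V \<in> center" "\<forall>A\<in>T ` D. op_le V A"
      show "op_le V (\<lambda>_. 0)"
        unfolding op_le_def
      proof (intro allI impI)
        fix x :: 'a assume x: "0 \<le> x"
        have "V x + app_proj d x \<le> app_proj d x"
          unfolding d_def
        proof (rule app_Inf_greatest[OF ne x], fold d_def)
          fix p assume "p \<in> D"
          then have "V x \<le> T p x" using V(2) x by (auto simp: op_le_def)
          then show "V x + app_proj d x \<le> app_proj p x" by (simp add: T_def le_diff_eq)
        qed
        then show "V x \<le> 0" by simp
      qed
    qed (rule zero)
    show "\<forall>\<^sub>F S in F. S \<in> center \<and> (\<exists>U. is_modulus_in center S U \<and> op_le U A)" if "A \<in> T ` D" for A
      unfolding ev using that T T_mono is_modulus_in_center_of_nonneg[OF T T_pos] by blast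
  qed
  then have "(f \<longlongrightarrow> 0) F" by (rule f(4))
  then have "\<forall>\<^sub>F S in F. dist (f S) 0 < \<epsilon>" using \<epsilon> by (rule tendstoD)
  then obtain p where p: "p \<in> D" "\<And>q. q \<in> D \<Longrightarrow> q \<le> p \<Longrightarrow> \<bar>f (T q)\<bar> < \<epsilon>"
    unfolding ev by auto
  have "f (T q) = f (app_proj q) - f (app_proj d)" for q
  proof -
    have "orth_bound (\<bar>- 1\<bar> * 1) (\<lambda>x. (- 1) *\<^sub>R app_proj d x)"
      by (rule orth_bound_scaleR[OF orth_bound_app])
    from f(1)[OF app_in_center centerI[OF this], of q] f(2)[OF app_in_center, of "- 1" d]
    show ?thesis by (simp add: T_def[abs_def])
  qed
  then show ?thesis using p by (auto simp: d_def)
qed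

lemma order_continuous_dual_charge:
  fixes f :: "('a::dedekind_complete_banach_lattice \<Rightarrow> 'a) \<Rightarrow> real"
  assumes f: "f \<in> order_continuous_dual center"
  shows "charge (\<lambda>p. f (app_proj p))"
proof
  note fD = order_continuous_dualD[OF f]
  show "f (app_proj (sup p q)) = f (app_proj p) + f (app_proj q)" if "inf p q = bot" for p q
  proof -
    have "app_proj (sup p q) = (\<lambda>x. app_proj p x + app_proj q x)"
      by (rule ext) (rule app_sup_disjoint[OF that])
    then show ?thesis by (simp only: fD(1)[OF app_in_center app_in_center])
  qed
  have "bounded (f ` {T\<in>center. op_le (\<lambda>_. 0) T \<and> op_le T id})"
    using fD(3)[OF app_in_center[of bot] app_in_center[of top]]
    by (simp add: app_bot[abs_def] app_top[abs_def] id_def)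
  then obtain B where B: "\<And>T. T \<in> center \<Longrightarrow> op_le (\<lambda>_. 0) T \<Longrightarrow> op_le T id \<Longrightarrow> \<bar>f T\<bar> \<le> B"
    by (auto simp: bounded_iff)
  show "\<exists>B. \<forall>p. \<bar>f (app_proj p)\<bar> \<le> B"
    by (intro exI[of _ B] allI B app_in_center) (simp_all add: op_le_def app_nonneg app_le)
  fix P :: "nat \<Rightarrow> 'a band_proj" assume P: "decseq P"
  show "(\<lambda>n. f (app_proj (P n))) \<longlonglongrightarrow> f (app_proj (INF n. P n))"
  proof (rule LIMSEQ_I)
    fix r :: real assume r: "0 < r"
    have "\<exists>s\<in>range P. s \<le> p \<and> s \<le> q" if pq: "p \<in> range P" "q \<in> range P" for p q
    proof -
      obtain i j where "p = P i" "q = P j" using pq by blast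
      then show ?thesis using decseqD[OF P, of i "max i j"] decseqD[OF P, of j "max i j"] by auto
    qed
    from order_continuous_dual_directed[OF f _ this r]
    obtain n where n: "\<And>q. q \<in> range P \<Longrightarrow> q \<le> P n \<Longrightarrow> \<bar>f (app_proj q) - f (app_proj (INF n. P n))\<bar> < r"
      by auto
    show "\<exists>n. \<forall>k\<ge>n. norm (f (app_proj (P k)) - f (app_proj (INF n. P n))) < r"
      using n decseqD[OF P] by (intro exI[of _ n]) auto
  qed
qed

lemma hom_outer_regular:
  fixes h :: "complex set \<Rightarrow> 'a::dedekind_complete_banach_lattice band_proj"
  assumes normal: "normal_lattice (center :: ('a \<Rightarrow> 'a) set)" and h: "borel_hom h"
    and X: "X \<in> sets borel" "h X = top" and A: "A \<in> sets borel" "A \<subseteq> X"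
  shows "(INF V\<in>{V. openin (top_of_set X) V \<and> A \<subseteq> V}. h V) = h A"
proof (rule ccontr)
  define VV where "VV = {V. openin (top_of_set X) V \<and> A \<subseteq> V}"
  define d where "d = (INF V\<in>VV. h V)"
  have VB: "V \<in> sets borel" if "V \<in> VV" for V
    using that X by (auto simp: VV_def openin_open)
  have XV: "X \<in> VV" using A by (simp add: VV_def openin_subtopology_self)
  assume "(INF V\<in>{V. openin (top_of_set X) V \<and> A \<subseteq> V}. h V) \<noteq> h A"
  then have "app_proj d \<noteq> app_proj (h A)" by (simp add: d_def VV_def app_proj_inject)
  then obtain f where f: "f \<in> order_continuous_dual center" "f (app_proj d) \<noteq> f (app_proj (h A))"
    using normal app_in_center unfolding normal_lattice_def by blast
  define m where "m p = f (app_proj p)" for p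
  interpret pos: charge m unfolding m_def[abs_def] by (rule order_continuous_dual_charge[OF f(1)])
  interpret neg: charge "\<lambda>p. - m p" by (rule charge_uminus) (rule pos.charge_axioms)
  \<comment> \<open>One error bounds the distance from \<open>m (h V)\<close> to \<open>m d\<close>,
    another the absolute value of \<open>m (h (V - A))\<close>; together they cannot bridge the gap
    \<open>3 * \<epsilon>\<close> between \<open>m d\<close> and \<open>m (h A)\<close>.\<close>
  define \<epsilon> where "\<epsilon> = \<bar>m d - m (h A)\<bar> / 3"
  have \<epsilon>: "0 < \<epsilon>" using f(2) by (simp add: \<epsilon>_def m_def)
  have "\<exists>r\<in>h ` VV. r \<le> p \<and> r \<le> q" if pq: "p \<in> h ` VV" "q \<in> h ` VV" for p q
  proof -
    obtain V W where VW: "V \<in> VV" "W \<in> VV" "p = h V" "q = h W" using pq by blast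
    then have "V \<inter> W \<in> VV" by (auto simp: VV_def)
    moreover have "h (V \<inter> W) \<le> p" "h (V \<inter> W) \<le> q"
      unfolding VW(3,4) using calculation VW(1,2) by (auto intro!: hom_mono[OF h VB VB])
    ultimately show ?thesis by blast
  qed
  from order_continuous_dual_directed[OF f(1) _ this \<epsilon>] XV
  obtain V0 where V0: "V0 \<in> VV" "\<And>V. V \<in> VV \<Longrightarrow> h V \<le> h V0 \<Longrightarrow> \<bar>m (h V) - m d\<bar> < \<epsilon>"
    unfolding d_def m_def by auto
  obtain U1 where U1: "open U1" "A \<subseteq> U1" "pos.pos_var (h (U1 - A)) \<le> \<epsilon>"
    using pos.pos_var_outer_regular[OF h A(1) \<epsilon>] by blast
  obtain U2 where U2: "open U2" "A \<subseteq> U2" "neg.pos_var (h (U2 - A)) \<le> \<epsilon>"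
    using neg.pos_var_outer_regular[OF h A(1) \<epsilon>] by blast
  \<comment> \<open>\<open>V0\<close> brings \<open>m (h V)\<close> close to \<open>m d\<close>;
    \<open>U1\<close> bounds the charge of \<open>V - A\<close> from above and \<open>U2\<close>,
    chosen for \<open>- m\<close>, from below.\<close>
  define V where "V = V0 \<inter> U1 \<inter> U2"
  have V: "V \<in> VV"
    using V0(1) U1 U2 unfolding V_def VV_def by (auto intro!: openin_Int_open)
  have UB: "U1 \<in> sets borel" "U2 \<in> sets borel" using U1 U2 by auto
  have VA: "V - A \<in> sets borel" using VB[OF V] A by auto
  have "h V \<le> h V0" by (rule hom_mono[OF h VB[OF V] VB[OF V0(1)]]) (auto simp: V_def)
  then have 1: "\<bar>m (h V) - m d\<bar> < \<epsilon>" by (rule V0(2)[OF V])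
  have "h (V - A) \<le> h (U1 - A)" "h (V - A) \<le> h (U2 - A)"
    using UB A VA by (auto intro!: hom_mono[OF h] simp: V_def)
  then have "m (h (V - A)) \<le> \<epsilon>" "- m (h (V - A)) \<le> \<epsilon>"
    using pos.le_pos_var U1(3) neg.le_pos_var U2(3) order_trans by blast+
  moreover have "m (h V) = m (h A) + m (h (V - A))"
  proof -
    have "inf (h A) (h (V - A)) = bot" by (rule hom_disjoint[OF h A(1) VA]) auto
    moreover have "h V = sup (h A) (h (V - A))"
      using hom_sup[OF h A(1) VA] V by (simp add: VV_def Un_absorb1)
    ultimately show ?thesis using pos.additive by simp
  qed
  ultimately have "\<bar>m d - m (h A)\<bar> < 3 * \<epsilon>" using 1 by linarith
  then show False by (simp add: \<epsilon>_def)
qed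

lemma hom_regular_borel_measure:
  fixes h :: "complex set \<Rightarrow> 'a::dedekind_complete_banach_lattice band_proj"
  assumes normal: "normal_lattice (center :: ('a \<Rightarrow> 'a) set)" and h: "borel_hom h"
    and X: "compact X" "h X = top"
  shows "regular_borel_measure center X (\<lambda>A. app_proj (h A))"
proof -
  have XB: "X \<in> sets borel" using X(1) by (simp add: compact_imp_closed)
  have inner: "is_sup_in center ((\<lambda>A. app_proj (h A)) ` {K. compact K \<and> K \<subseteq> V}) (app_proj (h V))"
    if V: "openin (top_of_set X) V" for V
  proof -
    obtain U where U: "open U" "V = X \<inter> U" using V by (auto simp: openin_open)
    \<comment> \<open>An open planar set is a countable union of compact sets. Their intersections
      with the compact \<open>X\<close> exhaust \<open>V\<close>, and \<open>h\<close> turns this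
      countable union into a supremum.\<close>
    have "\<exists>C :: nat \<Rightarrow> complex set. (\<forall>n. compact (C n)) \<and> (\<forall>n. C n \<subseteq> U) \<and> \<Union>(range C) = U"
      by (rule open_Union_compact_subsets[OF U(1)]) blast
    then obtain C :: "nat \<Rightarrow> complex set" where C: "\<And>n. compact (C n)" "\<And>n. C n \<subseteq> U" "\<Union>(range C) = U"
      by blast
    define K where "K n = X \<inter> C n" for n :: nat
    have K: "compact (K n)" "K n \<subseteq> V" for n
      using X(1) C U by (auto simp: K_def compact_Int)
    have KB: "K n \<in> sets borel" for n using K(1) by (simp add: compact_imp_closed)
    have VB: "V \<in> sets borel" using U XB by auto
    have "(\<Union>n. K n) = V" using C(3) U(2) by (auto simp: K_def)
    then have hV: "h V = (SUP n. h (K n))" using hom_SUP[OF h, of K] KB by simp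
    show ?thesis
      unfolding is_sup_in_def
    proof (intro conjI ballI impI)
      show "app_proj (h V) \<in> center" by (rule app_in_center)
      show "op_le L (app_proj (h V))" if "L \<in> (\<lambda>A. app_proj (h A)) ` {K. compact K \<and> K \<subseteq> V}" for L
        using that VB by (auto simp: op_le_def intro!: app_le_app hom_mono[OF h] borel_closed compact_imp_closed)
      fix W assume W: "W \<in> center" "\<forall>L\<in>(\<lambda>A. app_proj (h A)) ` {K. compact K \<and> K \<subseteq> V}. op_le L W"
      show "op_le (app_proj (h V)) W"
        unfolding op_le_def hV
      proof (intro allI impI)
        fix x :: 'a assume x: "0 \<le> x"
        show "app_proj (SUP n. h (K n)) x \<le> W x"
          by (rule app_Sup_least[OF _ x]) (use W(2) K x in \<open>auto simp: op_le_def\<close>)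
      qed
    qed
  qed
  have outer: "is_inf_in center ((\<lambda>A. app_proj (h A)) ` {V. openin (top_of_set X) V \<and> A \<subseteq> V}) (app_proj (h A))"
    if A: "A \<in> sets borel" "A \<subseteq> X" for A
    unfolding is_inf_in_def
  proof (intro conjI ballI impI)
    show "app_proj (h A) \<in> center" by (rule app_in_center)
    fix L assume "L \<in> (\<lambda>A. app_proj (h A)) ` {V. openin (top_of_set X) V \<and> A \<subseteq> V}"
    then obtain V where V: "L = app_proj (h V)" "openin (top_of_set X) V" "A \<subseteq> V" by blast
    then have "V \<in> sets borel" using XB by (auto simp: openin_open)
    then show "op_le (app_proj (h A)) L"
      unfolding V(1) op_le_def using A V(3) by (intro allI impI app_le_app hom_mono[OF h])
  next
    fix W assume W: "W \<in> center"
      "\<forall>L\<in>(\<lambda>A. app_proj (h A)) ` {V. openin (top_of_set X) V \<and> A \<subseteq> V}. op_le W L"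
    show "op_le W (app_proj (h A))"
      unfolding op_le_def hom_outer_regular[OF normal h XB X(2) A, symmetric]
    proof (intro allI impI)
      fix x :: 'a assume x: "0 \<le> x"
      have "X \<in> {V. openin (top_of_set X) V \<and> A \<subseteq> V}" using A by (simp add: openin_subtopology_self)
      then show "W x \<le> app_proj (INF V\<in>{V. openin (top_of_set X) V \<and> A \<subseteq> V}. h V) x"
        by (intro app_Inf_greatest[OF _ x]) (use W(2) x in \<open>auto simp: op_le_def\<close>)
    qed
  qed
  show ?thesis
    unfolding regular_borel_measure_def
    using borel_hom_op_measure[OF h XB] inner outer by (simp add: sets_borel_on[OF XB])
qed


section \<open>The spectral theorem\<close>

lemma complex_centerE:
  assumes "T \<in> complex_center"
  obtains R S c where "T = complex_op R S" "orth_bound c R" "orth_bound c S"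
proof -
  obtain R S U c where T: "T = complex_op R S" and RS: "R \<in> regular_ops" "S \<in> regular_ops"
    and sup: "is_sup_in regular_ops (range (\<lambda>\<theta>::real. \<lambda>x. cos \<theta> *\<^sub>R R x + sin \<theta> *\<^sub>R S x)) U"
    and U: "op_le U (\<lambda>x. c *\<^sub>R x)"
    using assms by (auto simp: complex_center_def)
  have le: "cos \<theta> *\<^sub>R R x + sin \<theta> *\<^sub>R S x \<le> c *\<^sub>R x" if "0 \<le> x" for \<theta> x
  proof -
    have "cos \<theta> *\<^sub>R R x + sin \<theta> *\<^sub>R S x \<le> U x"
      using sup that by (auto simp: is_sup_in_def op_le_def)
    also have "\<dots> \<le> c *\<^sub>R x" using U that by (simp add: op_le_def)
    finally show ?thesis .
  qed
  have lin: "linear R" "linear S" using RS by (auto simp: regular_ops_def intro: linear_compose_sub)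
  \<comment> \<open>The angles \<open>0\<close> and \<open>pi\<close> bound \<open>R\<close> from
    both sides, \<open>\<plusminus> pi / 2\<close> bound \<open>S\<close>.\<close>
  have "orth_bound c R"
    by (rule orth_boundI[OF lin(1)]) (use le[of _ 0] le[of _ pi] in simp_all)
  moreover have "orth_bound c S"
    by (rule orth_boundI[OF lin(2)]) (use le[of _ "pi / 2"] le[of _ "- (pi / 2)"] in simp_all)
  ultimately show thesis using T that by blast
qed

context spectral_pair
begin

lemma spectral_resolution: "spectral_resolution (complex_op R S) (\<lambda>A. app_proj (h A))"
proof -
  interpret concentrated_measure h "spectrum (complex_op R S)" "\<lambda>A. app_proj (h A)"
    by unfold_locales (auto simp: hom spectrum_borel hom_spectrum)
  have meas: "Re \<in> borel_measurable borel" "Im \<in> borel_measurable borel" by measurable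
  obtain N :: nat where N: "b \<le> real N" using real_arch_simple by blast
  have bd: "\<bar>Re t\<bar> \<le> real N" "\<bar>Im t\<bar> \<le> real N" if "t \<in> spectrum (complex_op R S)" for t
    using spectrum_coordinate_bounds[OF that] N by linarith+
  have id: "(\<lambda>t. t) \<in> borel_measurable (borel_on (spectrum (complex_op R S)))"
    by (rule measurable_restrict_space1) simp
  have "has_order_integral center (borel_on (spectrum (complex_op R S))) (\<lambda>A. app_proj (h A)) (\<lambda>t. t) (complex_op R S)"
    unfolding has_order_integral_def
    using id bounded_spectrum real_integral_of_bounds[OF R bounds_Re meas(1) bd(1)]
      real_integral_of_bounds[OF S bounds_Im meas(2) bd(2)]
    by (auto simp: space_X)
  moreover have "app_proj (h (spectrum (complex_op R S))) = id"
    by (simp add: hom_spectrum app_top fun_eq_iff)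
  ultimately show ?thesis
    unfolding spectral_resolution_def
    using borel_hom_op_measure[OF hom spectrum_borel] borel_hom_spectral[OF hom spectrum_borel] by blast
qed

lemma spectral_resolution_unique:
  assumes \<nu>: "spectral_resolution (complex_op R S) \<nu>"
    and A: "A \<in> sets (borel_on (spectrum (complex_op R S)))"
  shows "\<nu> A = app_proj (h A)"
proof -
  let ?X = "spectrum (complex_op R S)"
  obtain g where g: "borel_hom g" "g ?X = top" "\<And>A. A \<in> sets (borel_on ?X) \<Longrightarrow> \<nu> A = app_proj (g A)"
    using \<nu> spectral_measure_borel_hom[OF _ _ _ spectrum_borel, of \<nu>] unfolding spectral_resolution_def by blast
  interpret concentrated_measure g ?X \<nu>
    by unfold_locales (use g spectrum_borel in auto)
  obtain A' B' where int: "has_real_order_integral center (borel_on ?X) \<nu> Re A'"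
    "has_real_order_integral center (borel_on ?X) \<nu> Im B'" and eq: "complex_op R S = complex_op A' B'"
    using \<nu> unfolding spectral_resolution_def has_order_integral_def by auto
  have meas: "Re \<in> borel_measurable borel" "Im \<in> borel_measurable borel" by measurable
  note int' = real_integral_bounds[OF int(1) meas(1)] real_integral_bounds[OF int(2) meas(2)]
  have zero: "R 0 = 0" "S 0 = 0" "A' 0 = 0" "B' 0 = 0"
    using orth_boundD(1)[OF R] orth_boundD(1)[OF S] int'(2,4) center_linear linear_0 by blast+
  \<comment> \<open>Evaluation at \<open>(x, 0)\<close> recovers both components of a complex
    operator.\<close>
  have "R = A'" "S = B'"
    using fun_cong[OF eq, of "(_, 0)"] by (auto simp: complex_op_pair zero fun_eq_iff)
  then have "spectral_hom R S g" using g(1) int'(1,3) by (simp add: spectral_hom_def)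
  moreover have "A \<in> sets borel" using A by (simp add: sets_borel_on[OF spectrum_borel])
  ultimately have "g A = h A" using spectral_hom_unique[OF R S _ spectral] by blast
  then show ?thesis using g(3)[OF A] by simp
qed

end

text \<open>A measure is a total function with arbitrary values off the Borel subsets of the
  spectrum, so uniqueness is asserted on those subsets.\<close>

theorem theorem4p6:
  fixes T :: "'a::dedekind_complete_banach_lattice \<times> 'a \<Rightarrow> 'a \<times> 'a"
  assumes "normal_lattice (center :: ('a \<Rightarrow> 'a) set)"
    and "T \<in> complex_center"
  shows "\<exists>\<mu>. spectral_resolution T \<mu> \<and>
    (\<forall>\<nu>. spectral_resolution T \<nu> \<longrightarrow> (\<forall>\<Delta>\<in>sets (borel_on (spectrum T)). \<nu> \<Delta> = \<mu> \<Delta>)) \<and>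
    regular_borel_measure center (spectrum T) \<mu> \<and>
    (\<forall>\<Delta>\<in>sets (borel_on (spectrum T)). order_projection (\<mu> \<Delta>)) \<and>
    (\<forall>V. openin (top_of_set (spectrum T)) V \<longrightarrow> V \<noteq> {} \<longrightarrow>
      op_le (\<lambda>_. 0) (\<mu> V) \<and> \<mu> V \<noteq> (\<lambda>_. 0))"
proof -
  obtain R S c where T: "T = complex_op R S" and R: "orth_bound c R" and S: "orth_bound c S"
    by (rule complex_centerE[OF assms(2)])
  obtain h where h: "spectral_hom R S h" using spectral_hom_exists[OF R S] by blast
  interpret spectral_pair R S h c by unfold_locales (rule R S h)+
  show ?thesis
    unfolding T
  proof (intro exI[of _ "\<lambda>A. app_proj (h A)"] conjI allI impI ballI)
    show "spectral_resolution (complex_op R S) (\<lambda>A. app_proj (h A))" by (rule spectral_resolution)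
    show "\<nu> A = app_proj (h A)"
      if "spectral_resolution (complex_op R S) \<nu>" "A \<in> sets (borel_on (spectrum (complex_op R S)))" for \<nu> A
      by (rule spectral_resolution_unique[OF that])
    show "regular_borel_measure center (spectrum (complex_op R S)) (\<lambda>A. app_proj (h A))"
      by (rule hom_regular_borel_measure[OF assms(1) hom compact_spectrum hom_spectrum])
    show "order_projection (app_proj (h A))" for A by (rule order_projection_app)
    fix V assume V: "openin (top_of_set (spectrum (complex_op R S))) V" "V \<noteq> {}"
    show "op_le (\<lambda>_. 0) (app_proj (h V))" by (simp add: op_le_def app_nonneg)
    show "app_proj (h V) \<noteq> (\<lambda>_. 0)"
      using hom_open_nonzero[OF V] band_proj_eqI[of "h V" bot] by (auto simp: app_bot)
  qed
qed

end
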